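(* Let $k$ be a commutative ring and let $\mathcal{C}$ be a locally presentable $k$-linear category. Then $\mathcal{C}$ is the $k$-linear filtered bicolimit of its family of full subcategories $(\mathcal{C}^{\alpha})_{\alpha}$ of $\alpha$-presentable objects, where $\alpha$ varies in the totally ordered class $\mathsf{Reg}$ of small regular cardinals, and where the transition functor for $\alpha\le\beta$ is the natural embedding $\mathcal{C}^{\alpha}\subseteq\mathcal{C}^{\beta}$.
   Context: Set theory: we work in Tarski–Grothendieck set theory with a fixed universe $\mathcal{U}$; "small" means $\mathcal{U}$-small, and $k$ is a small commutative ring. The totally ordered class $\mathsf{Reg}$ of small regular cardinals, seen as a category, and the large categories considered here are small with respect to a larger universe $\mathcal{V}$; $\mathsf{Cat}$ (resp. $\mathsf{Cat}(k)$), the $2$-category of categories (resp. $k$-linear categories), is understood with respect to a large enough universe. Essentially small categories are treated as small. An object $C$ of a $k$-linear category $\mathcal{C}$ is $\alpha$-presentable if $\mathcal{C}(C,-):\mathcal{C}\to\mathsf{Mod}(k)$ preserves $\alpha$-filtered colimits; $\mathcal{C}^{\alpha}$ is the full subcategory of $\alpha$-presentable objects; for $\alpha\le\beta$ one has $\mathcal{C}^\alpha\subseteq\mathcal{C}^\beta$. $\mathcal{C}$ is locally $\alpha$-presentable if it is cocomplete and has a small set of $\alpha$-presentable objects such that every object is an $\alpha$-filtered colimit of objects in this set; it is locally presentable if it is locally $\alpha$-presentable for some small regular cardinal $\alpha$. Filtered bicolimit: given a filtered category $\mathcal{I}$ and a pseudofunctor $F:\mathcal{I}\to\mathsf{Cat}$,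 the filtered bicolimit of $F$ is a category $\mathcal{L}(F)$ with a pseudonatural transformation from $F$ to the constant $2$-functor at $\mathcal{L}(F)$ which, for every category $\mathcal{D}$, induces by composition an equivalence of categories $\mathsf{Cat}(\mathcal{L}(F),\mathcal{D})\cong\mathsf{Psnat}(F,\mathcal{D})$, where $\mathsf{Psnat}(F,\mathcal{D})$ is the category of pseudonatural transformations from $F$ to the constant $2$-functor at $\mathcal{D}$, with modifications as morphisms. It is unique up to equivalence. If $F$ takes values in $k$-linear categories and $k$-linear functors, the $k$-linear filtered bicolimit is defined by the same property with $\mathsf{Cat}$ replaced by $\mathsf{Cat}(k)$ and $\mathsf{Psnat}$ by its $k$-linear analogue; its underlying category is the filtered bicolimit. *)

theory Defs
  imports "HOL-Algebra.Module"
begin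

unbundle cardinal_syntax

section \<open>The universe and small regular cardinals\<close>

text \<open>
  The universe is modelled by a type \<open>'u\<close> whose cardinality is (strongly) inaccessible, as is
  the cardinality of a Grothendieck universe containing the natural numbers. A set of any type
  is small if it has fewer elements than \<open>'u\<close>; by inaccessibility these are, up to bijection,
  the sets belonging to the universe. In particular every small set is in bijection
  with a subset of \<open>'u\<close>.

  The canonical well-order \<open>univ_card\<close> of \<open>'u\<close> is an initial ordinal, so that an element of
  \<open>'u\<close> stands for a small ordinal, namely for the set of its predecessors; each small ordinal is
  obtained exactly once.
\<close>

definition univ_card :: "'u rel" where
  "univ_card = |UNIV :: 'u set|"

definition inaccessible :: "'a rel \<Rightarrow> bool" where
  "inaccessible r \<longleftrightarrow> Card_order r \<and> natLeq <o r \<and> regularCard r \<and>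
     (\<forall>A \<subseteq> Field r. |A| <o r \<longrightarrow> |Pow A| <o r)"

definition small :: "'u itself \<Rightarrow> 'a set \<Rightarrow> bool" where
  "small (_ :: 'u itself) A \<longleftrightarrow> |A| <o (univ_card :: 'u rel)"

definition ordinal :: "'u \<Rightarrow> 'u rel" where
  "ordinal \<alpha> = Restr univ_card (underS univ_card \<alpha>)"

definition small_regular_cardinals :: "'u set" where
  "small_regular_cardinals = {\<alpha>. Cinfinite (ordinal \<alpha>) \<and> regularCard (ordinal \<alpha>)}"


section \<open>Categories, functors, natural transformations\<close>

text \<open>
  Composition is written in the usual order: for \<open>f : a \<rightarrow> b\<close> and \<open>g : b \<rightarrow> c\<close>, the composite is
  \<open>Cmp C a b c g f\<close>. Hom-sets are indexed by objects and need not be disjoint.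
\<close>

record ('o, 'm) cat =
  Obj :: "'o set"
  Hom :: "'o \<Rightarrow> 'o \<Rightarrow> 'm set"
  Cmp :: "'o \<Rightarrow> 'o \<Rightarrow> 'o \<Rightarrow> 'm \<Rightarrow> 'm \<Rightarrow> 'm"
  Idn :: "'o \<Rightarrow> 'm"

locale category =
  fixes C :: "('o, 'm, 'x) cat_scheme"
  assumes Idn_closed: "a \<in> Obj C \<Longrightarrow> Idn C a \<in> Hom C a a"
    and Cmp_closed: "\<lbrakk>a \<in> Obj C; b \<in> Obj C; c \<in> Obj C; f \<in> Hom C a b; g \<in> Hom C b c\<rbrakk>
      \<Longrightarrow> Cmp C a b c g f \<in> Hom C a c"
    and Cmp_Idn_right: "\<lbrakk>a \<in> Obj C; b \<in> Obj C; f \<in> Hom C a b\<rbrakk> \<Longrightarrow> Cmp C a a b f (Idn C a) = f"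
    and Cmp_Idn_left: "\<lbrakk>a \<in> Obj C; b \<in> Obj C; f \<in> Hom C a b\<rbrakk> \<Longrightarrow> Cmp C a b b (Idn C b) f = f"
    and Cmp_assoc: "\<lbrakk>a \<in> Obj C; b \<in> Obj C; c \<in> Obj C; d \<in> Obj C;
        f \<in> Hom C a b; g \<in> Hom C b c; h \<in> Hom C c d\<rbrakk>
      \<Longrightarrow> Cmp C a c d h (Cmp C a b c g f) = Cmp C a b d (Cmp C b c d h g) f"

definition is_iso :: "('o, 'm, 'x) cat_scheme \<Rightarrow> 'o \<Rightarrow> 'o \<Rightarrow> 'm \<Rightarrow> bool" where
  "is_iso C a b f \<longleftrightarrow> f \<in> Hom C a b \<and>
     (\<exists>g \<in> Hom C b a. Cmp C a b a g f = Idn C a \<and> Cmp C b a b f g = Idn C b)"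

definition full_subcategory ::
  "('o, 'm, 'x) cat_scheme \<Rightarrow> 'o set \<Rightarrow> ('o, 'm, 'x) cat_scheme" where
  "full_subcategory C S = C\<lparr>Obj := S\<rparr>"

definition arrows :: "('o, 'm, 'x) cat_scheme \<Rightarrow> ('o \<times> 'o \<times> 'm) set" where
  "arrows C = {(a, b, f). a \<in> Obj C \<and> b \<in> Obj C \<and> f \<in> Hom C a b}"

text \<open>
  Functors and natural transformations are required to take the value \<open>undefined\<close> outside
  their domain, so that their equality is equality on the domain; \<open>mk_fct\<close> restricts
  an object map and an arrow map accordingly.
\<close>

record ('o, 'm, 'p, 'n) fct =
  fob :: "'o \<Rightarrow> 'p"
  far :: "'o \<Rightarrow> 'o \<Rightarrow> 'm \<Rightarrow> 'n"

definition mk_fct ::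
  "('o, 'm, 'x) cat_scheme \<Rightarrow> ('o \<Rightarrow> 'p) \<Rightarrow> ('o \<Rightarrow> 'o \<Rightarrow> 'm \<Rightarrow> 'n) \<Rightarrow> ('o, 'm, 'p, 'n) fct" where
  "mk_fct C fo fa =
     \<lparr>fob = (\<lambda>a \<in> Obj C. fo a),
      far = (\<lambda>a b f. if (a, b, f) \<in> arrows C then fa a b f else undefined)\<rparr>"

definition is_functor ::
  "('o, 'm, 'x) cat_scheme \<Rightarrow> ('p, 'n, 'y) cat_scheme \<Rightarrow> ('o, 'm, 'p, 'n) fct \<Rightarrow> bool" where
  "is_functor C D F \<longleftrightarrow>
     F = mk_fct C (fob F) (far F) \<and>
     (\<forall>a \<in> Obj C. fob F a \<in> Obj D) \<and>
     (\<forall>a \<in> Obj C. \<forall>b \<in> Obj C. \<forall>f \<in> Hom C a b. far F a b f \<in> Hom D (fob F a) (fob F b)) \<and>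
     (\<forall>a \<in> Obj C. far F a a (Idn C a) = Idn D (fob F a)) \<and>
     (\<forall>a \<in> Obj C. \<forall>b \<in> Obj C. \<forall>c \<in> Obj C. \<forall>f \<in> Hom C a b. \<forall>g \<in> Hom C b c.
        far F a c (Cmp C a b c g f) =
          Cmp D (fob F a) (fob F b) (fob F c) (far F b c g) (far F a b f))"

definition fct_id :: "('o, 'm, 'x) cat_scheme \<Rightarrow> ('o, 'm, 'o, 'm) fct" where
  "fct_id C = mk_fct C (\<lambda>a. a) (\<lambda>a b f. f)"

text \<open>The composite functor \<open>G \<circ> F\<close>, where \<open>F\<close> has domain \<open>C\<close>.\<close>

definition fct_comp ::
  "('o, 'm, 'x) cat_scheme \<Rightarrow> ('p, 'n, 'q, 'l) fct \<Rightarrow> ('o, 'm, 'p, 'n) fct \<Rightarrow> ('o, 'm, 'q, 'l) fct"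
where
  "fct_comp C G F =
     mk_fct C (\<lambda>a. fob G (fob F a)) (\<lambda>a b f. far G (fob F a) (fob F b) (far F a b f))"

definition is_nat_trans ::
  "('o, 'm, 'x) cat_scheme \<Rightarrow> ('p, 'n, 'y) cat_scheme \<Rightarrow> ('o, 'm, 'p, 'n) fct \<Rightarrow>
     ('o, 'm, 'p, 'n) fct \<Rightarrow> ('o \<Rightarrow> 'n) \<Rightarrow> bool" where
  "is_nat_trans C D F G \<eta> \<longleftrightarrow>
     \<eta> \<in> extensional (Obj C) \<and>
     (\<forall>a \<in> Obj C. \<eta> a \<in> Hom D (fob F a) (fob G a)) \<and>
     (\<forall>a \<in> Obj C. \<forall>b \<in> Obj C. \<forall>f \<in> Hom C a b.
        Cmp D (fob F a) (fob F b) (fob G b) (\<eta> b) (far F a b f) =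
        Cmp D (fob F a) (fob G a) (fob G b) (far G a b f) (\<eta> a))"

definition is_nat_iso ::
  "('o, 'm, 'x) cat_scheme \<Rightarrow> ('p, 'n, 'y) cat_scheme \<Rightarrow> ('o, 'm, 'p, 'n) fct \<Rightarrow>
     ('o, 'm, 'p, 'n) fct \<Rightarrow> ('o \<Rightarrow> 'n) \<Rightarrow> bool" where
  "is_nat_iso C D F G \<eta> \<longleftrightarrow>
     is_nat_trans C D F G \<eta> \<and> (\<forall>a \<in> Obj C. is_iso D (fob F a) (fob G a) (\<eta> a))"

definition is_equivalence ::
  "('o, 'm, 'x) cat_scheme \<Rightarrow> ('p, 'n, 'y) cat_scheme \<Rightarrow> ('o, 'm, 'p, 'n) fct \<Rightarrow> bool" where
  "is_equivalence C D F \<longleftrightarrow>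
     is_functor C D F \<and>
     (\<exists>G. is_functor D C G \<and>
        (\<exists>\<eta>. is_nat_iso C C (fct_id C) (fct_comp C G F) \<eta>) \<and>
        (\<exists>\<epsilon>. is_nat_iso D D (fct_comp D F G) (fct_id D) \<epsilon>))"

definition preorder_cat :: "'i set \<Rightarrow> 'i rel \<Rightarrow> ('i, unit) cat" where
  "preorder_cat A r =
     \<lparr>Obj = A, Hom = (\<lambda>a b. {_. (a, b) \<in> r}), Cmp = (\<lambda>a b c g f. ()), Idn = (\<lambda>a. ())\<rparr>"


section \<open>Colimits\<close>

definition is_cocone ::
  "('i, 'j, 'x) cat_scheme \<Rightarrow> ('o, 'm, 'y) cat_scheme \<Rightarrow> ('i, 'j, 'o, 'm) fct \<Rightarrow> 'o \<Rightarrow> ('i \<Rightarrow> 'm) \<Rightarrow> bool"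
where
  "is_cocone J C D L l \<longleftrightarrow>
     L \<in> Obj C \<and>
     (\<forall>i \<in> Obj J. l i \<in> Hom C (fob D i) L) \<and>
     (\<forall>i \<in> Obj J. \<forall>j \<in> Obj J. \<forall>u \<in> Hom J i j. Cmp C (fob D i) (fob D j) L (l j) (far D i j u) = l i)"

definition is_colimit ::
  "('i, 'j, 'x) cat_scheme \<Rightarrow> ('o, 'm, 'y) cat_scheme \<Rightarrow> ('i, 'j, 'o, 'm) fct \<Rightarrow> 'o \<Rightarrow> ('i \<Rightarrow> 'm) \<Rightarrow> bool"
where
  "is_colimit J C D L l \<longleftrightarrow>
     is_cocone J C D L l \<and>
     (\<forall>M m. is_cocone J C D M m \<longrightarrow>
        (\<exists>!h. h \<in> Hom C L M \<and> (\<forall>i \<in> Obj J. Cmp C (fob D i) L M h (l i) = m i)))"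

text \<open>
  \<open>J\<close> is \<open>r\<close>-filtered, for an infinite regular cardinal \<open>r\<close>, if every diagram in \<open>J\<close> with fewer
  than \<open>r\<close> arrows has a cocone. Up to isomorphism, every category with fewer than \<open>r\<close> arrows has
  its objects and arrows in the type underlying \<open>r\<close>. Filtered means \<open>natLeq\<close>-filtered.
\<close>

definition is_filtered :: "'s rel \<Rightarrow> ('i, 'j, 'x) cat_scheme \<Rightarrow> bool" where
  "is_filtered (r :: 's rel) J \<longleftrightarrow>
     (\<forall>K :: ('s, 's) cat. \<forall>D. category K \<and> |arrows K| <o r \<and> is_functor K J D \<longrightarrow>
        (\<exists>L l. is_cocone K J D L l))"

text \<open>Up to isomorphism, every small category has its objects and arrows in \<open>'u\<close>.\<close>

definition small_category :: "('u, 'u) cat \<Rightarrow> bool" where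
  "small_category J \<longleftrightarrow> category J \<and> small TYPE('u) (arrows J)"

definition cocomplete :: "'u itself \<Rightarrow> ('o, 'm, 'x) cat_scheme \<Rightarrow> bool" where
  "cocomplete (_ :: 'u itself) C \<longleftrightarrow>
     (\<forall>J :: ('u, 'u) cat. \<forall>D. small_category J \<and> is_functor J C D \<longrightarrow> (\<exists>L l. is_colimit J C D L l))"

definition preserves_filtered_colimits ::
  "'u \<Rightarrow> ('o, 'm, 'x) cat_scheme \<Rightarrow> ('p, 'n, 'y) cat_scheme \<Rightarrow> ('o, 'm, 'p, 'n) fct \<Rightarrow> bool" where
  "preserves_filtered_colimits (\<alpha> :: 'u) C E F \<longleftrightarrow>
     (\<forall>J :: ('u, 'u) cat. \<forall>D L l.
        small_category J \<and> is_filtered (ordinal \<alpha>) J \<and> is_functor J C D \<and> is_colimit J C D L l \<longrightarrow>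
        is_colimit J E (fct_comp J F D) (fob F L) (\<lambda>i. far F (fob D i) L (l i)))"


section \<open>\<open>k\<close>-linear categories\<close>

definition linear_map ::
  "('k, 'r) ring_scheme \<Rightarrow> ('k, 'a, 'x) module_scheme \<Rightarrow> ('k, 'b, 'y) module_scheme \<Rightarrow> ('a \<Rightarrow> 'b) \<Rightarrow> bool"
where
  "linear_map k M N h \<longleftrightarrow>
     h \<in> carrier M \<rightarrow> carrier N \<and>
     (\<forall>x \<in> carrier M. \<forall>y \<in> carrier M. h (x \<oplus>\<^bsub>M\<^esub> y) = h x \<oplus>\<^bsub>N\<^esub> h y) \<and>
     (\<forall>r \<in> carrier k. \<forall>x \<in> carrier M. h (r \<odot>\<^bsub>M\<^esub> x) = r \<odot>\<^bsub>N\<^esub> h x)"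

text \<open>
  The category of small \<open>k\<close>-modules. Up to isomorphism, every small module has its carrier in
  \<open>'u\<close>. (The multiplication and unit fields that the record type of modules inherits from rings
  are irrelevant.)
\<close>

definition Mod :: "('k, 'r) ring_scheme \<Rightarrow> (('k, 'u) module, 'u \<Rightarrow> 'u) cat" where
  "Mod k =
     \<lparr>Obj = {M. module k M \<and> small TYPE('u) (carrier M)},
      Hom = (\<lambda>M N. {h. linear_map k M N h \<and> h \<in> extensional (carrier M)}),
      Cmp = (\<lambda>M N P g f. compose (carrier M) g f),
      Idn = (\<lambda>M. \<lambda>x \<in> carrier M. x)\<rparr>"

record ('o, 'm, 'k) kcat = "('o, 'm) cat" +
  hmod :: "'o \<Rightarrow> 'o \<Rightarrow> ('k, 'm) module"

locale klinear_category = category C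
  for k :: "('k, 'r) ring_scheme" and C :: "('o, 'm, 'k) kcat" +
  assumes hmod_module: "\<lbrakk>a \<in> Obj C; b \<in> Obj C\<rbrakk> \<Longrightarrow> module k (hmod C a b)"
    and hmod_carrier: "\<lbrakk>a \<in> Obj C; b \<in> Obj C\<rbrakk> \<Longrightarrow> carrier (hmod C a b) = Hom C a b"
    and Cmp_linear_left: "\<lbrakk>a \<in> Obj C; b \<in> Obj C; c \<in> Obj C; f \<in> Hom C a b\<rbrakk>
      \<Longrightarrow> linear_map k (hmod C b c) (hmod C a c) (\<lambda>g. Cmp C a b c g f)"
    and Cmp_linear_right: "\<lbrakk>a \<in> Obj C; b \<in> Obj C; c \<in> Obj C; g \<in> Hom C b c\<rbrakk>
      \<Longrightarrow> linear_map k (hmod C a b) (hmod C a c) (\<lambda>f. Cmp C a b c g f)"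

definition klinear_functor ::
  "('k, 'r) ring_scheme \<Rightarrow> ('o, 'm, 'k) kcat \<Rightarrow> ('p, 'n, 'k) kcat \<Rightarrow> ('o, 'm, 'p, 'n) fct \<Rightarrow> bool"
where
  "klinear_functor k C D F \<longleftrightarrow>
     is_functor C D F \<and>
     (\<forall>a \<in> Obj C. \<forall>b \<in> Obj C. linear_map k (hmod C a b) (hmod D (fob F a) (fob F b)) (far F a b))"

text \<open>The hom-category \<open>Cat(k)(C, D)\<close>.\<close>

definition klinear_functor_cat ::
  "('k, 'r) ring_scheme \<Rightarrow> ('o, 'm, 'k) kcat \<Rightarrow> ('p, 'n, 'k) kcat \<Rightarrow>
     (('o, 'm, 'p, 'n) fct, 'o \<Rightarrow> 'n) cat" where
  "klinear_functor_cat k C D =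
     \<lparr>Obj = {F. klinear_functor k C D F},
      Hom = (\<lambda>F G. {\<eta>. is_nat_trans C D F G \<eta>}),
      Cmp = (\<lambda>F G H \<theta> \<eta>. \<lambda>a \<in> Obj C. Cmp D (fob F a) (fob G a) (fob H a) (\<theta> a) (\<eta> a)),
      Idn = (\<lambda>F. \<lambda>a \<in> Obj C. Idn D (fob F a))\<rparr>"


section \<open>Locally presentable \<open>k\<close>-linear categories\<close>

text \<open>
  From here on the arrows of the categories to which presentability applies are elements of \<open>'u\<close>:
  hom-sets are small (\<open>C(X, -)\<close> takes values in \<open>Mod k\<close>), hence may be taken to be subsets
  of \<open>'u\<close>, as hom-sets need not be disjoint. The type of objects remains arbitrary.
\<close>

definition hom_functor :: "('o, 'u, 'k) kcat \<Rightarrow> 'o \<Rightarrow> ('o, 'u, ('k, 'u) module, 'u \<Rightarrow> 'u) fct" where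
  "hom_functor C X =
     mk_fct C (\<lambda>Y. hmod C X Y) (\<lambda>Y Z f. \<lambda>g \<in> Hom C X Y. Cmp C X Y Z f g)"

definition presentable :: "('k, 'r) ring_scheme \<Rightarrow> ('o, 'u, 'k) kcat \<Rightarrow> 'u \<Rightarrow> 'o \<Rightarrow> bool" where
  "presentable k C \<alpha> X \<longleftrightarrow>
     X \<in> Obj C \<and>
     is_functor C (Mod k) (hom_functor C X) \<and>
     preserves_filtered_colimits \<alpha> C (Mod k) (hom_functor C X)"

definition presentables :: "('k, 'r) ring_scheme \<Rightarrow> ('o, 'u, 'k) kcat \<Rightarrow> 'u \<Rightarrow> ('o, 'u, 'k) kcat" where
  "presentables k C \<alpha> = full_subcategory C {X. presentable k C \<alpha> X}"

definition locally_presentable_at :: "('k, 'r) ring_scheme \<Rightarrow> ('o, 'u, 'k) kcat \<Rightarrow> 'u \<Rightarrow> bool" where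
  "locally_presentable_at k C (\<alpha> :: 'u) \<longleftrightarrow>
     cocomplete TYPE('u) C \<and>
     (\<exists>G. small TYPE('u) G \<and> (\<forall>X \<in> G. presentable k C \<alpha> X) \<and>
        (\<forall>X \<in> Obj C. \<exists>(J :: ('u, 'u) cat) D l.
           small_category J \<and> is_filtered (ordinal \<alpha>) J \<and> is_functor J C D \<and>
           (\<forall>i \<in> Obj J. fob D i \<in> G) \<and> is_colimit J C D X l))"

definition locally_presentable :: "('k, 'r) ring_scheme \<Rightarrow> ('o, 'u, 'k) kcat \<Rightarrow> bool" where
  "locally_presentable k C \<longleftrightarrow> (\<exists>\<alpha> \<in> small_regular_cardinals. locally_presentable_at k C \<alpha>)"


section \<open>Pseudofunctors and filtered bicolimits\<close>

text \<open>
  Pseudofunctors \<open>P : I \<rightarrow> Cat(k)\<close> on a \<open>1\<close>-category \<open>I\<close>, with compositors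
  \<open>pf_cmp P i j l g f : P(g) \<circ> P(f) \<Rightarrow> P(g \<circ> f)\<close> for \<open>f : i \<rightarrow> j\<close>, \<open>g : j \<rightarrow> l\<close>, and unitors
  \<open>pf_unit P i : id \<Rightarrow> P(id)\<close>. The equations between \<open>2\<close>-cells here and below are spelled out on
  components.
\<close>

record ('i, 'j, 'o, 'm, 'k) psfct =
  pf_ob :: "'i \<Rightarrow> ('o, 'm, 'k) kcat"
  pf_ar :: "'i \<Rightarrow> 'i \<Rightarrow> 'j \<Rightarrow> ('o, 'm, 'o, 'm) fct"
  pf_cmp :: "'i \<Rightarrow> 'i \<Rightarrow> 'i \<Rightarrow> 'j \<Rightarrow> 'j \<Rightarrow> 'o \<Rightarrow> 'm"
  pf_unit :: "'i \<Rightarrow> 'o \<Rightarrow> 'm"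

locale klinear_pseudofunctor = category I
  for k :: "('k, 'r) ring_scheme" and I :: "('i, 'j, 'x) cat_scheme"
    and P :: "('i, 'j, 'o, 'm, 'k) psfct" +
  assumes pf_ob: "i \<in> Obj I \<Longrightarrow> klinear_category k (pf_ob P i)"
    and pf_ar: "\<lbrakk>i \<in> Obj I; j \<in> Obj I; f \<in> Hom I i j\<rbrakk>
      \<Longrightarrow> klinear_functor k (pf_ob P i) (pf_ob P j) (pf_ar P i j f)"
    and pf_cmp: "\<lbrakk>i \<in> Obj I; j \<in> Obj I; l \<in> Obj I; f \<in> Hom I i j; g \<in> Hom I j l\<rbrakk>
      \<Longrightarrow> is_nat_iso (pf_ob P i) (pf_ob P l)
            (fct_comp (pf_ob P i) (pf_ar P j l g) (pf_ar P i j f))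
            (pf_ar P i l (Cmp I i j l g f))
            (pf_cmp P i j l g f)"
    and pf_unit: "i \<in> Obj I
      \<Longrightarrow> is_nat_iso (pf_ob P i) (pf_ob P i) (fct_id (pf_ob P i)) (pf_ar P i i (Idn I i)) (pf_unit P i)"
    and pf_assoc: "\<lbrakk>i \<in> Obj I; j \<in> Obj I; l \<in> Obj I; m \<in> Obj I;
        f \<in> Hom I i j; g \<in> Hom I j l; h \<in> Hom I l m; x \<in> Obj (pf_ob P i);
        gf = Cmp I i j l g f; hg = Cmp I j l m h g; hgf = Cmp I i l m h gf;
        y = fob (pf_ar P i j f) x; z = fob (pf_ar P j l g) y; w = fob (pf_ar P l m h) z\<rbrakk>
      \<Longrightarrow> Cmp (pf_ob P m)
             w (fob (pf_ar P l m h) (fob (pf_ar P i l gf) x)) (fob (pf_ar P i m hgf) x)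
             (pf_cmp P i l m h gf x)
             (far (pf_ar P l m h) z (fob (pf_ar P i l gf) x) (pf_cmp P i j l g f x)) =
          Cmp (pf_ob P m)
             w (fob (pf_ar P j m hg) y) (fob (pf_ar P i m hgf) x)
             (pf_cmp P i j m hg f x)
             (pf_cmp P j l m h g y)"
    and pf_unit_right: "\<lbrakk>i \<in> Obj I; j \<in> Obj I; f \<in> Hom I i j; x \<in> Obj (pf_ob P i);
        y = fob (pf_ar P i j f) x; x' = fob (pf_ar P i i (Idn I i)) x\<rbrakk>
      \<Longrightarrow> Cmp (pf_ob P j) y (fob (pf_ar P i j f) x') y
             (pf_cmp P i i j f (Idn I i) x)
             (far (pf_ar P i j f) x x' (pf_unit P i x)) = Idn (pf_ob P j) y"
    and pf_unit_left: "\<lbrakk>i \<in> Obj I; j \<in> Obj I; f \<in> Hom I i j; x \<in> Obj (pf_ob P i);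
        y = fob (pf_ar P i j f) x\<rbrakk>
      \<Longrightarrow> Cmp (pf_ob P j) y (fob (pf_ar P j j (Idn I j)) y) y
             (pf_cmp P i j j (Idn I j) f x)
             (pf_unit P j y) = Idn (pf_ob P j) y"

text \<open>
  Pseudonatural transformations \<open>s\<close> from \<open>P\<close> to the constant \<open>2\<close>-functor at \<open>D\<close>, with
  \<open>k\<close>-linear components \<open>s(i) : P(i) \<rightarrow> D\<close> and invertible \<open>2\<close>-cells
  \<open>s(f) : s(i) \<Rightarrow> s(j) \<circ> P(f)\<close> for \<open>f : i \<rightarrow> j\<close>.
\<close>

record ('i, 'j, 'o, 'm, 'p, 'n) psnat =
  pn_ob :: "'i \<Rightarrow> ('o, 'm, 'p, 'n) fct"
  pn_cell :: "'i \<Rightarrow> 'i \<Rightarrow> 'j \<Rightarrow> 'o \<Rightarrow> 'n"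

definition mk_psnat ::
  "('i, 'j, 'x) cat_scheme \<Rightarrow> ('i \<Rightarrow> ('o, 'm, 'p, 'n) fct) \<Rightarrow> ('i \<Rightarrow> 'i \<Rightarrow> 'j \<Rightarrow> 'o \<Rightarrow> 'n) \<Rightarrow>
     ('i, 'j, 'o, 'm, 'p, 'n) psnat" where
  "mk_psnat I so sc =
     \<lparr>pn_ob = (\<lambda>i \<in> Obj I. so i),
      pn_cell = (\<lambda>i j f. if (i, j, f) \<in> arrows I then sc i j f else undefined)\<rparr>"

definition is_psnat ::
  "('k, 'r) ring_scheme \<Rightarrow> ('i, 'j, 'x) cat_scheme \<Rightarrow> ('i, 'j, 'o, 'm, 'k) psfct \<Rightarrow>
     ('p, 'n, 'k) kcat \<Rightarrow> ('i, 'j, 'o, 'm, 'p, 'n) psnat \<Rightarrow> bool" where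
  "is_psnat k I P D s \<longleftrightarrow>
     s = mk_psnat I (pn_ob s) (pn_cell s) \<and>
     (\<forall>i \<in> Obj I. klinear_functor k (pf_ob P i) D (pn_ob s i)) \<and>
     (\<forall>i \<in> Obj I. \<forall>j \<in> Obj I. \<forall>f \<in> Hom I i j.
        is_nat_iso (pf_ob P i) D (pn_ob s i) (fct_comp (pf_ob P i) (pn_ob s j) (pf_ar P i j f))
          (pn_cell s i j f)) \<and>
     (\<forall>i \<in> Obj I. \<forall>j \<in> Obj I. \<forall>l \<in> Obj I. \<forall>f \<in> Hom I i j. \<forall>g \<in> Hom I j l. \<forall>x \<in> Obj (pf_ob P i).
        let gf = Cmp I i j l g f;
            y = fob (pf_ar P i j f) x; z = fob (pf_ar P j l g) y; z' = fob (pf_ar P i l gf) x;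
            a = fob (pn_ob s i) x; b = fob (pn_ob s j) y; c = fob (pn_ob s l) z; d = fob (pn_ob s l) z'
        in pn_cell s i l gf x =
             Cmp D a c d (far (pn_ob s l) z z' (pf_cmp P i j l g f x))
               (Cmp D a b c (pn_cell s j l g y) (pn_cell s i j f x))) \<and>
     (\<forall>i \<in> Obj I. \<forall>x \<in> Obj (pf_ob P i).
        pn_cell s i i (Idn I i) x =
          far (pn_ob s i) x (fob (pf_ar P i i (Idn I i)) x) (pf_unit P i x))"

definition is_modification ::
  "('i, 'j, 'x) cat_scheme \<Rightarrow> ('i, 'j, 'o, 'm, 'k) psfct \<Rightarrow> ('p, 'n, 'k) kcat \<Rightarrow>
     ('i, 'j, 'o, 'm, 'p, 'n) psnat \<Rightarrow> ('i, 'j, 'o, 'm, 'p, 'n) psnat \<Rightarrow> ('i \<Rightarrow> 'o \<Rightarrow> 'n) \<Rightarrow> bool"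
where
  "is_modification I P D s t \<mu> \<longleftrightarrow>
     \<mu> \<in> extensional (Obj I) \<and>
     (\<forall>i \<in> Obj I. is_nat_trans (pf_ob P i) D (pn_ob s i) (pn_ob t i) (\<mu> i)) \<and>
     (\<forall>i \<in> Obj I. \<forall>j \<in> Obj I. \<forall>f \<in> Hom I i j. \<forall>x \<in> Obj (pf_ob P i).
        let y = fob (pf_ar P i j f) x
        in Cmp D (fob (pn_ob s i) x) (fob (pn_ob t i) x) (fob (pn_ob t j) y)
             (pn_cell t i j f x) (\<mu> i x) =
           Cmp D (fob (pn_ob s i) x) (fob (pn_ob s j) y) (fob (pn_ob t j) y)
             (\<mu> j y) (pn_cell s i j f x))"

definition Psnat ::
  "('k, 'r) ring_scheme \<Rightarrow> ('i, 'j, 'x) cat_scheme \<Rightarrow> ('i, 'j, 'o, 'm, 'k) psfct \<Rightarrow>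
     ('p, 'n, 'k) kcat \<Rightarrow> (('i, 'j, 'o, 'm, 'p, 'n) psnat, 'i \<Rightarrow> 'o \<Rightarrow> 'n) cat" where
  "Psnat k I P D =
     \<lparr>Obj = {s. is_psnat k I P D s},
      Hom = (\<lambda>s t. {\<mu>. is_modification I P D s t \<mu>}),
      Cmp = (\<lambda>s t u \<nu> \<mu>. \<lambda>i \<in> Obj I. \<lambda>x \<in> Obj (pf_ob P i).
        Cmp D (fob (pn_ob s i) x) (fob (pn_ob t i) x) (fob (pn_ob u i) x) (\<nu> i x) (\<mu> i x)),
      Idn = (\<lambda>s. \<lambda>i \<in> Obj I. \<lambda>x \<in> Obj (pf_ob P i). Idn D (fob (pn_ob s i) x))\<rparr>"

text \<open>
  The functor \<open>Cat(k)(L, D) \<rightarrow> Psnat(P, D)\<close> sending \<open>G\<close> to \<open>G \<circ> s\<close>, for a pseudonatural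
  transformation \<open>s\<close> from \<open>P\<close> to the constant \<open>2\<close>-functor at \<open>L\<close>.
\<close>

definition induced_functor ::
  "('k, 'r) ring_scheme \<Rightarrow> ('i, 'j, 'x) cat_scheme \<Rightarrow> ('i, 'j, 'o, 'm, 'k) psfct \<Rightarrow>
     ('l, 'q, 'k) kcat \<Rightarrow> ('i, 'j, 'o, 'm, 'l, 'q) psnat \<Rightarrow> ('p, 'n, 'k) kcat \<Rightarrow>
     (('l, 'q, 'p, 'n) fct, 'l \<Rightarrow> 'n, ('i, 'j, 'o, 'm, 'p, 'n) psnat, 'i \<Rightarrow> 'o \<Rightarrow> 'n) fct" where
  "induced_functor k I P L s D =
     mk_fct (klinear_functor_cat k L D)
       (\<lambda>G. mk_psnat I
          (\<lambda>i. fct_comp (pf_ob P i) G (pn_ob s i))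
          (\<lambda>i j f. \<lambda>x \<in> Obj (pf_ob P i).
             far G (fob (pn_ob s i) x) (fob (pn_ob s j) (fob (pf_ar P i j f) x)) (pn_cell s i j f x)))
       (\<lambda>G H \<eta>. \<lambda>i \<in> Obj I. \<lambda>x \<in> Obj (pf_ob P i). \<eta> (fob (pn_ob s i) x))"

text \<open>
  The test categories \<open>D\<close> have objects in \<open>'p\<close> and arrows in \<open>'n\<close>. A definition cannot quantify
  over types, so these two types are parameters; results about bicolimits are to be
  polymorphic in them.
\<close>

definition is_klinear_filtered_bicolimit ::
  "'p itself \<Rightarrow> 'n itself \<Rightarrow> ('k, 'r) ring_scheme \<Rightarrow> ('i, 'j, 'x) cat_scheme \<Rightarrow>
     ('i, 'j, 'o, 'm, 'k) psfct \<Rightarrow> ('l, 'q, 'k) kcat \<Rightarrow> ('i, 'j, 'o, 'm, 'l, 'q) psnat \<Rightarrow> bool" where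
  "is_klinear_filtered_bicolimit (_ :: 'p itself) (_ :: 'n itself) k I P L s \<longleftrightarrow>
     is_filtered natLeq I \<and>
     klinear_pseudofunctor k I P \<and>
     klinear_category k L \<and>
     is_psnat k I P L s \<and>
     (\<forall>D :: ('p, 'n, 'k) kcat. klinear_category k D \<longrightarrow>
        is_equivalence (klinear_functor_cat k L D) (Psnat k I P D) (induced_functor k I P L s D))"


section \<open>The diagram of presentable objects\<close>

definition Reg :: "('u, unit) cat" where
  "Reg = preorder_cat small_regular_cardinals univ_card"

definition presentables_diagram ::
  "('k, 'r) ring_scheme \<Rightarrow> ('o, 'u, 'k) kcat \<Rightarrow> ('u, unit, 'o, 'u, 'k) psfct" where
  "presentables_diagram k C =
     \<lparr>pf_ob = presentables k C,
      pf_ar = (\<lambda>\<alpha> \<beta> _. fct_id (presentables k C \<alpha>)),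
      pf_cmp = (\<lambda>\<alpha> \<beta> \<gamma> _ _. \<lambda>X \<in> Obj (presentables k C \<alpha>). Idn C X),
      pf_unit = (\<lambda>\<alpha>. \<lambda>X \<in> Obj (presentables k C \<alpha>). Idn C X)\<rparr>"

text \<open>
  A functor does not record its codomain, so the embeddings \<open>C\<^sup>\<alpha> \<subseteq> C\<^sup>\<beta>\<close> above and \<open>C\<^sup>\<alpha> \<subseteq> C\<close> below
  have the same data as the identity of \<open>C\<^sup>\<alpha>\<close>.
\<close>

definition presentables_inclusions ::
  "('k, 'r) ring_scheme \<Rightarrow> ('o, 'u, 'k) kcat \<Rightarrow> ('u, unit, 'o, 'u, 'o, 'u) psnat" where
  "presentables_inclusions k C =
     mk_psnat Reg
       (\<lambda>\<alpha>. fct_id (presentables k C \<alpha>))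
       (\<lambda>\<alpha> \<beta> _. \<lambda>X \<in> Obj (presentables k C \<alpha>). Idn C X)"

end

theory Submission
  imports Defs
begin

text \<open>
  Every object \<open>X\<close> is presentable for some regular cardinal: it is the colimit of a small diagram of
  \<open>\<alpha>\<close>-presentable objects, and if \<open>\<beta> \<ge> \<alpha>\<close> is a regular cardinal exceeding the number of arrows of the diagram,
  then \<open>X\<close> is \<open>\<beta>\<close>-presentable, because in \<open>Mod k\<close> limits with fewer than \<open>\<beta>\<close> arrows commute with
  \<open>\<beta>\<close>-filtered colimits. Hence the \<open>C\<^sup>\<alpha>\<close> form a well-ordered chain of full subcategories with union \<open>C\<close>. A
  pseudonatural transformation \<open>s\<close> from such a chain to \<open>D\<close> is extended to \<open>C\<close> by \<open>X \<mapsto> s(\<alpha>)(X)\<close> with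
  \<open>\<alpha>\<close> least such that \<open>X \<in> C\<^sup>\<alpha>\<close>, the cells of \<open>s\<close> serving to compare different stages.
\<close>

section \<open>Small sets and small regular cardinals\<close>

text \<open>Presentability, a condition on colimits in \<open>Mod k\<close>, becomes usable through
  elements: a cocone on a filtered diagram of modules is a colimit iff each element comes from a
  stage and elements of one stage with equal image become equal later. To get this for an arbitrary
  colimit it is compared with an explicit one, whose carrier must be found inside \<open>'u\<close>;
  here smallness of the index category enters. A k-linear category may have hom-sets as large as
  \<open>'u\<close>, so smallness of C(X, Y) is part of what must be proved for X. On the bicolimit
  side, an arrow X -> Y is evaluated at any stage containing X and Y and carried back along the
  invertible cells to the least stages of X and Y. Coherence of the cells makes the result
  independent of the stage, so functoriality and linearity can be checked at one common stage. The
  cells of a restricted functor are identities, so restricting and then gluing returns a functor on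
  the nose; in the other order the cells themselves form the comparison isomorphism.\<close>

lemma Card_order_univ_card: "Card_order univ_card"
  unfolding univ_card_def by (rule card_of_Card_order)

lemma Well_order_univ_card: "Well_order univ_card"
  unfolding univ_card_def by (rule card_of_Well_order)

lemma Field_univ_card: "Field univ_card = UNIV"
  unfolding univ_card_def by (rule Field_card_of)

lemma wo_rel_univ_card: "wo_rel univ_card"
  by (simp add: wo_rel_def Well_order_univ_card)

lemma univ_card_refl: "(\<alpha>, \<alpha>) \<in> univ_card"
  using wo_rel.REFL[OF wo_rel_univ_card] by (rule refl_onD) (simp add: Field_univ_card)

lemma univ_card_trans: "(\<alpha>, \<beta>) \<in> univ_card \<Longrightarrow> (\<beta>, \<gamma>) \<in> univ_card \<Longrightarrow> (\<alpha>, \<gamma>) \<in> univ_card"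
  by (rule transD[OF wo_rel.TRANS[OF wo_rel_univ_card]])

lemma univ_card_total: "(\<alpha>, \<beta>) \<in> univ_card \<or> (\<beta>, \<alpha>) \<in> univ_card"
  by (rule wo_rel.TOTALS[OF wo_rel_univ_card, rule_format]) (simp_all add: Field_univ_card)

lemma univ_card_antisym: "(\<alpha>, \<beta>) \<in> univ_card \<Longrightarrow> (\<beta>, \<alpha>) \<in> univ_card \<Longrightarrow> \<alpha> = \<beta>"
  by (rule antisymD[OF wo_rel.ANTISYM[OF wo_rel_univ_card]])

lemma underS_univ_card_mono:
  assumes "(\<alpha>, \<beta>) \<in> univ_card"
  shows "underS univ_card \<alpha> \<subseteq> underS univ_card \<beta>"
proof
  fix \<gamma> assume "\<gamma> \<in> underS univ_card \<alpha>"
  then have "\<gamma> \<noteq> \<alpha>" "(\<gamma>, \<alpha>) \<in> univ_card" by (simp_all add: underS_def)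
  with assms have "(\<gamma>, \<beta>) \<in> univ_card" "\<gamma> \<noteq> \<beta>"
    using univ_card_trans univ_card_antisym by metis+
  then show "\<gamma> \<in> underS univ_card \<beta>" by (simp add: underS_def)
qed

lemma ordinal_mono:
  assumes "(\<alpha>, \<beta>) \<in> univ_card"
  shows "ordinal \<alpha> \<le>o ordinal \<beta>"
  unfolding ordinal_def
  using underS_univ_card_mono[OF assms]
  by (simp add: ofilter_subset_ordLeq[OF Well_order_univ_card, symmetric]
      wo_rel.underS_ofilter[OF wo_rel_univ_card])

locale universe =
  fixes U :: "'u itself"
  assumes inacc: "inaccessible (univ_card :: 'u rel)"
begin

lemma natLeq_univ: "natLeq <o (univ_card :: 'u rel)"
  using inacc by (simp add: inaccessible_def)

lemma Cinfinite_univ: "Cinfinite (univ_card :: 'u rel)"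
  using natLeq_univ Cinfinite_cong natLeq_Cinfinite Card_order_univ_card
  by (meson cinfinite_mono ordLess_imp_ordLeq)

lemma stable_univ: "stable (univ_card :: 'u rel)"
  using inacc Cinfinite_univ regularCard_stable unfolding inaccessible_def cinfinite_def by blast

lemma small_card_mono: "|A| \<le>o |B| \<Longrightarrow> small U B \<Longrightarrow> small U A"
  unfolding small_def using ordLeq_ordLess_trans by blast

lemma small_image: "small U A \<Longrightarrow> small U (f ` A)"
  using card_of_image small_card_mono by blast

lemma small_Sigma: "small U A \<Longrightarrow> (\<And>a. a \<in> A \<Longrightarrow> small U (F a)) \<Longrightarrow> small U (Sigma A F)"
  unfolding small_def using stable_elim[OF stable_univ] by blast

lemma small_Plus: "small U A \<Longrightarrow> small U B \<Longrightarrow> small U (A <+> B)"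
  unfolding small_def
  using card_of_Plus_ordLess_infinite_Field[OF _ Card_order_univ_card] Cinfinite_univ
  by (auto simp: cinfinite_def)

lemma small_nat: "small U (UNIV :: nat set)"
  unfolding small_def using natLeq_univ card_of_nat ordIso_ordLess_trans by blast

lemma small_embed:
  assumes "small U A"
  obtains e :: "'a \<Rightarrow> 'u" where "inj_on e A"
proof -
  have "|A| \<le>o |UNIV :: 'u set|"
    using assms unfolding small_def univ_card_def by (rule ordLess_imp_ordLeq)
  then show thesis using that card_of_ordLeq[of A "UNIV :: 'u set"] by blast
qed

text \<open>Inaccessibility bounds the power sets of subsets of \<open>'u\<close> only, so
  \<open>A\<close> is first replaced by a copy inside \<open>'u\<close>.\<close>

lemma small_Pow:
  assumes "small U A"
  shows "small U (Pow A)"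
proof -
  obtain e :: "'a \<Rightarrow> 'u" where e: "inj_on e A" using small_embed[OF assms] .
  have "|e ` A| <o (univ_card :: 'u rel)" using small_image[OF assms] by (simp add: small_def)
  then have "small U (Pow (e ` A))"
    using inacc unfolding inaccessible_def small_def by (simp add: Field_univ_card)
  moreover have "bij_betw e A (e ` A)" using e by (simp add: bij_betw_def)
  then have "|Pow A| =o |Pow (e ` A)|"
    using bij_betw_Pow card_of_ordIsoI by blast
  ultimately show ?thesis using small_card_mono ordIso_imp_ordLeq by blast
qed

text \<open>A function in the product is determined by its graph, a subset of
  \<open>Sigma A F\<close>, so that the bound on power sets applies.\<close>

lemma small_PiE:
  assumes "small U A" "\<And>a. a \<in> A \<Longrightarrow> small U (F a)"
  shows "small U (Pi\<^sub>E A F)"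
proof -
  define G where "G h = {(a, h a) |a. a \<in> A}" for h :: "'a \<Rightarrow> 'b"
  have "inj_on G (Pi\<^sub>E A F)"
  proof (rule inj_onI)
    fix g h assume "g \<in> Pi\<^sub>E A F" "h \<in> Pi\<^sub>E A F" "G g = G h"
    moreover have "g a = h a" if "a \<in> A" for a
    proof -
      have "(a, g a) \<in> G h" using that \<open>G g = G h\<close> unfolding G_def by blast
      then show ?thesis by (auto simp: G_def)
    qed
    ultimately show "g = h" using PiE_ext by metis
  qed
  moreover have "G ` Pi\<^sub>E A F \<subseteq> Pow (Sigma A F)" by (auto simp: G_def)
  ultimately have "|Pi\<^sub>E A F| \<le>o |Pow (Sigma A F)|" using card_of_ordLeq by blast
  then show ?thesis using small_card_mono small_Pow small_Sigma assms by blast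
qed

text \<open>The witness is the cardinal successor of the sum of \<open>\<alpha>\<close>, \<open>|A|\<close> and \<open>\<omega>\<close>.\<close>

lemma small_regular_above:
  assumes "small U A"
  obtains \<beta> :: 'u where "\<beta> \<in> small_regular_cardinals" "(\<alpha>, \<beta>) \<in> univ_card" "|A| <o ordinal \<beta>"
proof -
  have \<alpha>: "small U (underS univ_card \<alpha>)"
    unfolding small_def
    by (rule card_of_underS[OF Card_order_univ_card]) (simp add: Field_univ_card)
  define B where "B = underS univ_card \<alpha> <+> (A <+> (UNIV :: nat set))"
  have B: "small U B" unfolding B_def by (intro small_Plus \<alpha> assms small_nat)
  have infB: "Cinfinite |B|"
    unfolding B_def cinfinite_def
    by (rule conjI[OF _ card_of_Card_order])
      (simp only: Field_card_of finite_Plus_iff infinite_UNIV_nat simp_thms)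
  let ?s = "cardSuc |B|"
  \<comment> \<open>The successor is bounded by a power set, hence still small, and is therefore
    isomorphic to an initial segment \<open>ordinal \<beta>\<close>.\<close>
  have "?s \<le>o |Pow B|" by (rule cardSuc_least[OF card_of_Card_order card_of_Card_order card_of_Pow])
  then have "?s <o (univ_card :: 'u rel)"
    using small_Pow[OF B] ordLeq_ordLess_trans unfolding small_def by blast
  then obtain \<beta> :: 'u where \<beta>: "?s =o ordinal \<beta>"
    using internalize_ordLess[of ?s "univ_card :: 'u rel"] ordLess_iff_ordIso_Restr[of "univ_card :: 'u rel" ?s]
      Well_order_univ_card cardSuc_Well_order[OF card_of_Card_order]
    unfolding ordinal_def by blast
  have 1: "Cinfinite ?s" "regularCard ?s"
    using Cinfinite_cardSuc regularCard_cardSuc infB by blast+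
  have reg: "\<beta> \<in> small_regular_cardinals"
    unfolding small_regular_cardinals_def
    using Cinfinite_cong[OF \<beta> 1(1)] regularCard_ordIso[OF \<beta> 1] by simp
  have less: "|X| <o ordinal \<beta>" if "|X| \<le>o |B|" for X :: "'x set"
    by (rule ordLeq_ordLess_trans[OF that
          ordLess_ordIso_trans[OF cardSuc_greater[OF card_of_Card_order] \<beta>]])
  have A: "|A| <o ordinal \<beta>"
    unfolding B_def by (rule less[unfolded B_def, OF ordLeq_transitive[OF card_of_Plus1 card_of_Plus2]])
  \<comment> \<open>Otherwise the predecessors of \<open>\<beta>\<close>, being predecessors of
    \<open>\<alpha>\<close>, would number at most \<open>|B|\<close>, hence fewer than the cardinal
    \<open>ordinal \<beta>\<close> whose field they are.\<close>
  have "(\<alpha>, \<beta>) \<in> univ_card"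
  proof (rule ccontr)
    assume "(\<alpha>, \<beta>) \<notin> univ_card"
    then have "(\<beta>, \<alpha>) \<in> univ_card" using univ_card_total[of \<alpha> \<beta>] by blast
    then have "underS univ_card \<beta> \<subseteq> underS univ_card \<alpha>" by (rule underS_univ_card_mono)
    then have "|underS univ_card \<beta>| <o ordinal \<beta>"
      by (rule less[unfolded B_def, OF ordLeq_transitive[OF card_of_mono1 card_of_Plus1]])
    moreover have "Field (ordinal \<beta>) = underS univ_card \<beta>"
      unfolding ordinal_def
      using Refl_Field_Restr2[OF wo_rel.REFL[OF wo_rel_univ_card]] Field_univ_card by (metis subset_UNIV)
    moreover have "Card_order (ordinal \<beta>)"
      using reg by (simp add: small_regular_cardinals_def)
    ultimately show False
      using card_of_Field_ordIso not_ordLess_ordIso by metis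
  qed
  then show thesis using that reg A by blast
qed

end

section \<open>Filtered categories\<close>

text \<open>Identities embed the objects into the arrows, so the bound on arrows in
  \<open>is_filtered\<close> and \<open>small_category\<close> also bounds the objects.\<close>

lemma (in category) small_Obj:
  assumes "|arrows C| <o r"
  shows "|Obj C| <o r"
proof -
  have "inj_on (\<lambda>a. (a, a, Idn C a)) (Obj C)" by (simp add: inj_on_def)
  moreover have "(\<lambda>a. (a, a, Idn C a)) ` Obj C \<subseteq> arrows C"
    using Idn_closed by (auto simp: arrows_def)
  ultimately have "|Obj C| \<le>o |arrows C|" using card_of_ordLeq by blast
  then show ?thesis using assms ordLeq_ordLess_trans by blast
qed

lemma is_filtered_mono:
  fixes r s :: "'s rel"
  assumes "r \<le>o s" "is_filtered s J"
  shows "is_filtered r J"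
  using assms ordLess_ordLeq_trans unfolding is_filtered_def by metis

text \<open>Meant for \<open>H\<close> without composable pairs: of two composable arrows one is
  then an identity, and the composite is the other one. A single value \<open>i\<close> serves as
  every identity because hom-sets are indexed by objects.\<close>

definition bipartite_cat :: "'a set \<Rightarrow> ('a \<Rightarrow> 'a \<Rightarrow> 'b set) \<Rightarrow> 'b \<Rightarrow> ('a, 'b) cat" where
  "bipartite_cat V H i =
     \<lparr>Obj = V, Hom = (\<lambda>a b. if a = b then {i} else H a b),
      Cmp = (\<lambda>a b c g f. if a = b then g else f), Idn = (\<lambda>a. i)\<rparr>"

lemma category_bipartite_cat:
  assumes "\<And>a b c. a \<noteq> b \<Longrightarrow> b \<noteq> c \<Longrightarrow> H a b = {} \<or> H b c = {}"
  shows "category (bipartite_cat V H i)"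
  by unfold_locales (use assms in \<open>auto simp: bipartite_cat_def split: if_splits\<close>)

text \<open>
  Subdividing each arrow of the quiver, by a new vertex with one arrow to its source and one to
  its target, turns the quiver into a category without adding any composite.
\<close>

lemma filtered_quiver_cocone:
  fixes r :: "'s rel" and J :: "('i, 'j, 'x) cat_scheme"
  assumes J: "category J" and fil: "is_filtered r J" and r: "Cinfinite r"
    and A: "A \<subseteq> arrows J" "|A| <o r" and B: "B \<subseteq> Obj J" "|B| <o r"
    and AB: "\<And>i j u. (i, j, u) \<in> A \<Longrightarrow> i \<in> B \<and> j \<in> B"
  obtains m c where "m \<in> Obj J" "\<And>i. i \<in> B \<Longrightarrow> c i \<in> Hom J i m"
    "\<And>i j u. (i, j, u) \<in> A \<Longrightarrow> Cmp J i j m (c j) u = c i"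
proof -
  interpret J: category J by fact
  have inf: "\<not> finite (Field r)" "Card_order r" using r by (auto simp: cinfinite_def)
  have V: "|A <+> B| <o r"
    using card_of_Plus_ordLess_infinite_Field[OF inf A(2) B(2)] .
  \<comment> \<open>\<open>is_filtered\<close> only tests index categories with objects and arrows
    in \<open>'s\<close>. So the vertices of the subdivided quiver, \<open>Inl\<close> for the new
    ones and \<open>Inr\<close> for the old ones, are coded in \<open>'s\<close>: \<open>e\<close>
    encodes and \<open>d\<close> decodes.\<close>
  have "|A <+> B| \<le>o |UNIV :: 's set|"
    using V inf(2) card_of_Field_ordIso card_of_mono1[of "Field r" UNIV]
    by (meson ordIso_imp_ordLeq ordIso_symmetric ordLess_imp_ordLeq ordLeq_transitive subset_UNIV)
  then obtain e :: "_ \<Rightarrow> 's" where e: "inj_on e (A <+> B)"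
    using card_of_ordLeq[of "A <+> B" "UNIV :: 's set"] by blast
  define d where "d = inv_into (A <+> B) e"
  have d: "d (e v) = v" if "v \<in> A <+> B" for v using e that by (simp add: d_def)
  have dmem: "d p \<in> A <+> B" if p: "p \<in> e ` (A <+> B)" for p
  proof -
    obtain v where "v \<in> A <+> B" "p = e v" using p by blast
    then show ?thesis using d by simp
  qed
  \<comment> \<open>Names for the two arrows out of a subdividing vertex, \<open>x\<close> to the
    source and \<open>y\<close> to the target. They must differ because for a loop both arrows lie
    in the same hom-set.\<close>
  obtain x y :: 's where xy: "x \<noteq> y"
    using inf(1) by (metis (full_types) finite.intros finite_subset insertCI subsetI)
  define H :: "'s \<Rightarrow> 's \<Rightarrow> 's set" where
    "H p q = (case (d p, d q) of (Inl (i, j, u), Inr l) \<Rightarrow> {w. w = x \<and> l = i \<or> w = y \<and> l = j} | _ \<Rightarrow> {})"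
    for p q
  let ?K = "bipartite_cat (e ` (A <+> B)) H x"
  have K: "category ?K"
    by (rule category_bipartite_cat) (auto simp: H_def split: sum.splits)
  have image_less: "|f ` X| <o r" if "|X| <o r" for f :: "'y \<Rightarrow> 'z" and X
    using card_of_image that by (rule ordLeq_ordLess_trans)
  \<comment> \<open>One identity for each vertex and two further arrows for each arrow of the
    quiver, hence fewer than \<open>r\<close> in all.\<close>
  have "arrows ?K \<subseteq> (\<lambda>v. (e v, e v, x)) ` (A <+> B) \<union>
      ((\<lambda>(i, j, u). (e (Inl (i, j, u)), e (Inr i), x)) ` A \<union>
       (\<lambda>(i, j, u). (e (Inl (i, j, u)), e (Inr j), y)) ` A)" (is "_ \<subseteq> ?R")
  proof
    fix t assume "t \<in> arrows ?K"
    then obtain v v' w where t: "t = (e v, e v', w)" "v \<in> A <+> B" "v' \<in> A <+> B"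
      "w \<in> Hom ?K (e v) (e v')"
      unfolding arrows_def bipartite_cat_def by auto
    show "t \<in> ?R"
    proof (cases "e v = e v'")
      case True
      then show ?thesis using t by (auto simp: bipartite_cat_def)
    next
      case False
      then have "w \<in> H (e v) (e v')" using t(4) by (simp add: bipartite_cat_def)
      then obtain i j u l where "v = Inl (i, j, u)" "v' = Inr l" "w = x \<and> l = i \<or> w = y \<and> l = j"
        using d[OF t(2)] d[OF t(3)] by (auto simp: H_def split: sum.splits)
      moreover from this have "(i, j, u) \<in> A" using t(2) by blast
      ultimately show ?thesis using t(1) by force
    qed
  qed
  moreover have "|?R| <o r"
    by (intro card_of_Un_ordLess_infinite_Field[OF inf] image_less V A(2))
  ultimately have cardK: "|arrows ?K| <o r" using card_of_mono1 ordLeq_ordLess_trans by blast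
  \<comment> \<open>The vertex subdividing u : i -> j lies over the source i; its arrow
    \<open>x\<close> lies over the identity of i and its arrow \<open>y\<close> over u.\<close>
  define fo where "fo p = (case d p of Inl (i, j, u) \<Rightarrow> i | Inr i \<Rightarrow> i)" for p
  define fa where "fa p q w = (if p = q then Idn J (fo p) else
      (case d p of Inl (i, j, u) \<Rightarrow> if w = x then Idn J i else u | Inr i \<Rightarrow> undefined))" for p q w
  let ?D = "mk_fct ?K fo fa"
  have fo: "fo p \<in> Obj J" if p: "p \<in> e ` (A <+> B)" for p
    using dmem[OF p] A(1) B(1) by (auto simp: fo_def arrows_def)
  have fa: "fa p q w \<in> Hom J (fo p) (fo q)"
    if pq: "p \<in> e ` (A <+> B)" "q \<in> e ` (A <+> B)" "w \<in> Hom ?K p q" for p q w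
  proof (cases "p = q")
    case True
    then show ?thesis using fo[OF pq(1)] J.Idn_closed by (simp add: fa_def)
  next
    case False
    then have w: "w \<in> H p q" using pq(3) by (simp add: bipartite_cat_def)
    then obtain i j u l where dp: "d p = Inl (i, j, u)" "d q = Inr l"
      by (auto simp: H_def split: sum.splits)
    have iju: "(i, j, u) \<in> A" using dmem[OF pq(1)] dp(1) by auto
    then have "i \<in> Obj J" "u \<in> Hom J i j" using A(1) by (auto simp: arrows_def)
    then show ?thesis using w dp False xy J.Idn_closed by (auto simp: H_def fa_def fo_def)
  qed
  have "is_functor ?K J ?D"
  proof -
    have "fa p s (if p = q then w' else w) =
        Cmp J (fo p) (fo q) (fo s) (fa q s w') (fa p q w)"
      if h: "p \<in> e ` (A <+> B)" "q \<in> e ` (A <+> B)" "s \<in> e ` (A <+> B)"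
        "w \<in> Hom ?K p q" "w' \<in> Hom ?K q s" for p q s w w'
    proof (cases "p = q")
      case True
      then have "fa p q w = Idn J (fo q)" by (simp add: fa_def)
      then show ?thesis using True J.Cmp_Idn_right fo fa h by auto
    next
      case False
      have "q = s"
      proof (rule ccontr)
        assume "q \<noteq> s"
        then show False using h(4,5) False
          by (auto simp: bipartite_cat_def H_def split: sum.splits if_splits)
      qed
      then have "fa q s w' = Idn J (fo q)" by (simp add: fa_def)
      then show ?thesis using \<open>q = s\<close> False J.Cmp_Idn_left fo fa h by auto
    qed
    moreover have "Obj ?K = e ` (A <+> B)" "Idn ?K = (\<lambda>_. x)"
        "Cmp ?K = (\<lambda>a b c g f. if a = b then g else f)"
      by (simp_all add: bipartite_cat_def)
    moreover have "x \<in> Hom ?K p p" for p by (simp add: bipartite_cat_def)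
    moreover have "fa p p x = Idn J (fo p)" for p by (simp add: fa_def)
    ultimately show ?thesis using fo fa category.Cmp_closed[OF K]
      by (simp add: is_functor_def mk_fct_def arrows_def restrict_def fun_eq_iff)
  qed
  then obtain m l where ml: "is_cocone ?K J ?D m l"
    using fil K cardK unfolding is_filtered_def by blast
  have ob: "fob ?D p = fo p" if "p \<in> e ` (A <+> B)" for p
    using that by (simp add: mk_fct_def bipartite_cat_def)
  have m: "m \<in> Obj J" using ml by (simp add: is_cocone_def)
  have l: "l p \<in> Hom J (fo p) m" if "p \<in> e ` (A <+> B)" for p
  proof -
    have "p \<in> Obj ?K" using that by (simp add: bipartite_cat_def)
    then have "l p \<in> Hom J (fob ?D p) m" using ml unfolding is_cocone_def by blast
    then show ?thesis using ob[OF that] by simp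
  qed
  have nat: "Cmp J (fo p) (fo q) m (l q) (fa p q w) = l p"
    if "p \<in> e ` (A <+> B)" "q \<in> e ` (A <+> B)" "w \<in> Hom ?K p q" for p q w
  proof -
    have "p \<in> Obj ?K" "q \<in> Obj ?K" using that by (simp_all add: bipartite_cat_def)
    then have "Cmp J (fob ?D p) (fob ?D q) m (l q) (far ?D p q w) = l p"
      using ml that(3) unfolding is_cocone_def by blast
    moreover have "far ?D p q w = fa p q w"
      using \<open>p \<in> Obj ?K\<close> \<open>q \<in> Obj ?K\<close> that(3) by (simp add: mk_fct_def arrows_def)
    ultimately show ?thesis using ob that by simp
  qed
  show thesis
  proof (rule that)
    show "m \<in> Obj J" by fact
    show "l (e (Inr i)) \<in> Hom J i m" if "i \<in> B" for i
    proof -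
      have "Inr i \<in> A <+> B" using that by blast
      then show ?thesis using l[of "e (Inr i)"] d[of "Inr i"] by (auto simp: fo_def)
    qed
    fix i j u assume a: "(i, j, u) \<in> A"
    let ?p = "e (Inl (i, j, u))"
    let ?i = "e (Inr i)" and ?j = "e (Inr j)"
    have mem: "Inl (i, j, u) \<in> A <+> B" "Inr i \<in> A <+> B" "Inr j \<in> A <+> B"
      using a AB by blast+
    have dd: "d ?p = Inl (i, j, u)" "d ?i = Inr i" "d ?j = Inr j" using d mem by blast+
    have ne: "?p \<noteq> ?i" "?p \<noteq> ?j" using dd by (metis sum.distinct(1))+
    have ij: "i \<in> Obj J" "j \<in> Obj J" "u \<in> Hom J i j" using a A(1) by (auto simp: arrows_def)
    \<comment> \<open>The cocone equations at the two arrows out of \<open>?p\<close> both compute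
      \<open>l ?p\<close>; comparing them gives the equation for \<open>u\<close>.\<close>
    have "x \<in> Hom ?K ?p ?i" "y \<in> Hom ?K ?p ?j"
      using ne dd by (simp_all add: bipartite_cat_def H_def)
    then have "Cmp J (fo ?p) (fo ?i) m (l ?i) (fa ?p ?i x) = l ?p"
      "Cmp J (fo ?p) (fo ?j) m (l ?j) (fa ?p ?j y) = l ?p"
      using nat mem by blast+
    moreover have "fo ?p = i" "fo ?i = i" "fo ?j = j" "fa ?p ?i x = Idn J i" "fa ?p ?j y = u"
      using dd ne xy by (simp_all add: fo_def fa_def)
    moreover have "Cmp J i i m (l ?i) (Idn J i) = l ?i"
      using J.Cmp_Idn_right ij(1) m l[of ?i] mem \<open>fo ?i = i\<close> by auto
    ultimately show "Cmp J i j m (l (e (Inr j))) u = l (e (Inr i))" by simp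
  qed
qed

section \<open>Filtered colimits of modules\<close>

lemma Mod_simps:
  "Obj (Mod k :: (('k, 'u) module, 'u \<Rightarrow> 'u) cat) = {M. module k M \<and> small TYPE('u) (carrier M)}"
  "Hom (Mod k) M N = {h. linear_map k M N h \<and> h \<in> extensional (carrier M)}"
  "Cmp (Mod k) M N P g f = compose (carrier M) g f"
  "Idn (Mod k) M = (\<lambda>x\<in>carrier M. x)"
  for M N P :: "('k, 'u) module"
  by (simp_all add: Mod_def)

lemma linear_mapD:
  assumes "linear_map k M N h"
  shows "x \<in> carrier M \<Longrightarrow> h x \<in> carrier N"
    "x \<in> carrier M \<Longrightarrow> y \<in> carrier M \<Longrightarrow> h (x \<oplus>\<^bsub>M\<^esub> y) = h x \<oplus>\<^bsub>N\<^esub> h y"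
    "a \<in> carrier k \<Longrightarrow> x \<in> carrier M \<Longrightarrow> h (a \<odot>\<^bsub>M\<^esub> x) = a \<odot>\<^bsub>N\<^esub> h x"
  using assms by (auto simp: linear_map_def)

locale filtered_Mod_diagram = universe U + J: category J
  for U :: "'u itself" and k :: "('k, 'r) ring_scheme" and J :: "('i, 'j, 'x) cat_scheme"
    and r :: "'s rel" and F :: "('i, 'j, ('k, 'u) module, 'u \<Rightarrow> 'u) fct" +
  assumes filtered: "is_filtered r J" and r: "Cinfinite r" and F: "is_functor J (Mod k) F"
begin

lemma module_F: "j \<in> Obj J \<Longrightarrow> module k (fob F j)"
  and small_F: "j \<in> Obj J \<Longrightarrow> small U (carrier (fob F j))"
  using F by (auto simp: is_functor_def Mod_simps small_def)

lemma linear_F: "\<lbrakk>i \<in> Obj J; j \<in> Obj J; u \<in> Hom J i j\<rbrakk> \<Longrightarrow> linear_map k (fob F i) (fob F j) (far F i j u)"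
  using F by (auto simp: is_functor_def Mod_simps)

lemmas far_closed = linear_mapD(1)[OF linear_F]
lemmas far_add = linear_mapD(2)[OF linear_F]
lemmas far_smult = linear_mapD(3)[OF linear_F]

lemma far_Cmp:
  assumes "i \<in> Obj J" "j \<in> Obj J" "l \<in> Obj J" "u \<in> Hom J i j" "v \<in> Hom J j l"
    "x \<in> carrier (fob F i)"
  shows "far F i l (Cmp J i j l v u) x = far F j l v (far F i j u x)"
proof -
  have "far F i l (Cmp J i j l v u) = compose (carrier (fob F i)) (far F j l v) (far F i j u)"
    using F assms by (auto simp: is_functor_def Mod_simps)
  then show ?thesis using assms(6) by (simp add: compose_def)
qed

lemma finite_quiver_cocone:
  assumes "finite A" "A \<subseteq> arrows J" "finite B" "B \<subseteq> Obj J"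
    "\<And>i j u. (i, j, u) \<in> A \<Longrightarrow> i \<in> B \<and> j \<in> B"
  obtains m c where "m \<in> Obj J" "\<And>i. i \<in> B \<Longrightarrow> c i \<in> Hom J i m"
    "\<And>i j u. (i, j, u) \<in> A \<Longrightarrow> Cmp J i j m (c j) u = c i"
proof -
  have fin: "|X| <o r" if "finite X" for X :: "'y set"
    using that r natLeq_ordLeq_cinfinite finite_iff_ordLess_natLeq ordLess_ordLeq_trans by blast
  show thesis
    by (rule filtered_quiver_cocone[OF J.category_axioms filtered r assms(2) fin[OF assms(1)] assms(4)
          fin[OF assms(3)]]) (use assms(5) that in blast)+
qed

lemma Obj_nonempty: obtains j where "j \<in> Obj J"
  by (rule finite_quiver_cocone[of "{}" "{}"]) (use that in auto)

text \<open>The relation whose classes are the elements of the filtered colimit of the underlying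
  sets.\<close>

definition eqv :: "'i \<Rightarrow> 'u \<Rightarrow> 'i \<Rightarrow> 'u \<Rightarrow> bool" where
  "eqv i x j y \<longleftrightarrow> (\<exists>m \<in> Obj J. \<exists>u \<in> Hom J i m. \<exists>v \<in> Hom J j m. far F i m u x = far F j m v y)"

lemma eqv_far:
  assumes "i \<in> Obj J" "j \<in> Obj J" "u \<in> Hom J i j" "x \<in> carrier (fob F i)"
  shows "eqv i x j (far F i j u x)"
proof -
  have "far F i j (Cmp J i j j (Idn J j) u) x = far F j j (Idn J j) (far F i j u x)"
    using assms J.Idn_closed by (intro far_Cmp) auto
  then show ?thesis
    unfolding eqv_def using assms J.Idn_closed J.Cmp_closed by blast
qed

lemma eqv_refl: "i \<in> Obj J \<Longrightarrow> eqv i x i x"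
  unfolding eqv_def using J.Idn_closed by blast

lemma eqv_sym: "eqv i x j y \<Longrightarrow> eqv j y i x"
  unfolding eqv_def by metis

text \<open>Take a cocone on the quiver formed by the arrows of both witnesses. It has a single leg
  at each vertex, whence the last conclusion, which replaces two different arrows out of one stage
  by a single arrow.\<close>

lemma eqv_joint:
  assumes ij: "i \<in> Obj J" "j \<in> Obj J"
    and x: "x \<in> carrier (fob F i)" "x' \<in> carrier (fob F j)" "eqv i x j x'"
    and y: "y \<in> carrier (fob F i)" "y' \<in> carrier (fob F j)" "eqv i y j y'"
  obtains m u v where "m \<in> Obj J" "u \<in> Hom J i m" "v \<in> Hom J j m"
    "far F i m u x = far F j m v x'" "far F i m u y = far F j m v y'" "i = j \<Longrightarrow> u = v"
proof -
  obtain m1 u1 v1 where 1: "m1 \<in> Obj J" "u1 \<in> Hom J i m1" "v1 \<in> Hom J j m1"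
    "far F i m1 u1 x = far F j m1 v1 x'"
    using x(3) unfolding eqv_def by blast
  obtain m2 u2 v2 where 2: "m2 \<in> Obj J" "u2 \<in> Hom J i m2" "v2 \<in> Hom J j m2"
    "far F i m2 u2 y = far F j m2 v2 y'"
    using y(3) unfolding eqv_def by blast
  obtain m c where m: "m \<in> Obj J" "\<And>l. l \<in> {i, j, m1, m2} \<Longrightarrow> c l \<in> Hom J l m"
    "\<And>p q w. (p, q, w) \<in> {(i, m1, u1), (j, m1, v1), (i, m2, u2), (j, m2, v2)} \<Longrightarrow>
      Cmp J p q m (c q) w = c p"
    by (rule finite_quiver_cocone[of "{(i, m1, u1), (j, m1, v1), (i, m2, u2), (j, m2, v2)}" "{i, j, m1, m2}"])
      (use 1 2 ij in \<open>auto simp: arrows_def\<close>)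
  have "far F i m (c i) x = far F m1 m (c m1) (far F i m1 u1 x)"
    using far_Cmp[of i m1 m u1 "c m1" x] m 1 ij x by auto
  moreover have "far F j m (c j) x' = far F m1 m (c m1) (far F j m1 v1 x')"
    using far_Cmp[of j m1 m v1 "c m1" x'] m 1 ij x by auto
  moreover have "far F i m (c i) y = far F m2 m (c m2) (far F i m2 u2 y)"
    using far_Cmp[of i m2 m u2 "c m2" y] m 2 ij y by auto
  moreover have "far F j m (c j) y' = far F m2 m (c m2) (far F j m2 v2 y')"
    using far_Cmp[of j m2 m v2 "c m2" y'] m 2 ij y by auto
  ultimately show thesis using that[of m "c i" "c j"] m(1,2) 1(4) 2(4) by auto
qed

text \<open>The witnesses form a zigzag from \<open>i\<close> through \<open>m1\<close>,
  \<open>j\<close> and \<open>m2\<close> to \<open>l\<close>. In a cocone on it, both arrows out of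
  \<open>j\<close> continue to the same leg.\<close>

lemma eqv_trans:
  assumes ijl: "i \<in> Obj J" "j \<in> Obj J" "l \<in> Obj J"
    and xyz: "x \<in> carrier (fob F i)" "y \<in> carrier (fob F j)" "z \<in> carrier (fob F l)"
    and "eqv i x j y" "eqv j y l z"
  shows "eqv i x l z"
proof -
  obtain m1 u1 v1 where 1: "m1 \<in> Obj J" "u1 \<in> Hom J i m1" "v1 \<in> Hom J j m1"
    "far F i m1 u1 x = far F j m1 v1 y"
    using \<open>eqv i x j y\<close> unfolding eqv_def by blast
  obtain m2 u2 v2 where 2: "m2 \<in> Obj J" "u2 \<in> Hom J j m2" "v2 \<in> Hom J l m2"
    "far F j m2 u2 y = far F l m2 v2 z"
    using \<open>eqv j y l z\<close> unfolding eqv_def by blast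
  obtain m c where m: "m \<in> Obj J" "\<And>p. p \<in> {i, j, l, m1, m2} \<Longrightarrow> c p \<in> Hom J p m"
    "\<And>p q w. (p, q, w) \<in> {(i, m1, u1), (j, m1, v1), (j, m2, u2), (l, m2, v2)} \<Longrightarrow>
      Cmp J p q m (c q) w = c p"
    by (rule finite_quiver_cocone[of "{(i, m1, u1), (j, m1, v1), (j, m2, u2), (l, m2, v2)}" "{i, j, l, m1, m2}"])
      (use 1 2 ijl in \<open>auto simp: arrows_def\<close>)
  have "far F i m (c i) x = far F m1 m (c m1) (far F i m1 u1 x)"
    using far_Cmp[of i m1 m u1 "c m1" x] m 1 ijl xyz by auto
  moreover have "far F j m (c j) y = far F m1 m (c m1) (far F j m1 v1 y)"
    using far_Cmp[of j m1 m v1 "c m1" y] m 1 ijl xyz by auto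
  moreover have "far F j m (c j) y = far F m2 m (c m2) (far F j m2 u2 y)"
    using far_Cmp[of j m2 m u2 "c m2" y] m 2 ijl xyz by auto
  moreover have "far F l m (c l) z = far F m2 m (c m2) (far F l m2 v2 z)"
    using far_Cmp[of l m2 m v2 "c m2" z] m 2 ijl xyz by auto
  ultimately have "far F i m (c i) x = far F l m (c l) z" using 1(4) 2(4) by simp
  then show ?thesis unfolding eqv_def using m(1,2) by blast
qed

lemma common_stage:
  assumes "i \<in> Obj J" "j \<in> Obj J" "l \<in> Obj J"
  obtains m u v w where "m \<in> Obj J" "u \<in> Hom J i m" "v \<in> Hom J j m" "w \<in> Hom J l m"
proof -
  obtain m c where "m \<in> Obj J" "\<And>p. p \<in> {i, j, l} \<Longrightarrow> c p \<in> Hom J p m"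
    by (rule finite_quiver_cocone[of "{}" "{i, j, l}"]) (use assms in auto)
  then show thesis using that[of m "c i" "c j" "c l"] by simp
qed

section \<open>Cocones and colimits of modules in terms of elements\<close>

lemma cocone_linear:
  assumes "is_cocone J (Mod k) F N n" "j \<in> Obj J"
  shows "linear_map k (fob F j) N (n j)" "n j \<in> extensional (carrier (fob F j))"
  using assms by (auto simp: is_cocone_def Mod_simps)

lemma cocone_far:
  assumes "is_cocone J (Mod k) F N n" "i \<in> Obj J" "j \<in> Obj J" "u \<in> Hom J i j" "x \<in> carrier (fob F i)"
  shows "n j (far F i j u x) = n i x"
proof -
  have "compose (carrier (fob F i)) (n j) (far F i j u) = n i"
    using assms by (auto simp: is_cocone_def Mod_simps)
  then show ?thesis using assms(5) by (metis compose_eq)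
qed

lemma cocone_eqv:
  assumes "is_cocone J (Mod k) F N n" "i \<in> Obj J" "j \<in> Obj J" "x \<in> carrier (fob F i)"
    "y \<in> carrier (fob F j)" "eqv i x j y"
  shows "n i x = n j y"
  using assms(6) cocone_far[OF assms(1) assms(2) _ _ assms(4)] cocone_far[OF assms(1) assms(3) _ _ assms(5)]
  unfolding eqv_def by metis

text \<open>The map induced by a cocone \<open>m\<close> sends \<open>n j x\<close> to
  \<open>m j x\<close>. Injectivity is assumed within one stage, so elements of different stages are
  moved to a common stage before they are compared or added.\<close>

lemma is_colimit_ModI:
  assumes N: "is_cocone J (Mod k) F N n"
    and surj: "\<And>y. y \<in> carrier N \<Longrightarrow> \<exists>j \<in> Obj J. \<exists>x \<in> carrier (fob F j). y = n j x"
    and inj: "\<And>j x y. \<lbrakk>j \<in> Obj J; x \<in> carrier (fob F j); y \<in> carrier (fob F j); n j x = n j y\<rbrakk>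
      \<Longrightarrow> eqv j x j y"
  shows "is_colimit J (Mod k) F N n"
  unfolding is_colimit_def
proof (intro conjI allI impI N)
  fix M m assume M: "is_cocone J (Mod k) F M m"
  note nl = linear_mapD[OF cocone_linear(1)[OF N]] and ml = linear_mapD[OF cocone_linear(1)[OF M]]
  have wd: "m i x = m j y"
    if ij: "i \<in> Obj J" "j \<in> Obj J" "x \<in> carrier (fob F i)" "y \<in> carrier (fob F j)" "n i x = n j y"
    for i j x y
  proof -
    obtain l u v where l: "l \<in> Obj J" "u \<in> Hom J i l" "v \<in> Hom J j l"
      by (rule common_stage[OF ij(1,2,2)])
    have "n l (far F i l u x) = n l (far F j l v y)"
      using cocone_far[OF N] ij l by simp
    then have "eqv l (far F i l u x) l (far F j l v y)"
      using inj l ij far_closed by blast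
    then have "m l (far F i l u x) = m l (far F j l v y)"
      using cocone_eqv[OF M] l ij far_closed by blast
    then show ?thesis using cocone_far[OF M] ij l by simp
  qed
  define h where "h = (\<lambda>z \<in> carrier N. SOME w. \<exists>j \<in> Obj J. \<exists>x \<in> carrier (fob F j). z = n j x \<and> w = m j x)"
  have h: "h (n j x) = m j x" if "j \<in> Obj J" "x \<in> carrier (fob F j)" for j x
  proof -
    have "n j x \<in> carrier N" using nl(1) that by blast
    then have "h (n j x) = (SOME w. \<exists>i \<in> Obj J. \<exists>y \<in> carrier (fob F i). n j x = n i y \<and> w = m i y)"
      by (simp add: h_def)
    also have "\<dots> = m j x"
    proof (rule some_equality)
      show "\<exists>i \<in> Obj J. \<exists>y \<in> carrier (fob F i). n j x = n i y \<and> m j x = m i y"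
        using that by blast
      fix w assume "\<exists>i \<in> Obj J. \<exists>y \<in> carrier (fob F i). n j x = n i y \<and> w = m i y"
      then obtain i y where "i \<in> Obj J" "y \<in> carrier (fob F i)" "n j x = n i y" "w = m i y" by blast
      then show "w = m j x" using wd[OF that(1) _ that(2)] by simp
    qed
    finally show ?thesis .
  qed
  have "linear_map k N M h"
    unfolding linear_map_def
  proof (intro conjI ballI funcsetI)
    fix y assume "y \<in> carrier N"
    then obtain j x where jx: "j \<in> Obj J" "x \<in> carrier (fob F j)" "y = n j x" using surj by blast
    then show "h y \<in> carrier M" using h ml(1) by simp
    fix a assume a: "a \<in> carrier k"
    then have "a \<odot>\<^bsub>fob F j\<^esub> x \<in> carrier (fob F j)"
      using module.smult_closed[OF module_F] jx by blast
    then show "h (a \<odot>\<^bsub>N\<^esub> y) = a \<odot>\<^bsub>M\<^esub> h y"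
      using jx a h nl(3) ml(3) by metis
  next
    fix y y' assume "y \<in> carrier N" "y' \<in> carrier N"
    then obtain i x j x' where ij: "i \<in> Obj J" "x \<in> carrier (fob F i)" "y = n i x"
      "j \<in> Obj J" "x' \<in> carrier (fob F j)" "y' = n j x'" using surj by meson
    obtain l u v where l: "l \<in> Obj J" "u \<in> Hom J i l" "v \<in> Hom J j l"
      by (rule common_stage[OF ij(1,4,4)])
    let ?x = "far F i l u x" and ?x' = "far F j l v x'"
    have x: "?x \<in> carrier (fob F l)" "?x' \<in> carrier (fob F l)" "y = n l ?x" "y' = n l ?x'"
      using ij l far_closed cocone_far[OF N] by simp_all
    interpret F: module k "fob F l" by (rule module_F) fact
    have "h (n l ?x \<oplus>\<^bsub>N\<^esub> n l ?x') = h (n l ?x) \<oplus>\<^bsub>M\<^esub> h (n l ?x')"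
      using h nl(2)[OF l(1) x(1,2)] ml(2)[OF l(1) x(1,2)] x l F.M.a_closed by metis
    then show "h (y \<oplus>\<^bsub>N\<^esub> y') = h y \<oplus>\<^bsub>M\<^esub> h y'" using x by simp
  qed
  moreover have "h \<in> extensional (carrier N)" by (simp add: h_def)
  ultimately have hom: "h \<in> Hom (Mod k) N M" by (simp add: Mod_simps)
  have comp: "Cmp (Mod k) (fob F i) N M g (n i) = m i \<longleftrightarrow> (\<forall>x\<in>carrier (fob F i). g (n i x) = m i x)"
    if "i \<in> Obj J" for i g
  proof -
    have "compose (carrier (fob F i)) g (n i) = m i \<longleftrightarrow> (\<forall>x\<in>carrier (fob F i). g (n i x) = m i x)"
      by (subst extensional_restrict[OF cocone_linear(2)[OF M that], symmetric])
        (auto simp: compose_def restrict_def fun_eq_iff)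
    then show ?thesis by (simp add: Mod_simps)
  qed
  show "\<exists>!h. h \<in> Hom (Mod k) N M \<and> (\<forall>i\<in>Obj J. Cmp (Mod k) (fob F i) N M h (n i) = m i)"
  proof (rule ex1I)
    show "h \<in> Hom (Mod k) N M \<and> (\<forall>i\<in>Obj J. Cmp (Mod k) (fob F i) N M h (n i) = m i)"
      using hom comp h by blast
    fix g assume g: "g \<in> Hom (Mod k) N M \<and> (\<forall>i\<in>Obj J. Cmp (Mod k) (fob F i) N M g (n i) = m i)"
    have "g \<in> extensional (carrier N)" using g by (simp add: Mod_simps)
    moreover have "g y = h y" if "y \<in> carrier N" for y
      using surj[OF that] g comp h by metis
    ultimately show "g = h" using \<open>h \<in> extensional (carrier N)\<close> by (metis extensionalityI)
  qed
qed

section \<open>An explicit filtered colimit of modules with carrier inside the universe type\<close>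

definition enc :: "'i \<times> 'u \<Rightarrow> 'u" where
  "enc = (SOME e. inj_on e (SIGMA j:Obj J. carrier (fob F j)))"

text \<open>A class of \<open>eqv\<close> is not itself an element of \<open>'u\<close>; it is coded
  by a chosen member, carried into \<open>'u\<close> by \<open>enc\<close>. The choice in
  \<open>enc\<close> is meaningful once \<open>Obj J\<close> is small, which makes the disjoint
  union of the stages small.\<close>

definition cls :: "'i \<Rightarrow> 'u \<Rightarrow> 'u" where
  "cls j x = enc (SOME p. fst p \<in> Obj J \<and> snd p \<in> carrier (fob F (fst p)) \<and> eqv (fst p) (snd p) j x)"

text \<open>Equivalent pairs have the same candidates for a representative, so \<open>SOME\<close>
  returns the same one. Conversely, injectivity of \<open>enc\<close> yields one representative
  equivalent to both elements.\<close>

lemma cls_eq_iff: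
  assumes small: "small U (Obj J)"
    and ij: "i \<in> Obj J" "j \<in> Obj J" "x \<in> carrier (fob F i)" "y \<in> carrier (fob F j)"
  shows "cls i x = cls j y \<longleftrightarrow> eqv i x j y"
proof
  have e: "inj_on enc (SIGMA j:Obj J. carrier (fob F j))"
  proof -
    obtain e0 :: "'i \<times> 'u \<Rightarrow> 'u" where "inj_on e0 (SIGMA j:Obj J. carrier (fob F j))"
      by (rule small_embed[OF small_Sigma[OF small small_F]])
    then show ?thesis unfolding enc_def by (rule someI[where P = "\<lambda>e. inj_on e _"])
  qed
  let ?P = "\<lambda>i x p. fst p \<in> Obj J \<and> snd p \<in> carrier (fob F (fst p)) \<and> eqv (fst p) (snd p) i x"
  have P: "?P i x (SOME p. ?P i x p)" if "i \<in> Obj J" "x \<in> carrier (fob F i)" for i x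
    by (rule someI[of _ "(i, x)"]) (use that eqv_refl in auto)
  {
    assume e: "eqv i x j y"
    have "?P i x p = ?P j y p" for p
    proof (intro conj_cong refl iffI)
      assume p: "fst p \<in> Obj J" "snd p \<in> carrier (fob F (fst p))"
      show "eqv (fst p) (snd p) j y" if "eqv (fst p) (snd p) i x"
        by (rule eqv_trans[OF p(1) ij(1,2) p(2) ij(3,4) that e])
      show "eqv (fst p) (snd p) i x" if "eqv (fst p) (snd p) j y"
        by (rule eqv_trans[OF p(1) ij(2,1) p(2) ij(4,3) that eqv_sym[OF e]])
    qed
    then show "cls i x = cls j y" by (simp only: cls_def)
  next
    assume c: "cls i x = cls j y"
    define p q where "p = (SOME p. ?P i x p)" and "q = (SOME p. ?P j y p)"
    have p: "?P i x p" and q: "?P j y q"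
      using P[OF ij(1,3)] P[OF ij(2,4)] by (simp_all only: p_def q_def)
    have "enc p = enc q" using c by (simp only: cls_def p_def q_def)
    moreover have "p \<in> (SIGMA j:Obj J. carrier (fob F j))" using p by (cases p) simp
    moreover have "q \<in> (SIGMA j:Obj J. carrier (fob F j))" using q by (cases q) simp
    ultimately have "p = q" by (rule inj_onD[OF e])
    then show "eqv i x j y"
      using eqv_trans[of i "fst p" j x "snd p" y] p q ij eqv_sym by blast
  }
qed

lemma cls_far:
  assumes "small U (Obj J)" "i \<in> Obj J" "j \<in> Obj J" "u \<in> Hom J i j" "x \<in> carrier (fob F i)"
  shows "cls j (far F i j u x) = cls i x"
  using cls_eq_iff eqv_far eqv_sym far_closed assms by metis

definition colim_carrier :: "'u set" where
  "colim_carrier = (\<lambda>(j, x). cls j x) ` (SIGMA j:Obj J. carrier (fob F j))"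

lemma cls_closed: "j \<in> Obj J \<Longrightarrow> x \<in> carrier (fob F j) \<Longrightarrow> cls j x \<in> colim_carrier"
  by (force simp: colim_carrier_def)

text \<open>Each operation is computed at any stage carrying representatives. That the outcome does
  not depend on the choice is the content of \<open>colim_add\<close>, \<open>colim_smult\<close>
  and \<open>colim_zero\<close>.\<close>

definition colim :: "('k, 'u) module" where
  "colim = \<lparr>carrier = colim_carrier, monoid.mult = undefined, one = undefined,
     zero = (SOME z. \<exists>j\<in>Obj J. z = cls j \<zero>\<^bsub>fob F j\<^esub>),
     add = (\<lambda>p q. SOME z. \<exists>j\<in>Obj J. \<exists>x\<in>carrier (fob F j). \<exists>y\<in>carrier (fob F j).
        p = cls j x \<and> q = cls j y \<and> z = cls j (x \<oplus>\<^bsub>fob F j\<^esub> y)),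
     smult = (\<lambda>a p. SOME z. \<exists>j\<in>Obj J. \<exists>x\<in>carrier (fob F j). p = cls j x \<and> z = cls j (a \<odot>\<^bsub>fob F j\<^esub> x))\<rparr>"

context
  assumes small: "small U (Obj J)"
begin

text \<open>Two choices of representatives may lie at different stages \<open>j\<close> and
  \<open>i\<close>. By \<open>eqv_joint\<close> both summands agree at one stage \<open>m\<close>
  along the same pair of arrows, and these preserve sums.\<close>

lemma colim_add:
  assumes "j \<in> Obj J" "x \<in> carrier (fob F j)" "y \<in> carrier (fob F j)"
  shows "cls j x \<oplus>\<^bsub>colim\<^esub> cls j y = cls j (x \<oplus>\<^bsub>fob F j\<^esub> y)"
proof -
  have well_defined: "cls i (x' \<oplus>\<^bsub>fob F i\<^esub> y') = cls j (x \<oplus>\<^bsub>fob F j\<^esub> y)"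
    if i: "i \<in> Obj J" "x' \<in> carrier (fob F i)" "y' \<in> carrier (fob F i)" "cls j x = cls i x'" "cls j y = cls i y'"
    for i x' y'
  proof -
    have E: "eqv j x i x'" "eqv j y i y'" using cls_eq_iff small assms i by blast+
    obtain m u v where m: "m \<in> Obj J" "u \<in> Hom J j m" "v \<in> Hom J i m"
      "far F j m u x = far F i m v x'" "far F j m u y = far F i m v y'"
      by (rule eqv_joint[OF assms(1) i(1) assms(2) i(2) E(1) assms(3) i(3) E(2)])
    have "far F j m u (x \<oplus>\<^bsub>fob F j\<^esub> y) = far F i m v (x' \<oplus>\<^bsub>fob F i\<^esub> y')"
      using far_add m assms i by simp
    moreover have "x \<oplus>\<^bsub>fob F j\<^esub> y \<in> carrier (fob F j)" "x' \<oplus>\<^bsub>fob F i\<^esub> y' \<in> carrier (fob F i)"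
      using assms i module_F by (meson abelian_groupE(1) module.axioms(2))+
    ultimately show ?thesis using cls_far[OF small] assms(1) i(1) m by metis
  qed
  show ?thesis
    unfolding colim_def monoid.simps ring.simps module.simps
  proof (rule some_equality)
    show "\<exists>i\<in>Obj J. \<exists>x'\<in>carrier (fob F i). \<exists>y'\<in>carrier (fob F i).
        cls j x = cls i x' \<and> cls j y = cls i y' \<and>
         cls j (x \<oplus>\<^bsub>fob F j\<^esub> y) = cls i (x' \<oplus>\<^bsub>fob F i\<^esub> y')"
      using assms by blast
    fix z assume "\<exists>i\<in>Obj J. \<exists>x'\<in>carrier (fob F i). \<exists>y'\<in>carrier (fob F i).
        cls j x = cls i x' \<and> cls j y = cls i y' \<and>
         z = cls i (x' \<oplus>\<^bsub>fob F i\<^esub> y')"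
    then obtain i x' y' where "i \<in> Obj J" "x' \<in> carrier (fob F i)" "y' \<in> carrier (fob F i)"
      "cls j x = cls i x'" "cls j y = cls i y'"
      "z = cls i (x' \<oplus>\<^bsub>fob F i\<^esub> y')"
      by blast
    then show "z = cls j (x \<oplus>\<^bsub>fob F j\<^esub> y)" using well_defined by simp
  qed
qed

lemma colim_smult:
  assumes "j \<in> Obj J" "x \<in> carrier (fob F j)" "a \<in> carrier k"
  shows "a \<odot>\<^bsub>colim\<^esub> cls j x = cls j (a \<odot>\<^bsub>fob F j\<^esub> x)"
proof -
  have well_defined: "cls i (a \<odot>\<^bsub>fob F i\<^esub> x') = cls j (a \<odot>\<^bsub>fob F j\<^esub> x)"
    if i: "i \<in> Obj J" "x' \<in> carrier (fob F i)" "cls j x = cls i x'" for i x'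
  proof -
    have "eqv j x i x'" using cls_eq_iff small assms i by blast
    then obtain m u v where m: "m \<in> Obj J" "u \<in> Hom J j m" "v \<in> Hom J i m"
      "far F j m u x = far F i m v x'"
      unfolding eqv_def by blast
    have "far F j m u (a \<odot>\<^bsub>fob F j\<^esub> x) = far F i m v (a \<odot>\<^bsub>fob F i\<^esub> x')"
      using far_smult m assms i by simp
    moreover have "a \<odot>\<^bsub>fob F j\<^esub> x \<in> carrier (fob F j)" "a \<odot>\<^bsub>fob F i\<^esub> x' \<in> carrier (fob F i)"
      using module.smult_closed[OF module_F] assms i by simp_all
    ultimately show ?thesis using cls_far[OF small] assms(1) i(1) m by metis
  qed
  show ?thesis
    unfolding colim_def monoid.simps ring.simps module.simps
  proof (rule some_equality)
    show "\<exists>i\<in>Obj J. \<exists>x'\<in>carrier (fob F i).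
        cls j x = cls i x' \<and> cls j (a \<odot>\<^bsub>fob F j\<^esub> x) = cls i (a \<odot>\<^bsub>fob F i\<^esub> x')"
      using assms by blast
    fix z assume "\<exists>i\<in>Obj J. \<exists>x'\<in>carrier (fob F i). cls j x = cls i x' \<and> z = cls i (a \<odot>\<^bsub>fob F i\<^esub> x')"
    then obtain i x' where "i \<in> Obj J" "x' \<in> carrier (fob F i)" "cls j x = cls i x'" "z = cls i (a \<odot>\<^bsub>fob F i\<^esub> x')"
      by blast
    then show "z = cls j (a \<odot>\<^bsub>fob F j\<^esub> x)" using well_defined by simp
  qed
qed

lemma far_zero:
  assumes "i \<in> Obj J" "j \<in> Obj J" "u \<in> Hom J i j"
  shows "far F i j u \<zero>\<^bsub>fob F i\<^esub> = \<zero>\<^bsub>fob F j\<^esub>"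
proof -
  interpret Fi: module k "fob F i" by (rule module_F) fact
  interpret Fj: module k "fob F j" by (rule module_F) fact
  have "far F i j u (\<zero>\<^bsub>k\<^esub> \<odot>\<^bsub>fob F i\<^esub> \<zero>\<^bsub>fob F i\<^esub>) = \<zero>\<^bsub>k\<^esub> \<odot>\<^bsub>fob F j\<^esub> far F i j u \<zero>\<^bsub>fob F i\<^esub>"
    by (rule far_smult[OF assms]) simp_all
  also have "\<dots> = \<zero>\<^bsub>fob F j\<^esub>" using far_closed[OF assms] by simp
  finally show ?thesis by simp
qed

lemma colim_zero:
  assumes "j \<in> Obj J"
  shows "\<zero>\<^bsub>colim\<^esub> = cls j \<zero>\<^bsub>fob F j\<^esub>"
proof -
  have well_defined: "cls i \<zero>\<^bsub>fob F i\<^esub> = cls j \<zero>\<^bsub>fob F j\<^esub>" if i: "i \<in> Obj J" for i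
  proof -
    obtain m u v where "m \<in> Obj J" "u \<in> Hom J i m" "v \<in> Hom J j m"
      by (rule common_stage[OF i assms assms])
    moreover have "\<zero>\<^bsub>fob F i\<^esub> \<in> carrier (fob F i)" "\<zero>\<^bsub>fob F j\<^esub> \<in> carrier (fob F j)"
      using assms i module_F by (meson abelian_groupE(2) module.axioms(2))+
    ultimately show ?thesis using cls_far[OF small] far_zero assms i by metis
  qed
  show ?thesis
    unfolding colim_def monoid.simps ring.simps module.simps
  proof (rule some_equality)
    show "\<exists>i\<in>Obj J. cls j \<zero>\<^bsub>fob F j\<^esub> = cls i \<zero>\<^bsub>fob F i\<^esub>"
      using assms by blast
    fix z assume "\<exists>i\<in>Obj J. z = cls i \<zero>\<^bsub>fob F i\<^esub>"
    then obtain i where "i \<in> Obj J" "z = cls i \<zero>\<^bsub>fob F i\<^esub>"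
      by blast
    then show "z = cls j \<zero>\<^bsub>fob F j\<^esub>" using well_defined by simp
  qed
qed

lemma carrier_colim: "carrier colim = colim_carrier"
  by (simp add: colim_def)

text \<open>Each module axiom involves at most three elements of the carrier, so it can be inherited
  from the module at one stage.\<close>

lemma colim_common_stage:
  assumes "p \<in> carrier colim" "q \<in> carrier colim" "s \<in> carrier colim"
  obtains j x y z where "j \<in> Obj J" "x \<in> carrier (fob F j)" "y \<in> carrier (fob F j)"
    "z \<in> carrier (fob F j)" "p = cls j x" "q = cls j y" "s = cls j z"
proof -
  obtain i1 x1 i2 x2 i3 x3 where i: "i1 \<in> Obj J" "x1 \<in> carrier (fob F i1)" "p = cls i1 x1"
    "i2 \<in> Obj J" "x2 \<in> carrier (fob F i2)" "q = cls i2 x2"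
    "i3 \<in> Obj J" "x3 \<in> carrier (fob F i3)" "s = cls i3 x3"
    using assms unfolding carrier_colim colim_carrier_def by auto
  obtain m u v w where m: "m \<in> Obj J" "u \<in> Hom J i1 m" "v \<in> Hom J i2 m" "w \<in> Hom J i3 m"
    by (rule common_stage[OF i(1,4,7)])
  show thesis
    using that[of m "far F i1 m u x1" "far F i2 m v x2" "far F i3 m w x3"]
      cls_far[OF small] far_closed i m by simp
qed

lemma module_colim: "module k colim"
proof -
  \<comment> \<open>The empty quiver has a cocone, so there is a stage; it supplies the zero and,
    being a module, the ring axioms of \<open>k\<close>.\<close>
  obtain j0 where j0: "j0 \<in> Obj J" by (rule Obj_nonempty)
  interpret F0: module k "fob F j0" by (rule module_F) fact
  show ?thesis
  proof (rule moduleI[OF F0.R.cring_axioms abelian_groupI])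
    show "\<zero>\<^bsub>colim\<^esub> \<in> carrier colim"
      using colim_zero[OF j0] cls_closed[OF j0] carrier_colim F0.M.zero_closed by simp
  next
    fix p q s assume pqs: "p \<in> carrier colim" "q \<in> carrier colim" "s \<in> carrier colim"
    obtain j x y z where j: "j \<in> Obj J" "x \<in> carrier (fob F j)" "y \<in> carrier (fob F j)"
      "z \<in> carrier (fob F j)" "p = cls j x" "q = cls j y" "s = cls j z"
      by (rule colim_common_stage[OF pqs])
    interpret Fj: module k "fob F j" by (rule module_F) fact
    show "(p \<oplus>\<^bsub>colim\<^esub> q) \<oplus>\<^bsub>colim\<^esub> s = p \<oplus>\<^bsub>colim\<^esub> (q \<oplus>\<^bsub>colim\<^esub> s)"
      using j by (simp add: colim_add Fj.M.a_assoc)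
  next
    fix p q assume pq: "p \<in> carrier colim" "q \<in> carrier colim"
    obtain j x y where j: "j \<in> Obj J" "x \<in> carrier (fob F j)" "y \<in> carrier (fob F j)"
      "p = cls j x" "q = cls j y"
      by (rule colim_common_stage[OF pq(1,2,2)])
    interpret Fj: module k "fob F j" by (rule module_F) fact
    show "p \<oplus>\<^bsub>colim\<^esub> q \<in> carrier colim" using j by (simp add: colim_add carrier_colim cls_closed)
    show "p \<oplus>\<^bsub>colim\<^esub> q = q \<oplus>\<^bsub>colim\<^esub> p" using j by (simp add: colim_add Fj.M.a_comm)
    fix a assume a: "a \<in> carrier k"
    show "a \<odot>\<^bsub>colim\<^esub> (p \<oplus>\<^bsub>colim\<^esub> q) = a \<odot>\<^bsub>colim\<^esub> p \<oplus>\<^bsub>colim\<^esub> a \<odot>\<^bsub>colim\<^esub> q"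
      using j a by (simp add: colim_add colim_smult Fj.smult_r_distr)
  next
    fix p assume p: "p \<in> carrier colim"
    obtain j x where j: "j \<in> Obj J" "x \<in> carrier (fob F j)" "p = cls j x"
      by (rule colim_common_stage[OF p p p])
    interpret Fj: module k "fob F j" by (rule module_F) fact
    show "\<zero>\<^bsub>colim\<^esub> \<oplus>\<^bsub>colim\<^esub> p = p" using j by (simp add: colim_add colim_zero[OF j(1)])
    have "cls j (\<ominus>\<^bsub>fob F j\<^esub> x) \<oplus>\<^bsub>colim\<^esub> p = \<zero>\<^bsub>colim\<^esub>"
      using j by (simp add: colim_add colim_zero[OF j(1)] Fj.M.l_neg)
    then show "\<exists>q\<in>carrier colim. q \<oplus>\<^bsub>colim\<^esub> p = \<zero>\<^bsub>colim\<^esub>"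
      using j cls_closed carrier_colim by auto
    show "\<one>\<^bsub>k\<^esub> \<odot>\<^bsub>colim\<^esub> p = p" using j by (simp add: colim_smult)
    fix a assume a: "a \<in> carrier k"
    show "a \<odot>\<^bsub>colim\<^esub> p \<in> carrier colim"
      using j a by (simp add: colim_smult carrier_colim cls_closed)
    fix b assume b: "b \<in> carrier k"
    show "(a \<oplus>\<^bsub>k\<^esub> b) \<odot>\<^bsub>colim\<^esub> p = a \<odot>\<^bsub>colim\<^esub> p \<oplus>\<^bsub>colim\<^esub> b \<odot>\<^bsub>colim\<^esub> p"
      using j a b by (simp add: colim_smult colim_add Fj.smult_l_distr)
    show "(a \<otimes>\<^bsub>k\<^esub> b) \<odot>\<^bsub>colim\<^esub> p = a \<odot>\<^bsub>colim\<^esub> (b \<odot>\<^bsub>colim\<^esub> p)"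
      using j a b by (simp add: colim_smult Fj.smult_assoc1)
  qed
qed

lemma is_cocone_colim: "is_cocone J (Mod k) F colim (\<lambda>j. \<lambda>x\<in>carrier (fob F j). cls j x)"
proof -
  have "small U colim_carrier"
    unfolding colim_carrier_def by (intro small_image small_Sigma small small_F)
  then have "colim \<in> Obj (Mod k)"
    using module_colim by (simp add: Mod_simps carrier_colim small_def)
  moreover have "(\<lambda>x\<in>carrier (fob F j). cls j x) \<in> Hom (Mod k) (fob F j) colim" if "j \<in> Obj J" for j
  proof -
    interpret Fj: module k "fob F j" by (rule module_F) fact
    show ?thesis using that
      by (simp add: Mod_simps linear_map_def carrier_colim cls_closed colim_add colim_smult)
  qed
  moreover have "Cmp (Mod k) (fob F i) (fob F j) colim (\<lambda>x\<in>carrier (fob F j). cls j x) (far F i j u) =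
      (\<lambda>x\<in>carrier (fob F i). cls i x)" if "i \<in> Obj J" "j \<in> Obj J" "u \<in> Hom J i j" for i j u
    unfolding Mod_simps compose_def
    by (rule restrict_ext) (use that cls_far[OF small] far_closed in simp)
  ultimately show ?thesis by (simp add: is_cocone_def)
qed

text \<open>Comparison with the explicit colimit: the universal properties give \<open>h\<close>
  from \<open>N\<close> to \<open>colim\<close> and \<open>g\<close> back, with g h the identity by
  uniqueness. Thus every \<open>y\<close> equals \<open>g (h y)\<close>, which comes from a stage,
  and \<open>h\<close> turns an equality in \<open>N\<close> into an equality of classes.\<close>

lemma is_colimit_ModD:
  assumes N: "is_colimit J (Mod k) F N n"
  shows "y \<in> carrier N \<Longrightarrow> \<exists>j \<in> Obj J. \<exists>x \<in> carrier (fob F j). y = n j x"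
    and "\<lbrakk>j \<in> Obj J; x \<in> carrier (fob F j); z \<in> carrier (fob F j); n j x = n j z\<rbrakk>
      \<Longrightarrow> \<exists>m \<in> Obj J. \<exists>u \<in> Hom J j m. far F j m u x = far F j m u z"
proof -
  let ?c = "\<lambda>j. \<lambda>x\<in>carrier (fob F j). cls j x"
  note Nc = N[unfolded is_colimit_def, THEN conjunct1]
    and Nu = N[unfolded is_colimit_def, THEN conjunct2, rule_format]
  have C: "is_colimit J (Mod k) F colim ?c"
  proof (rule is_colimit_ModI[OF is_cocone_colim])
    show "\<exists>j\<in>Obj J. \<exists>x\<in>carrier (fob F j). y = ?c j x" if "y \<in> carrier colim" for y
      using that unfolding carrier_colim colim_carrier_def by auto
    show "eqv j x j y" if "j \<in> Obj J" "x \<in> carrier (fob F j)" "y \<in> carrier (fob F j)" "?c j x = ?c j y"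
      for j x y using that cls_eq_iff[OF small] by auto
  qed
  note Cu = C[unfolded is_colimit_def, THEN conjunct2, rule_format]
  obtain h where h: "h \<in> Hom (Mod k) N colim" "\<And>i. i \<in> Obj J \<Longrightarrow> Cmp (Mod k) (fob F i) N colim h (n i) = ?c i"
    using Nu[OF is_cocone_colim] by blast
  obtain g where g: "g \<in> Hom (Mod k) colim N" "\<And>i. i \<in> Obj J \<Longrightarrow> Cmp (Mod k) (fob F i) colim N g (?c i) = n i"
    using Cu[OF Nc] by blast
  have hn: "h (n j x) = cls j x" if "j \<in> Obj J" "x \<in> carrier (fob F j)" for j x
    using fun_cong[OF h(2)[OF that(1)], of x] that by (simp add: Mod_simps compose_def)
  have gc: "g (cls j x) = n j x" if "j \<in> Obj J" "x \<in> carrier (fob F j)" for j x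
    using fun_cong[OF g(2)[OF that(1)], of x] that by (simp add: Mod_simps compose_def)
  have hl: "linear_map k N colim h" and gl: "linear_map k colim N g"
    using h(1) g(1) by (simp_all add: Mod_simps)
  have id: "compose (carrier N) g h = (\<lambda>x\<in>carrier N. x)"
  proof -
    let ?Q = "\<lambda>f. f \<in> Hom (Mod k) N N \<and> (\<forall>i\<in>Obj J. Cmp (Mod k) (fob F i) N N f (n i) = n i)"
    have nN: "n i x \<in> carrier N" if "i \<in> Obj J" "x \<in> carrier (fob F i)" for i x
      using linear_mapD(1)[OF cocone_linear(1)[OF Nc]] that by blast
    have rst: "n i = restrict (n i) (carrier (fob F i))" if "i \<in> Obj J" for i
      using cocone_linear(2)[OF Nc that] by (simp add: extensional_restrict)
    have modN: "module k N" using Nc by (simp add: is_cocone_def Mod_simps)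
    interpret N: module k N by fact
    have "linear_map k N N (compose (carrier N) g h)"
      using hl gl linear_mapD[OF hl] linear_mapD[OF gl]
      by (auto simp: linear_map_def compose_def)
    then have "?Q (compose (carrier N) g h)"
      using hn gc nN rst by (auto simp: Mod_simps compose_def cong: restrict_cong)
    moreover have "?Q (\<lambda>x\<in>carrier N. x)"
      using nN rst by (auto simp: Mod_simps compose_def linear_map_def cong: restrict_cong)
    ultimately show ?thesis using Nu[OF Nc] by blast
  qed
  {
    assume y: "y \<in> carrier N"
    then have "h y \<in> carrier colim" using linear_mapD(1)[OF hl] by blast
    then obtain j x where "j \<in> Obj J" "x \<in> carrier (fob F j)" "h y = cls j x"
      unfolding carrier_colim colim_carrier_def by auto
    moreover have "g (h y) = y" using fun_cong[OF id, of y] y by (simp add: compose_def)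
    ultimately show "\<exists>j \<in> Obj J. \<exists>x \<in> carrier (fob F j). y = n j x" using gc by metis
  next
    assume j: "j \<in> Obj J" "x \<in> carrier (fob F j)" "z \<in> carrier (fob F j)" "n j x = n j z"
    then have "eqv j x j z" using hn cls_eq_iff[OF small] by metis
    \<comment> \<open>\<open>eqv\<close> provides two arrows out of \<open>j\<close>; the last
      conclusion of \<open>eqv_joint\<close> merges them into one.\<close>
    then show "\<exists>m \<in> Obj J. \<exists>u \<in> Hom J j m. far F j m u x = far F j m u z"
      using eqv_joint[OF j(1,1,2,3) _ j(2,3)] by metis
  }
qed

end

end

section \<open>Presentable objects\<close>

lemma mk_fct_simps:
  "a \<in> Obj C \<Longrightarrow> fob (mk_fct C fo fa) a = fo a"
  "a \<in> Obj C \<Longrightarrow> b \<in> Obj C \<Longrightarrow> f \<in> Hom C a b \<Longrightarrow> far (mk_fct C fo fa) a b f = fa a b f"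
  by (simp_all add: mk_fct_def arrows_def)

lemma mk_fct_eqI:
  assumes "\<And>a. a \<in> Obj C \<Longrightarrow> fo a = fo' a"
    and "\<And>a b f. \<lbrakk>a \<in> Obj C; b \<in> Obj C; f \<in> Hom C a b\<rbrakk> \<Longrightarrow> fa a b f = fa' a b f"
  shows "mk_fct C fo fa = mk_fct C fo' fa'"
  using assms by (auto simp: mk_fct_def arrows_def restrict_def fun_eq_iff)

lemma is_functor_mk_fct:
  assumes "category C"
    and "\<And>a. a \<in> Obj C \<Longrightarrow> fo a \<in> Obj D"
    and "\<And>a b f. \<lbrakk>a \<in> Obj C; b \<in> Obj C; f \<in> Hom C a b\<rbrakk> \<Longrightarrow> fa a b f \<in> Hom D (fo a) (fo b)"
    and "\<And>a. a \<in> Obj C \<Longrightarrow> fa a a (Idn C a) = Idn D (fo a)"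
    and "\<And>a b c f g. \<lbrakk>a \<in> Obj C; b \<in> Obj C; c \<in> Obj C; f \<in> Hom C a b; g \<in> Hom C b c\<rbrakk>
      \<Longrightarrow> fa a c (Cmp C a b c g f) = Cmp D (fo a) (fo b) (fo c) (fa b c g) (fa a b f)"
  shows "is_functor C D (mk_fct C fo fa)"
proof -
  interpret C: category C by fact
  have "mk_fct C fo fa = mk_fct C (fob (mk_fct C fo fa)) (far (mk_fct C fo fa))"
    by (rule mk_fct_eqI) (simp_all add: mk_fct_simps)
  then show ?thesis
    unfolding is_functor_def
    by (simp add: mk_fct_simps assms(2-5) C.Idn_closed C.Cmp_closed)
qed

lemma is_functorD:
  assumes "is_functor C D F"
  shows "a \<in> Obj C \<Longrightarrow> fob F a \<in> Obj D"
    and "a \<in> Obj C \<Longrightarrow> b \<in> Obj C \<Longrightarrow> f \<in> Hom C a b \<Longrightarrow> far F a b f \<in> Hom D (fob F a) (fob F b)"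
    and "a \<in> Obj C \<Longrightarrow> far F a a (Idn C a) = Idn D (fob F a)"
    and "a \<in> Obj C \<Longrightarrow> b \<in> Obj C \<Longrightarrow> c \<in> Obj C \<Longrightarrow> f \<in> Hom C a b \<Longrightarrow> g \<in> Hom C b c
      \<Longrightarrow> far F a c (Cmp C a b c g f) = Cmp D (fob F a) (fob F b) (fob F c) (far F b c g) (far F a b f)"
  using assms[unfolded is_functor_def, THEN conjunct2] by blast+

lemma is_functor_eq: "is_functor C D F \<Longrightarrow> mk_fct C (fob F) (far F) = F"
  unfolding is_functor_def by (rule sym, rule conjunct1)

lemma is_functor_fct_comp:
  assumes "category C" "is_functor C D F" "is_functor D E G"
  shows "is_functor C E (fct_comp C G F)"
  unfolding fct_comp_def
  by (rule is_functor_mk_fct) (simp_all add: assms(1) is_functorD[OF assms(2)] is_functorD[OF assms(3)])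

lemma is_coconeD:
  assumes "is_cocone J C D L l"
  shows "L \<in> Obj C"
    and "i \<in> Obj J \<Longrightarrow> l i \<in> Hom C (fob D i) L"
    and "i \<in> Obj J \<Longrightarrow> j \<in> Obj J \<Longrightarrow> u \<in> Hom J i j \<Longrightarrow> Cmp C (fob D i) (fob D j) L (l j) (far D i j u) = l i"
  using assms unfolding is_cocone_def by blast+

lemma is_colimit_cocone: "is_colimit J C D L l \<Longrightarrow> is_cocone J C D L l"
  by (simp add: is_colimit_def)

lemma is_cocone_fct_comp:
  assumes "is_functor J C D" "is_functor C E F" "is_cocone J C D L l"
  shows "is_cocone J E (fct_comp J F D) (fob F L) (\<lambda>i. far F (fob D i) L (l i))"
  unfolding is_cocone_def
proof (intro conjI ballI)
  note D = is_functorD[OF assms(1)] and F = is_functorD[OF assms(2)] and l = is_coconeD[OF assms(3)]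
  show "fob F L \<in> Obj E" using F(1) l(1) by blast
  fix i assume i: "i \<in> Obj J"
  then show "far F (fob D i) L (l i) \<in> Hom E (fob (fct_comp J F D) i) (fob F L)"
    using D F l by (simp add: fct_comp_def mk_fct_simps)
  fix j u assume "j \<in> Obj J" "u \<in> Hom J i j"
  then show "Cmp E (fob (fct_comp J F D) i) (fob (fct_comp J F D) j) (fob F L)
      (far F (fob D j) L (l j)) (far (fct_comp J F D) i j u) = far F (fob D i) L (l i)"
    using i D F(4)[of "fob D i" "fob D j" L "far D i j u" "l j"] l
    by (simp add: fct_comp_def mk_fct_simps)
qed

lemma (in category) cocone_Cmp:
  assumes "is_functor J C D" "is_cocone J C D L l" "M \<in> Obj C" "h \<in> Hom C L M"
  shows "is_cocone J C D M (\<lambda>i. Cmp C (fob D i) L M h (l i))"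
  unfolding is_cocone_def
proof (intro conjI ballI)
  note D = is_functorD[OF assms(1)] and l = is_coconeD[OF assms(2)]
  show "M \<in> Obj C" by fact
  fix i assume i: "i \<in> Obj J"
  then show "Cmp C (fob D i) L M h (l i) \<in> Hom C (fob D i) M"
    using Cmp_closed[OF D(1) l(1) assms(3) l(2) assms(4)] by simp
  fix j u assume j: "j \<in> Obj J" "u \<in> Hom J i j"
  then show "Cmp C (fob D i) (fob D j) M (Cmp C (fob D j) L M h (l j)) (far D i j u) =
      Cmp C (fob D i) L M h (l i)"
    using i Cmp_assoc[of "fob D i" "fob D j" L M "far D i j u" "l j" h] D l assms(3,4) by simp
qed

lemma (in category) colimit_hom_eqI:
  assumes "is_functor J C D" "is_colimit J C D L l" "M \<in> Obj C" "f \<in> Hom C L M" "g \<in> Hom C L M"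
    and "\<And>i. i \<in> Obj J \<Longrightarrow> Cmp C (fob D i) L M f (l i) = Cmp C (fob D i) L M g (l i)"
  shows "f = g"
proof -
  have "is_cocone J C D M (\<lambda>i. Cmp C (fob D i) L M f (l i))"
    by (rule cocone_Cmp[OF assms(1) is_colimit_cocone[OF assms(2)] assms(3,4)])
  then have "\<exists>!h. h \<in> Hom C L M \<and> (\<forall>i\<in>Obj J. Cmp C (fob D i) L M h (l i) = Cmp C (fob D i) L M f (l i))"
    using assms(2) unfolding is_colimit_def by blast
  then show ?thesis using assms(4-6) by metis
qed

text \<open>
  For a filtered diagram \<open>D\<close> with colimit \<open>l : D \<rightarrow> L\<close>, this says that \<open>colim C(X, D) \<rightarrow> C(X, L)\<close>
  is bijective.
\<close>

definition hom_colimit_bij ::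
  "('i, 'j, 'x) cat_scheme \<Rightarrow> ('o, 'm, 'y) cat_scheme \<Rightarrow> ('i, 'j, 'o, 'm) fct \<Rightarrow> 'o \<Rightarrow> ('i \<Rightarrow> 'm) \<Rightarrow> 'o \<Rightarrow> bool"
where
  "hom_colimit_bij J C D L l X \<longleftrightarrow>
     (\<forall>f \<in> Hom C X L. \<exists>j \<in> Obj J. \<exists>g \<in> Hom C X (fob D j). f = Cmp C X (fob D j) L (l j) g) \<and>
     (\<forall>j \<in> Obj J. \<forall>g \<in> Hom C X (fob D j). \<forall>g' \<in> Hom C X (fob D j).
        Cmp C X (fob D j) L (l j) g = Cmp C X (fob D j) L (l j) g' \<longrightarrow>
        (\<exists>m \<in> Obj J. \<exists>u \<in> Hom J j m.
           Cmp C X (fob D j) (fob D m) (far D j m u) g = Cmp C X (fob D j) (fob D m) (far D j m u) g'))"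

section \<open>Presentability expressed by lifting arrows to a stage\<close>

locale universe_klinear_category = universe U + C: klinear_category k C
  for U :: "'u itself" and k :: "('k, 'r) ring_scheme" and C :: "('o, 'u, 'k) kcat"
begin

lemma hom_functor_simps:
  "Y \<in> Obj C \<Longrightarrow> fob (hom_functor C X) Y = hmod C X Y"
  "\<lbrakk>Y \<in> Obj C; Z \<in> Obj C; f \<in> Hom C Y Z\<rbrakk>
    \<Longrightarrow> far (hom_functor C X) Y Z f = (\<lambda>g\<in>Hom C X Y. Cmp C X Y Z f g)"
  by (simp_all add: hom_functor_def mk_fct_simps)

text \<open>A hom-set is a subset of \<open>'u\<close> that may be as large as \<open>'u\<close>,
  whereas the objects of \<open>Mod k\<close> are small modules; hence the smallness
  assumption.\<close>

lemma is_functor_hom_functor: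
  assumes X: "X \<in> Obj C" and small: "\<And>Y. Y \<in> Obj C \<Longrightarrow> small U (Hom C X Y)"
  shows "is_functor C (Mod k) (hom_functor C X)"
  unfolding hom_functor_def
proof (rule is_functor_mk_fct)
  show "category C" by (rule C.category_axioms)
  fix Y assume Y: "Y \<in> Obj C"
  show "hmod C X Y \<in> Obj (Mod k)"
    using C.hmod_module C.hmod_carrier small X Y by (simp add: Mod_simps small_def)
  show "(\<lambda>g\<in>Hom C X Y. Cmp C X Y Y (Idn C Y) g) = Idn (Mod k) (hmod C X Y)"
    using C.hmod_carrier[OF X Y] C.Cmp_Idn_left[OF X Y] by (simp add: Mod_simps cong: restrict_cong)
  fix Z f assume Z: "Z \<in> Obj C" and f: "f \<in> Hom C Y Z"
  have "linear_map k (hmod C X Y) (hmod C X Z) (\<lambda>g\<in>Hom C X Y. Cmp C X Y Z f g)"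
  proof -
    interpret M: module k "hmod C X Y" by (rule C.hmod_module[OF X Y])
    show ?thesis
      using C.Cmp_linear_right[OF X Y Z f] C.hmod_carrier[OF X Y, symmetric]
      by (auto simp: linear_map_def)
  qed
  then show "(\<lambda>g\<in>Hom C X Y. Cmp C X Y Z f g) \<in> Hom (Mod k) (hmod C X Y) (hmod C X Z)"
    using C.hmod_carrier[OF X Y] by (simp add: Mod_simps)
  fix W h assume W: "W \<in> Obj C" and h: "h \<in> Hom C Z W"
  show "(\<lambda>g\<in>Hom C X Y. Cmp C X Y W (Cmp C Y Z W h f) g) =
      Cmp (Mod k) (hmod C X Y) (hmod C X Z) (hmod C X W)
        (\<lambda>g\<in>Hom C X Z. Cmp C X Z W h g) (\<lambda>g\<in>Hom C X Y. Cmp C X Y Z f g)"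
    unfolding Mod_simps compose_def C.hmod_carrier[OF X Y]
    by (rule restrict_ext) (use X Y Z W f h C.Cmp_closed C.Cmp_assoc in simp)
qed

text \<open>Presentability includes that \<open>hom_functor C X\<close> takes its values in small
  modules.\<close>

lemma presentable_small_Hom:
  assumes "presentable k C \<alpha> X" "Y \<in> Obj C"
  shows "small U (Hom C X Y)"
proof -
  have "X \<in> Obj C" "hmod C X Y \<in> Obj (Mod k)"
    using assms is_functorD(1)[of C "Mod k" "hom_functor C X" Y]
    by (auto simp: presentable_def hom_functor_simps)
  then show ?thesis using C.hmod_carrier assms(2) by (simp add: Mod_simps small_def)
qed

text \<open>\<open>is_colimit_ModD\<close> and \<open>is_colimit_ModI\<close> characterize filtered
  colimits in \<open>Mod k\<close> by elements; for the diagram C(X, D) their two conditions are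
  those of \<open>hom_colimit_bij\<close>.\<close>

lemma is_colimit_hom_functor_iff:
  fixes J :: "('i, 'j, 'x) cat_scheme" and r :: "'s rel"
  assumes "category J" "is_filtered r J" "Cinfinite r" "small U (Obj J)"
    and X: "X \<in> Obj C" "is_functor C (Mod k) (hom_functor C X)"
    and D: "is_functor J C D" "is_colimit J C D L l"
  shows "is_colimit J (Mod k) (fct_comp J (hom_functor C X) D) (fob (hom_functor C X) L)
      (\<lambda>i. far (hom_functor C X) (fob D i) L (l i)) \<longleftrightarrow> hom_colimit_bij J C D L l X"
    (is "is_colimit _ _ ?F ?N ?n \<longleftrightarrow> _")
proof -
  interpret J: category J by fact
  interpret F: filtered_Mod_diagram U k J r ?F
    by (intro filtered_Mod_diagram.intro filtered_Mod_diagram_axioms.intro universe_axioms assms(1-3)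
        is_functor_fct_comp[OF assms(1) D(1) X(2)])
  note DD = is_functorD[OF D(1)] and ll = is_coconeD[OF is_colimit_cocone[OF D(2)]]
  have N: "carrier ?N = Hom C X L" using C.hmod_carrier X ll(1) by (simp add: hom_functor_simps)
  have Fo: "carrier (fob ?F j) = Hom C X (fob D j)" if "j \<in> Obj J" for j
    using that C.hmod_carrier[OF X(1)] DD(1) by (simp add: fct_comp_def mk_fct_simps hom_functor_simps)
  have Fa: "far ?F j m u g = Cmp C X (fob D j) (fob D m) (far D j m u) g"
    if "j \<in> Obj J" "m \<in> Obj J" "u \<in> Hom J j m" "g \<in> Hom C X (fob D j)" for j m u g
    using that DD by (simp add: fct_comp_def mk_fct_simps hom_functor_simps)
  have n: "?n j g = Cmp C X (fob D j) L (l j) g" if "j \<in> Obj J" "g \<in> Hom C X (fob D j)" for j g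
    using that DD ll by (simp add: hom_functor_simps)
  show ?thesis
  proof
    assume c: "is_colimit J (Mod k) ?F ?N ?n"
    note c1 = F.is_colimit_ModD(1)[OF assms(4) c] and c2 = F.is_colimit_ModD(2)[OF assms(4) c]
    show "hom_colimit_bij J C D L l X"
      unfolding hom_colimit_bij_def
    proof (intro conjI ballI impI)
      fix f assume "f \<in> Hom C X L"
      then obtain j g where j: "j \<in> Obj J" "g \<in> carrier (fob ?F j)" "f = ?n j g"
        using c1 N by blast
      then show "\<exists>j\<in>Obj J. \<exists>g\<in>Hom C X (fob D j). f = Cmp C X (fob D j) L (l j) g"
        using n[OF j(1)] Fo[OF j(1)] by auto
    next
      fix j g g' assume j: "j \<in> Obj J" "g \<in> Hom C X (fob D j)" "g' \<in> Hom C X (fob D j)"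
        "Cmp C X (fob D j) L (l j) g = Cmp C X (fob D j) L (l j) g'"
      then have "?n j g = ?n j g'" using n by simp
      then obtain m u where "m \<in> Obj J" "u \<in> Hom J j m" "far ?F j m u g = far ?F j m u g'"
        using c2[of j g g'] j Fo by blast
      then show "\<exists>m\<in>Obj J. \<exists>u\<in>Hom J j m.
          Cmp C X (fob D j) (fob D m) (far D j m u) g = Cmp C X (fob D j) (fob D m) (far D j m u) g'"
        using Fa j by auto
    qed
  next
    assume b: "hom_colimit_bij J C D L l X"
    show "is_colimit J (Mod k) ?F ?N ?n"
    proof (rule F.is_colimit_ModI)
      show "is_cocone J (Mod k) ?F ?N ?n"
        by (rule is_cocone_fct_comp[OF D(1) X(2) is_colimit_cocone[OF D(2)]])
      fix y assume "y \<in> carrier ?N"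
      then obtain j g where j: "j \<in> Obj J" "g \<in> Hom C X (fob D j)" "y = Cmp C X (fob D j) L (l j) g"
        using b N unfolding hom_colimit_bij_def by blast
      then show "\<exists>j\<in>Obj J. \<exists>x\<in>carrier (fob ?F j). y = ?n j x"
        using n[OF j(1,2)] Fo[OF j(1)] by (intro bexI[of _ j] bexI[of _ g]) simp_all
    next
      fix j x y assume j: "j \<in> Obj J" "x \<in> carrier (fob ?F j)" "y \<in> carrier (fob ?F j)" "?n j x = ?n j y"
      then have xy: "x \<in> Hom C X (fob D j)" "y \<in> Hom C X (fob D j)" using Fo by blast+
      then have "Cmp C X (fob D j) L (l j) x = Cmp C X (fob D j) L (l j) y" using j n by simp
      then obtain m u where m: "m \<in> Obj J" "u \<in> Hom J j m"
        "Cmp C X (fob D j) (fob D m) (far D j m u) x = Cmp C X (fob D j) (fob D m) (far D j m u) y"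
        using b j(1) xy unfolding hom_colimit_bij_def by blast
      then have "far ?F j m u x = far ?F j m u y" using Fa j(1) xy by simp
      then show "F.eqv j x j y" unfolding F.eqv_def using m by blast
    qed
  qed
qed

lemma presentable_iff:
  assumes "Cinfinite (ordinal \<alpha>)"
  shows "presentable k C \<alpha> X \<longleftrightarrow> X \<in> Obj C \<and> is_functor C (Mod k) (hom_functor C X) \<and>
     (\<forall>J :: ('u, 'u) cat. \<forall>D L l.
        small_category J \<and> is_filtered (ordinal \<alpha>) J \<and> is_functor J C D \<and> is_colimit J C D L l \<longrightarrow>
        hom_colimit_bij J C D L l X)"
proof -
  have "is_colimit J (Mod k) (fct_comp J (hom_functor C X) D) (fob (hom_functor C X) L)
      (\<lambda>i. far (hom_functor C X) (fob D i) L (l i)) \<longleftrightarrow> hom_colimit_bij J C D L l X"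
    if X: "X \<in> Obj C" "is_functor C (Mod k) (hom_functor C X)"
      and J: "small_category J \<and> is_filtered (ordinal \<alpha>) J \<and> is_functor J C D \<and> is_colimit J C D L l"
    for J :: "('u, 'u) cat" and D L l
  proof -
    have "category J" "small U (Obj J)"
      using J category.small_Obj[of J "univ_card :: 'u rel"] by (auto simp: small_category_def small_def)
    then show ?thesis using is_colimit_hom_functor_iff[OF _ _ assms _ X] J by blast
  qed
  then show ?thesis unfolding presentable_def preserves_filtered_colimits_def by blast
qed

text \<open>A \<open>\<beta>\<close>-filtered index category is \<open>\<alpha>\<close>-filtered, so
  the colimits to be preserved for \<beta> are among those for \<alpha>.\<close>

lemma presentable_mono:
  assumes "(\<alpha>, \<beta>) \<in> univ_card" "presentable k C \<alpha> X"
  shows "presentable k C \<beta> X"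
proof -
  have "is_filtered (ordinal \<alpha>) J" if "is_filtered (ordinal \<beta>) J" for J :: "('u, 'u) cat"
    using is_filtered_mono[OF ordinal_mono[OF assms(1)] that] .
  then show ?thesis
    using assms(2) unfolding presentable_def preserves_filtered_colimits_def by blast
qed

text \<open>An arrow out of a colimit is determined by its composites with the cocone, which embeds
  the hom-set into a small product of small sets.\<close>

lemma small_Hom_colimit:
  assumes I: "small U (Obj I)" and Z: "is_functor I C Z" "is_colimit I C Z X z"
    and small: "\<And>i Y. \<lbrakk>i \<in> Obj I; Y \<in> Obj C\<rbrakk> \<Longrightarrow> small U (Hom C (fob Z i) Y)"
    and Y: "Y \<in> Obj C"
  shows "small U (Hom C X Y)"
proof -
  note zz = is_coconeD(1,2)[OF is_colimit_cocone[OF Z(2)]] and ZZ = is_functorD(1,2)[OF Z(1)]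
  define \<Phi> where "\<Phi> f = (\<lambda>i\<in>Obj I. Cmp C (fob Z i) X Y f (z i))" for f
  have inj: "inj_on \<Phi> (Hom C X Y)"
  proof (rule inj_onI)
    fix f g assume fg: "f \<in> Hom C X Y" "g \<in> Hom C X Y" "\<Phi> f = \<Phi> g"
    have "Cmp C (fob Z i) X Y f (z i) = Cmp C (fob Z i) X Y g (z i)" if "i \<in> Obj I" for i
      using fun_cong[OF fg(3), of i] that by (simp add: \<Phi>_def)
    then show "f = g" by (rule C.colimit_hom_eqI[OF Z Y fg(1,2)])
  qed
  have "\<Phi> ` Hom C X Y \<subseteq> (\<Pi>\<^sub>E i\<in>Obj I. Hom C (fob Z i) Y)"
    using C.Cmp_closed zz ZZ Y by (auto simp: \<Phi>_def)
  then have "|Hom C X Y| \<le>o |\<Pi>\<^sub>E i\<in>Obj I. Hom C (fob Z i) Y|"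
    using inj card_of_ordLeq by blast
  then show ?thesis by (rule small_card_mono) (intro small_PiE I small Y)
qed

text \<open>C(X, -) is the limit over \<open>I\<close> of the C(Z i, -), and its interchange with a
  \<open>\<beta>\<close>-filtered colimit is carried out on arrows. An arrow out of \<open>X\<close>
  is a family indexed by the objects of \<open>I\<close>, subject to one equation for each arrow of
  \<open>I\<close>; fewer than \<beta> choices or equations can be accommodated at a single stage of
  \<open>J\<close>.\<close>

lemma presentable_colimit:
  fixes I :: "('u, 'u) cat"
  assumes \<beta>: "Cinfinite (ordinal \<beta>)" and I: "small_category I" "|arrows I| <o ordinal \<beta>"
    and Z: "is_functor I C Z" "is_colimit I C Z X z" "\<And>i. i \<in> Obj I \<Longrightarrow> presentable k C \<beta> (fob Z i)"
  shows "presentable k C \<beta> X"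
proof -
  interpret I: category I using I by (simp add: small_category_def)
  have smallI: "small U (Obj I)"
    using I.small_Obj[of "univ_card :: 'u rel"] I(1) by (simp add: small_category_def small_def)
  note zz = is_coconeD(1,2)[OF is_colimit_cocone[OF Z(2)]] and ZZ = is_functorD(1,2)[OF Z(1)]
    and z_nat = is_coconeD(3)[OF is_colimit_cocone[OF Z(2)]]
  have ObjI: "|Obj I| <o ordinal \<beta>" by (rule I.small_Obj[OF I(2)])
  have image_less: "|f ` A| <o ordinal \<beta>" if "|A| <o ordinal \<beta>" for f :: "'b \<Rightarrow> 'c" and A
    using card_of_image that by (rule ordLeq_ordLess_trans)
  have finite_less: "|A| <o ordinal \<beta>" if "finite A" for A :: "'b set"
    using that natLeq_ordLeq_cinfinite[OF \<beta>] finite_iff_ordLess_natLeq ordLess_ordLeq_trans by blast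
  have insert_less: "|insert a A| <o ordinal \<beta>" if "|A| <o ordinal \<beta>" for a :: 'b and A
  proof -
    have "|{a}| <o ordinal \<beta>" by (rule finite_less) simp
    then have "|{a} \<union> A| <o ordinal \<beta>"
      using that \<beta> by (intro card_of_Un_ordLess_infinite_Field) (auto simp: cinfinite_def)
    then show ?thesis by simp
  qed
  have "hom_colimit_bij J C D L l X"
    if J: "small_category J" "is_filtered (ordinal \<beta>) J" and D: "is_functor J C D" "is_colimit J C D L l"
    for J :: "('u, 'u) cat" and D L l
  proof -
    interpret J: category J using J by (simp add: small_category_def)
    note ll = is_coconeD(1,2)[OF is_colimit_cocone[OF D(2)]] and DD = is_functorD(1,2)[OF D(1)]
      and l_nat = is_coconeD(3)[OF is_colimit_cocone[OF D(2)]] and D_Cmp = is_functorD(4)[OF D(1)]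
    have bij: "hom_colimit_bij J C D L l (fob Z i)" if "i \<in> Obj I" for i
      using Z(3)[OF that] J D unfolding presentable_iff[OF \<beta>] by blast
    \<comment> \<open>Applied with \<open>T\<close> the objects of \<open>I\<close> to compare two
      lifts of an arrow out of \<open>X\<close>, and with \<open>T\<close> the arrows of
      \<open>I\<close> to make a family of lifts compatible.\<close>
    have wide: "\<exists>m \<in> Obj J. \<exists>u \<in> Hom J j m. \<forall>t \<in> T.
        Cmp C (fob Z (s t)) (fob D j) (fob D m) (far D j m u) (p t) =
        Cmp C (fob Z (s t)) (fob D j) (fob D m) (far D j m u) (q t)"
      if j: "j \<in> Obj J" and T: "|T| <o ordinal \<beta>"
        and s: "\<And>t. t \<in> T \<Longrightarrow> s t \<in> Obj I"
        and pq: "\<And>t. t \<in> T \<Longrightarrow> p t \<in> Hom C (fob Z (s t)) (fob D j)"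
          "\<And>t. t \<in> T \<Longrightarrow> q t \<in> Hom C (fob Z (s t)) (fob D j)"
        and eq: "\<And>t. t \<in> T \<Longrightarrow> Cmp C (fob Z (s t)) (fob D j) L (l j) (p t) =
            Cmp C (fob Z (s t)) (fob D j) L (l j) (q t)"
      for j and T :: "'t set" and s p q
    proof -
      have "\<forall>t\<in>T. \<exists>m u. m \<in> Obj J \<and> u \<in> Hom J j m \<and>
          Cmp C (fob Z (s t)) (fob D j) (fob D m) (far D j m u) (p t) =
          Cmp C (fob Z (s t)) (fob D j) (fob D m) (far D j m u) (q t)"
        using bij s pq eq j unfolding hom_colimit_bij_def by blast
      then obtain m u where mu: "\<And>t. t \<in> T \<Longrightarrow> m t \<in> Obj J" "\<And>t. t \<in> T \<Longrightarrow> u t \<in> Hom J j (m t)"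
        "\<And>t. t \<in> T \<Longrightarrow> Cmp C (fob Z (s t)) (fob D j) (fob D (m t)) (far D j (m t) (u t)) (p t) =
          Cmp C (fob Z (s t)) (fob D j) (fob D (m t)) (far D j (m t) (u t)) (q t)"
        by metis
      \<comment> \<open>The quiver has one arrow \<open>u t\<close> out of \<open>j\<close> for each
        \<open>t\<close>. The leg \<open>c j\<close> of its cocone factors through every
        \<open>u t\<close>, hence identifies all the pairs at once.\<close>
      obtain n c where n: "n \<in> Obj J" "\<And>i. i \<in> insert j (m ` T) \<Longrightarrow> c i \<in> Hom J i n"
        "\<And>i i' w. (i, i', w) \<in> (\<lambda>t. (j, m t, u t)) ` T \<Longrightarrow> Cmp J i i' n (c i') w = c i"
      proof (rule filtered_quiver_cocone[OF J.category_axioms J(2) \<beta>])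
        show "(\<lambda>t. (j, m t, u t)) ` T \<subseteq> arrows J" using mu j by (auto simp: arrows_def)
        show "|(\<lambda>t. (j, m t, u t)) ` T| <o ordinal \<beta>" by (rule image_less[OF T])
        show "insert j (m ` T) \<subseteq> Obj J" using mu j by auto
        show "|insert j (m ` T)| <o ordinal \<beta>" by (intro insert_less image_less T)
      qed auto
      have "Cmp C (fob Z (s t)) (fob D j) (fob D n) (far D j n (c j)) (p t) =
          Cmp C (fob Z (s t)) (fob D j) (fob D n) (far D j n (c j)) (q t)" if t: "t \<in> T" for t
      proof -
        have cm: "c (m t) \<in> Hom J (m t) n" using n(2) t by blast
        have "c j = Cmp J j (m t) n (c (m t)) (u t)" using n(3)[of j "m t" "u t"] t by auto
        then have fc: "far D j n (c j) = Cmp C (fob D j) (fob D (m t)) (fob D n)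
            (far D (m t) n (c (m t))) (far D j (m t) (u t))"
          using D_Cmp[OF j mu(1)[OF t] n(1) mu(2)[OF t] cm] by simp
        have "Cmp C (fob Z (s t)) (fob D j) (fob D n) (far D j n (c j)) x =
            Cmp C (fob Z (s t)) (fob D (m t)) (fob D n) (far D (m t) n (c (m t)))
              (Cmp C (fob Z (s t)) (fob D j) (fob D (m t)) (far D j (m t) (u t)) x)"
          if "x \<in> Hom C (fob Z (s t)) (fob D j)" for x
          unfolding fc
          by (rule C.Cmp_assoc[OF ZZ(1)[OF s[OF t]] DD(1)[OF j] DD(1)[OF mu(1)[OF t]] DD(1)[OF n(1)] that
                DD(2)[OF j mu(1)[OF t] mu(2)[OF t]] DD(2)[OF mu(1)[OF t] n(1) cm], symmetric])
        then show ?thesis using pq[OF t] mu(3)[OF t] by simp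
      qed
      then show ?thesis using n(1,2) by blast
    qed
    show ?thesis
      unfolding hom_colimit_bij_def
    proof (intro conjI ballI impI)
      fix j g g' assume j: "j \<in> Obj J" and g: "g \<in> Hom C X (fob D j)" "g' \<in> Hom C X (fob D j)"
        and eq: "Cmp C X (fob D j) L (l j) g = Cmp C X (fob D j) L (l j) g'"
      have assoc: "Cmp C (fob Z i) (fob D j) M h (Cmp C (fob Z i) X (fob D j) x (z i)) =
          Cmp C (fob Z i) X M (Cmp C X (fob D j) M h x) (z i)"
        if "i \<in> Obj I" "M \<in> Obj C" "h \<in> Hom C (fob D j) M" "x \<in> Hom C X (fob D j)" for i M h x
        by (rule C.Cmp_assoc) (use that ZZ zz DD j in blast)+
      \<comment> \<open>At one stage the two arrows agree along every \<open>z i\<close>; the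
        universal property of \<open>X\<close> then makes them equal there.\<close>
      obtain m u where mu: "m \<in> Obj J" "u \<in> Hom J j m"
        "\<And>i. i \<in> Obj I \<Longrightarrow>
          Cmp C (fob Z i) (fob D j) (fob D m) (far D j m u) (Cmp C (fob Z i) X (fob D j) g (z i)) =
          Cmp C (fob Z i) (fob D j) (fob D m) (far D j m u) (Cmp C (fob Z i) X (fob D j) g' (z i))"
        using wide[OF j ObjI, of "\<lambda>i. i" "\<lambda>i. Cmp C (fob Z i) X (fob D j) g (z i)"
            "\<lambda>i. Cmp C (fob Z i) X (fob D j) g' (z i)"] assoc[OF _ ll(1) ll(2)[OF j]] g eq
          C.Cmp_closed[OF ZZ(1) zz(1) DD(1)[OF j] zz(2)]
        by auto
      have Du: "far D j m u \<in> Hom C (fob D j) (fob D m)" using DD(2) j mu(1,2) by blast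
      have "Cmp C X (fob D j) (fob D m) (far D j m u) g = Cmp C X (fob D j) (fob D m) (far D j m u) g'"
        using C.colimit_hom_eqI[OF Z(1,2) DD(1)[OF mu(1)]] mu(3) assoc[OF _ DD(1)[OF mu(1)] Du] g
          C.Cmp_closed[OF zz(1) DD(1)[OF j] DD(1)[OF mu(1)] _ Du] by metis
      then show "\<exists>m\<in>Obj J. \<exists>u\<in>Hom J j m.
          Cmp C X (fob D j) (fob D m) (far D j m u) g = Cmp C X (fob D j) (fob D m) (far D j m u) g'"
        using mu by blast
    next
      fix f assume f: "f \<in> Hom C X L"
      have fz: "Cmp C (fob Z i) X L f (z i) \<in> Hom C (fob Z i) L" if "i \<in> Obj I" for i
        using C.Cmp_closed ZZ(1) zz ll(1) f that by blast
      have "\<forall>i\<in>Obj I. \<exists>m g. m \<in> Obj J \<and> g \<in> Hom C (fob Z i) (fob D m) \<and>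
          Cmp C (fob Z i) X L f (z i) = Cmp C (fob Z i) (fob D m) L (l m) g"
        using bij fz unfolding hom_colimit_bij_def by blast
      then obtain m g where mg: "\<And>i. i \<in> Obj I \<Longrightarrow> m i \<in> Obj J"
        "\<And>i. i \<in> Obj I \<Longrightarrow> g i \<in> Hom C (fob Z i) (fob D (m i))"
        "\<And>i. i \<in> Obj I \<Longrightarrow> Cmp C (fob Z i) X L f (z i) = Cmp C (fob Z i) (fob D (m i)) L (l (m i)) (g i)"
        by metis
      \<comment> \<open>The lifts \<open>g i\<close> live at stages depending on \<open>i\<close>.
        As \<open>I\<close> has fewer than \<beta> objects, some \<open>j\<close> lies beyond all of
        these stages.\<close>
      obtain j c where j: "j \<in> Obj J" "\<And>i. i \<in> m ` Obj I \<Longrightarrow> c i \<in> Hom J i j"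
      proof (rule filtered_quiver_cocone[OF J.category_axioms J(2) \<beta>, of "{}" "m ` Obj I"])
        show "|{}| <o ordinal \<beta>" by (rule finite_less) simp
        show "|m ` Obj I| <o ordinal \<beta>" by (rule image_less[OF ObjI])
      qed (use mg in auto)
      define h where "h i = Cmp C (fob Z i) (fob D (m i)) (fob D j) (far D (m i) j (c (m i))) (g i)" for i
      have c: "far D (m i) j (c (m i)) \<in> Hom C (fob D (m i)) (fob D j)" if "i \<in> Obj I" for i
        using DD(2) mg(1) j that by blast
      have h: "h i \<in> Hom C (fob Z i) (fob D j)" if "i \<in> Obj I" for i
        unfolding h_def by (rule C.Cmp_closed) (use that ZZ DD mg(1,2) j c in blast)+
      have lh: "Cmp C (fob Z i) (fob D j) L (l j) (h i) = Cmp C (fob Z i) X L f (z i)" if "i \<in> Obj I" for i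
      proof -
        have "Cmp C (fob Z i) (fob D j) L (l j) (h i) =
            Cmp C (fob Z i) (fob D (m i)) L (Cmp C (fob D (m i)) (fob D j) L (l j) (far D (m i) j (c (m i)))) (g i)"
          unfolding h_def by (rule C.Cmp_assoc) (use that ZZ DD mg(1,2) j c ll in blast)+
        then show ?thesis using l_nat[OF mg(1)[OF that] j(1)] j(2) mg(3) that by simp
      qed
      text \<open>The \<open>h i\<close> form a cocone on \<open>Z\<close> only at a later stage, which exists as \<open>I\<close> has fewer than
        \<open>\<beta>\<close> arrows.\<close>
      let ?s = "\<lambda>(i, i', a). i" and ?p = "\<lambda>(i, i', a). Cmp C (fob Z i) (fob Z i') (fob D j) (h i') (far Z i i' a)"
        and ?q = "\<lambda>(i, i', a). h i"
      have "Cmp C (fob Z i) (fob D j) L (l j) (Cmp C (fob Z i) (fob Z i') (fob D j) (h i') (far Z i i' a)) =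
          Cmp C (fob Z i) (fob D j) L (l j) (h i)" if a: "i \<in> Obj I" "i' \<in> Obj I" "a \<in> Hom I i i'" for i i' a
      proof -
        have "Cmp C (fob Z i) (fob D j) L (l j) (Cmp C (fob Z i) (fob Z i') (fob D j) (h i') (far Z i i' a)) =
            Cmp C (fob Z i) (fob Z i') L (Cmp C (fob Z i') (fob D j) L (l j) (h i')) (far Z i i' a)"
          by (rule C.Cmp_assoc) (use a ZZ DD j ll h in blast)+
        also have "\<dots> = Cmp C (fob Z i) (fob Z i') L (Cmp C (fob Z i') X L f (z i')) (far Z i i' a)"
          using lh a by simp
        also have "\<dots> = Cmp C (fob Z i) X L f (Cmp C (fob Z i) (fob Z i') X (z i') (far Z i i' a))"
          by (rule C.Cmp_assoc[symmetric]) (use a ZZ zz ll f in blast)+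
        also have "\<dots> = Cmp C (fob Z i) (fob D j) L (l j) (h i)"
          using z_nat[OF a] lh a by simp
        finally show ?thesis .
      qed
      moreover have "Cmp C (fob Z i) (fob Z i') (fob D j) (h i') (far Z i i' a) \<in> Hom C (fob Z i) (fob D j)"
        if "i \<in> Obj I" "i' \<in> Obj I" "a \<in> Hom I i i'" for i i' a
        by (rule C.Cmp_closed) (use that ZZ DD j h in blast)+
      ultimately obtain n u where nu: "n \<in> Obj J" "u \<in> Hom J j n"
        "\<And>i i' a. \<lbrakk>i \<in> Obj I; i' \<in> Obj I; a \<in> Hom I i i'\<rbrakk> \<Longrightarrow>
          Cmp C (fob Z i) (fob D j) (fob D n) (far D j n u)
            (Cmp C (fob Z i) (fob Z i') (fob D j) (h i') (far Z i i' a)) =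
          Cmp C (fob Z i) (fob D j) (fob D n) (far D j n u) (h i)"
        using wide[OF j(1) I(2), of ?s ?p ?q] h unfolding arrows_def by auto
      have Du: "far D j n u \<in> Hom C (fob D j) (fob D n)" using DD(2) j nu(1,2) by blast
      have "is_cocone I C Z (fob D n) (\<lambda>i. Cmp C (fob Z i) (fob D j) (fob D n) (far D j n u) (h i))"
        unfolding is_cocone_def
      proof (intro conjI ballI)
        show "fob D n \<in> Obj C" using DD nu(1) by blast
        fix i assume i: "i \<in> Obj I"
        show "Cmp C (fob Z i) (fob D j) (fob D n) (far D j n u) (h i) \<in> Hom C (fob Z i) (fob D n)"
          by (rule C.Cmp_closed) (use i ZZ DD j nu(1,2) h Du in blast)+
        fix i' a assume i': "i' \<in> Obj I" "a \<in> Hom I i i'"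
        have "Cmp C (fob Z i) (fob Z i') (fob D n)
            (Cmp C (fob Z i') (fob D j) (fob D n) (far D j n u) (h i')) (far Z i i' a) =
          Cmp C (fob Z i) (fob D j) (fob D n) (far D j n u)
            (Cmp C (fob Z i) (fob Z i') (fob D j) (h i') (far Z i i' a))"
          by (rule C.Cmp_assoc[symmetric]) (use i i' ZZ DD j nu(1,2) h Du in blast)+
        then show "Cmp C (fob Z i) (fob Z i') (fob D n)
            (Cmp C (fob Z i') (fob D j) (fob D n) (far D j n u) (h i')) (far Z i i' a) =
          Cmp C (fob Z i) (fob D j) (fob D n) (far D j n u) (h i)"
          using nu(3) i i' by simp
      qed
      then obtain w where w: "w \<in> Hom C X (fob D n)"
        "\<And>i. i \<in> Obj I \<Longrightarrow> Cmp C (fob Z i) X (fob D n) w (z i) =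
          Cmp C (fob Z i) (fob D j) (fob D n) (far D j n u) (h i)"
        using Z(2) unfolding is_colimit_def by blast
      have "f = Cmp C X (fob D n) L (l n) w"
      proof (rule C.colimit_hom_eqI[OF Z(1,2) ll(1) f])
        show "Cmp C X (fob D n) L (l n) w \<in> Hom C X L"
          using C.Cmp_closed zz(1) DD(1) ll nu(1) w(1) by blast
        fix i assume i: "i \<in> Obj I"
        have "Cmp C (fob Z i) X L (Cmp C X (fob D n) L (l n) w) (z i) =
            Cmp C (fob Z i) (fob D n) L (l n) (Cmp C (fob Z i) X (fob D n) w (z i))"
          by (rule C.Cmp_assoc[symmetric]) (use i ZZ zz DD nu(1,2) ll w(1) in blast)+
        also have "\<dots> = Cmp C (fob Z i) (fob D n) L (l n)
            (Cmp C (fob Z i) (fob D j) (fob D n) (far D j n u) (h i))"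
          using w(2) i by simp
        also have "\<dots> = Cmp C (fob Z i) (fob D j) L (Cmp C (fob D j) (fob D n) L (l n) (far D j n u)) (h i)"
          by (rule C.Cmp_assoc) (use i ZZ DD nu(1,2) ll j h Du in blast)+
        also have "\<dots> = Cmp C (fob Z i) X L f (z i)"
          using l_nat[OF j(1) nu(1,2)] lh i by simp
        finally show "Cmp C (fob Z i) X L f (z i) =
            Cmp C (fob Z i) X L (Cmp C X (fob D n) L (l n) w) (z i)" by simp
      qed
      then show "\<exists>j\<in>Obj J. \<exists>g\<in>Hom C X (fob D j). f = Cmp C X (fob D j) L (l j) g"
        using nu(1) w(1) by blast
    qed
  qed
  \<comment> \<open>Smallness of the hom-sets out of \<open>X\<close> is inherited from the objects
    \<open>fob Z i\<close>.\<close>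
  moreover have "is_functor C (Mod k) (hom_functor C X)"
    by (rule is_functor_hom_functor[OF zz(1) small_Hom_colimit[OF smallI Z(1,2)]])
      (use Z(3) presentable_small_Hom in blast)+
  ultimately show ?thesis
    unfolding presentable_iff[OF \<beta>] using zz(1) by blast
qed

lemma locally_presentable_ex_presentable:
  assumes "locally_presentable k C" "X \<in> Obj C"
  shows "\<exists>\<beta> \<in> small_regular_cardinals. presentable k C \<beta> X"
proof -
  obtain \<alpha> G where G: "\<forall>X\<in>G. presentable k C \<alpha> X" "\<forall>X\<in>Obj C. \<exists>(J :: ('u, 'u) cat) D l.
      small_category J \<and> is_filtered (ordinal \<alpha>) J \<and> is_functor J C D \<and>
      (\<forall>i\<in>Obj J. fob D i \<in> G) \<and> is_colimit J C D X l"
    using assms(1) unfolding locally_presentable_def locally_presentable_at_def by blast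
  obtain J :: "('u, 'u) cat" and D l where J: "small_category J" "is_functor J C D"
      "\<forall>i\<in>Obj J. fob D i \<in> G" "is_colimit J C D X l"
    using G(2) assms(2) by blast
  have "small U (arrows J)" using J(1) by (simp add: small_category_def small_def)
  then obtain \<beta> where \<beta>: "\<beta> \<in> small_regular_cardinals" "(\<alpha>, \<beta>) \<in> univ_card" "|arrows J| <o ordinal \<beta>"
    by (rule small_regular_above)
  have "presentable k C \<beta> X"
    by (rule presentable_colimit[OF _ J(1) \<beta>(3) J(2,4)])
      (use \<beta> J(3) G(1) presentable_mono in \<open>auto simp: small_regular_cardinals_def\<close>)
  then show ?thesis using \<beta>(1) by blast
qed

end

section \<open>Commutative squares\<close>

text \<open>The horizontal arrows are \<open>u\<close> and \<open>u'\<close>, the vertical ones \<open>h\<close> and \<open>h'\<close>.\<close>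

definition square ::
  "('o, 'm, 'x) cat_scheme \<Rightarrow> 'o \<Rightarrow> 'o \<Rightarrow> 'o \<Rightarrow> 'o \<Rightarrow> 'm \<Rightarrow> 'm \<Rightarrow> 'm \<Rightarrow> 'm \<Rightarrow> bool" where
  "square C a b c d u h h' u' \<longleftrightarrow>
     u \<in> Hom C a b \<and> h \<in> Hom C a c \<and> h' \<in> Hom C b d \<and> u' \<in> Hom C c d \<and>
     Cmp C a b d h' u = Cmp C a c d u' h"

lemma square_transpose: "square C a b c d u h h' u' \<Longrightarrow> square C a c b d h u u' h'"
  by (simp add: square_def)

context category
begin

lemma square_hcomp:
  assumes "a \<in> Obj C" "b \<in> Obj C" "c \<in> Obj C" "d \<in> Obj C" "e \<in> Obj C" "f \<in> Obj C"
    and s: "square C a b d e u h h' u'" and t: "square C b c e f v h' h'' v'"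
  shows "square C a c d f (Cmp C a b c v u) h h'' (Cmp C d e f v' u')"
proof -
  have m: "u \<in> Hom C a b" "h \<in> Hom C a d" "h' \<in> Hom C b e" "u' \<in> Hom C d e"
    "v \<in> Hom C b c" "h'' \<in> Hom C c f" "v' \<in> Hom C e f"
    and eq: "Cmp C a b e h' u = Cmp C a d e u' h" "Cmp C b c f h'' v = Cmp C b e f v' h'"
    using s t by (simp_all add: square_def)
  have "Cmp C a c f h'' (Cmp C a b c v u) = Cmp C a b f (Cmp C b c f h'' v) u"
    by (rule Cmp_assoc) fact+
  also have "\<dots> = Cmp C a e f v' (Cmp C a b e h' u)"
    unfolding eq(2) by (rule Cmp_assoc[symmetric]) fact+
  also have "\<dots> = Cmp C a d f (Cmp C d e f v' u') h"
    unfolding eq(1) by (rule Cmp_assoc) fact+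
  finally show ?thesis
    using m assms(1-6) Cmp_closed by (simp add: square_def)
qed

lemma square_vcomp:
  assumes "a \<in> Obj C" "b \<in> Obj C" "c \<in> Obj C" "d \<in> Obj C" "e \<in> Obj C" "f \<in> Obj C"
    and "square C a b c d u h h' u'" "square C c d e f u' g g' u''"
  shows "square C a b e f u (Cmp C a c e g h) (Cmp C b d f g' h') u''"
  using square_hcomp[OF assms(1,3,5,2,4,6) assms(7,8)[THEN square_transpose]] by (rule square_transpose)

lemma square_Idn: "a \<in> Obj C \<Longrightarrow> b \<in> Obj C \<Longrightarrow> u \<in> Hom C a b \<Longrightarrow> square C a b a b u (Idn C a) (Idn C b) u"
  by (simp add: square_def Idn_closed Cmp_Idn_left Cmp_Idn_right)

lemma iso_monic:
  assumes "a \<in> Obj C" "b \<in> Obj C" "c \<in> Obj C" "is_iso C b c p" "f \<in> Hom C a b" "g \<in> Hom C a b"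
    and "Cmp C a b c p f = Cmp C a b c p g"
  shows "f = g"
proof -
  obtain q where q: "q \<in> Hom C c b" "Cmp C b c b q p = Idn C b" and p: "p \<in> Hom C b c"
    using assms(4) unfolding is_iso_def by blast
  have "x = Cmp C a c b q (Cmp C a b c p x)" if "x \<in> Hom C a b" for x
    using Cmp_assoc[OF assms(1-3,2) that p q(1)] Cmp_Idn_left[OF assms(1,2) that] q(2) by simp
  then show ?thesis using assms(5-7) by metis
qed

text \<open>The two ways round the upper square agree after composition with \<open>q\<close>, which
  is monic. This descends a square from a common stage to the least stages of its corners.\<close>

lemma square_cancel:
  assumes "a \<in> Obj C" "b \<in> Obj C" "c \<in> Obj C" "d \<in> Obj C" "x \<in> Obj C" "y \<in> Obj C"
    and s: "square C a b x y u (Cmp C a c x p h) (Cmp C b d y q k) z"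
    and t: "square C c d x y u' p q z"
    and h: "h \<in> Hom C a c" and k: "k \<in> Hom C b d" and q: "is_iso C d y q"
  shows "square C a b c d u h k u'"
proof -
  have m: "u \<in> Hom C a b" "u' \<in> Hom C c d" "p \<in> Hom C c x" "q \<in> Hom C d y" "z \<in> Hom C x y"
    and eq: "Cmp C a b y (Cmp C b d y q k) u = Cmp C a x y z (Cmp C a c x p h)"
      "Cmp C c d y q u' = Cmp C c x y z p"
    using s t by (simp_all add: square_def)
  have "Cmp C a d y q (Cmp C a b d k u) = Cmp C a x y z (Cmp C a c x p h)"
    unfolding eq(1)[symmetric] by (rule Cmp_assoc) fact+
  also have "\<dots> = Cmp C a c y (Cmp C c d y q u') h"
    unfolding eq(2) by (rule Cmp_assoc) fact+
  also have "\<dots> = Cmp C a d y q (Cmp C a c d u' h)"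
    by (rule Cmp_assoc[symmetric]) fact+
  finally have "Cmp C a b d k u = Cmp C a c d u' h"
    by (rule iso_monic[OF assms(1,4,6) q, rotated 2]) (rule Cmp_closed; fact)+
  then show ?thesis using m h k by (simp add: square_def)
qed

lemma square_unique:
  assumes "a \<in> Obj C" "b \<in> Obj C" "d \<in> Obj C" "is_iso C b d h'"
    and "square C a b c d u h h' u'" "square C a b c d v h h' u'"
  shows "u = v"
  using iso_monic[OF assms(1-4), of u v] assms(5,6) by (simp add: square_def)

text \<open>The missing side is u' h followed by an inverse of h'. With \<open>square_unique\<close>
  this is what defines a glued functor on arrows.\<close>

lemma square_fill:
  assumes "a \<in> Obj C" "b \<in> Obj C" "c \<in> Obj C" "d \<in> Obj C" "is_iso C b d h'"
    and "h \<in> Hom C a c" "u' \<in> Hom C c d"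
  shows "\<exists>u. square C a b c d u h h' u'"
proof -
  obtain q where q: "q \<in> Hom C d b" "Cmp C d b d h' q = Idn C d" and h': "h' \<in> Hom C b d"
    using assms(5) unfolding is_iso_def by blast
  have w: "Cmp C a c d u' h \<in> Hom C a d" by (rule Cmp_closed) fact+
  have "Cmp C a b d h' (Cmp C a d b q (Cmp C a c d u' h)) = Cmp C a c d u' h"
    using Cmp_assoc[OF assms(1,4,2,4) w q(1) h'] q(2) Cmp_Idn_left[OF assms(1,4) w] by simp
  then show ?thesis
    using w q(1) h' assms Cmp_closed by (intro exI[of _ "Cmp C a d b q (Cmp C a c d u' h)"]) (simp add: square_def)
qed

text \<open>Precompose the equation of the square with \<open>g\<close> and postcompose it with
  \<open>g'\<close>; then h g and g' h' cancel.\<close>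

lemma square_inverse:
  assumes ob: "a \<in> Obj C" "b \<in> Obj C" "c \<in> Obj C" "d \<in> Obj C"
    and s: "square C a b c d u h h' u'"
    and g: "g \<in> Hom C c a" "Cmp C c a c h g = Idn C c"
    and g': "g' \<in> Hom C d b" "Cmp C b d b g' h' = Idn C b"
  shows "square C c d a b u' g g' u"
proof -
  have m: "u \<in> Hom C a b" "u' \<in> Hom C c d" "h \<in> Hom C a c" "h' \<in> Hom C b d"
    and eq: "Cmp C a b d h' u = Cmp C a c d u' h"
    using s by (simp_all add: square_def)
  have ug: "Cmp C c a b u g \<in> Hom C c b" by (rule Cmp_closed) fact+
  have "Cmp C c d b g' u' = Cmp C c d b g' (Cmp C c c d u' (Cmp C c a c h g))"
    using g m ob by (simp add: Cmp_Idn_right)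
  also have "\<dots> = Cmp C c d b g' (Cmp C c a d (Cmp C a c d u' h) g)"
    using Cmp_assoc[OF ob(3,1,3,4) g(1) m(3,2)] by simp
  also have "\<dots> = Cmp C c d b g' (Cmp C c b d h' (Cmp C c a b u g))"
    unfolding eq[symmetric] using Cmp_assoc[OF ob(3,1,2,4) g(1) m(1,4)] by simp
  also have "\<dots> = Cmp C c b b (Cmp C b d b g' h') (Cmp C c a b u g)"
    by (rule Cmp_assoc) fact+
  also have "\<dots> = Cmp C c a b u g" using g'(2) Cmp_Idn_left[OF ob(3,2) ug] by simp
  finally show ?thesis using m g g' by (simp add: square_def)
qed

lemma is_nat_iso_Idn:
  "is_nat_iso C C (fct_id C) (fct_id C) (\<lambda>a\<in>Obj C. Idn C a)"
  by (auto simp: is_nat_iso_def is_nat_trans_def is_iso_def fct_id_def mk_fct_simps Idn_closed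
      Cmp_Idn_left Cmp_Idn_right)

end

text \<open>Brings naturality into the form in which squares can be pasted and inverted.\<close>

lemma is_nat_trans_iff_square:
  assumes "is_functor C D F" "is_functor C D G"
  shows "is_nat_trans C D F G \<eta> \<longleftrightarrow> \<eta> \<in> extensional (Obj C) \<and>
    (\<forall>a\<in>Obj C. \<eta> a \<in> Hom D (fob F a) (fob G a)) \<and>
    (\<forall>a\<in>Obj C. \<forall>b\<in>Obj C. \<forall>f\<in>Hom C a b.
      square D (fob F a) (fob F b) (fob G a) (fob G b) (far F a b f) (\<eta> a) (\<eta> b) (far G a b f))"
  using is_functorD(2)[OF assms(1)] is_functorD(2)[OF assms(2)]
  unfolding is_nat_trans_def square_def by blast

section \<open>Functor categories\<close>

lemma klinear_functor_cat_simps: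
  "Obj (klinear_functor_cat k C D) = {F. klinear_functor k C D F}"
  "Hom (klinear_functor_cat k C D) F G = {\<eta>. is_nat_trans C D F G \<eta>}"
  "Cmp (klinear_functor_cat k C D) F G H \<theta> \<eta> =
     (\<lambda>a\<in>Obj C. Cmp D (fob F a) (fob G a) (fob H a) (\<theta> a) (\<eta> a))"
  "Idn (klinear_functor_cat k C D) F = (\<lambda>a\<in>Obj C. Idn D (fob F a))"
  by (simp_all add: klinear_functor_cat_def)

lemma category_klinear_functor_cat:
  assumes "category D"
  shows "category (klinear_functor_cat k C D)"
proof -
  interpret D: category D by fact
  have ob: "fob F a \<in> Obj D" if "klinear_functor k C D F" "a \<in> Obj C" for F a
    using that is_functorD(1) by (auto simp: klinear_functor_def)
  have F: "is_functor C D F" if "klinear_functor k C D F" for F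
    using that by (simp add: klinear_functor_def)
  have \<eta>: "\<eta> a \<in> Hom D (fob F a) (fob G a)" if "is_nat_trans C D F G \<eta>" "a \<in> Obj C" for F G \<eta> a
    using that by (simp add: is_nat_trans_def)
  show ?thesis
  proof (unfold_locales; unfold klinear_functor_cat_simps mem_Collect_eq)
    fix F assume "klinear_functor k C D F"
    then show "is_nat_trans C D F F (\<lambda>a\<in>Obj C. Idn D (fob F a))"
      using ob D.square_Idn is_functorD(2)[OF F] D.Idn_closed by (simp add: is_nat_trans_iff_square F)
  next
    fix F G H \<eta> \<theta>
    assume fs: "klinear_functor k C D F" "klinear_functor k C D G" "klinear_functor k C D H"
      and nat: "is_nat_trans C D F G \<eta>" "is_nat_trans C D G H \<theta>"
    show "is_nat_trans C D F H (\<lambda>a\<in>Obj C. Cmp D (fob F a) (fob G a) (fob H a) (\<theta> a) (\<eta> a))"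
      unfolding is_nat_trans_iff_square[OF F[OF fs(1)] F[OF fs(3)]]
    proof (intro conjI ballI)
      fix a assume a: "a \<in> Obj C"
      show "(\<lambda>a\<in>Obj C. Cmp D (fob F a) (fob G a) (fob H a) (\<theta> a) (\<eta> a)) a \<in> Hom D (fob F a) (fob H a)"
        using a D.Cmp_closed ob fs \<eta>[OF nat(1)] \<eta>[OF nat(2)] by simp
      fix b f assume b: "b \<in> Obj C" "f \<in> Hom C a b"
      have "square D (fob F a) (fob F b) (fob H a) (fob H b) (far F a b f)
        (Cmp D (fob F a) (fob G a) (fob H a) (\<theta> a) (\<eta> a)) (Cmp D (fob F b) (fob G b) (fob H b) (\<theta> b) (\<eta> b)) (far H a b f)"
        by (rule D.square_vcomp[of _ _ "fob G a" "fob G b" _ _ _ _ _ "far G a b f"])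
          (use ob fs a b nat F in \<open>simp_all add: is_nat_trans_iff_square\<close>)
      then show "square D (fob F a) (fob F b) (fob H a) (fob H b) (far F a b f)
        ((\<lambda>a\<in>Obj C. Cmp D (fob F a) (fob G a) (fob H a) (\<theta> a) (\<eta> a)) a)
        ((\<lambda>a\<in>Obj C. Cmp D (fob F a) (fob G a) (fob H a) (\<theta> a) (\<eta> a)) b) (far H a b f)"
        using a b by simp
    qed simp
  next
    fix F G \<eta>
    assume fs: "klinear_functor k C D F" "klinear_functor k C D G" and nat: "is_nat_trans C D F G \<eta>"
    have ext: "\<eta> = (\<lambda>a\<in>Obj C. \<eta> a)" using nat by (simp add: is_nat_trans_def extensional_restrict)
    show "(\<lambda>a\<in>Obj C. Cmp D (fob F a) (fob F a) (fob G a) (\<eta> a) ((\<lambda>a\<in>Obj C. Idn D (fob F a)) a)) = \<eta>"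
      by (subst (2) ext, rule restrict_ext) (use \<eta>[OF nat] ob fs D.Cmp_Idn_right in simp)
    show "(\<lambda>a\<in>Obj C. Cmp D (fob F a) (fob G a) (fob G a) ((\<lambda>a\<in>Obj C. Idn D (fob G a)) a) (\<eta> a)) = \<eta>"
      by (subst (2) ext, rule restrict_ext) (use \<eta>[OF nat] ob fs D.Cmp_Idn_left in simp)
  next
    fix F G H K \<eta> \<theta> \<kappa>
    assume fs: "klinear_functor k C D F" "klinear_functor k C D G" "klinear_functor k C D H"
      "klinear_functor k C D K"
      and nat: "is_nat_trans C D F G \<eta>" "is_nat_trans C D G H \<theta>" "is_nat_trans C D H K \<kappa>"
    show "(\<lambda>a\<in>Obj C. Cmp D (fob F a) (fob H a) (fob K a) (\<kappa> a)
          ((\<lambda>a\<in>Obj C. Cmp D (fob F a) (fob G a) (fob H a) (\<theta> a) (\<eta> a)) a)) =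
        (\<lambda>a\<in>Obj C. Cmp D (fob F a) (fob G a) (fob K a)
          ((\<lambda>a\<in>Obj C. Cmp D (fob G a) (fob H a) (fob K a) (\<kappa> a) (\<theta> a)) a) (\<eta> a))"
      by (rule restrict_ext)
        (use D.Cmp_assoc ob fs \<eta>[OF nat(1)] \<eta>[OF nat(2)] \<eta>[OF nat(3)] in simp)
  qed
qed

section \<open>Well-ordered chains of full subcategories\<close>

text \<open>Abstracts \<open>presentables_diagram\<close>: the bicolimit argument sees only an
  increasing family of object sets, not what presentability means.\<close>

definition full_chain :: "('o, 'm, 'k) kcat \<Rightarrow> ('i \<Rightarrow> 'o set) \<Rightarrow> ('i, unit, 'o, 'm, 'k) psfct" where
  "full_chain C S =
     \<lparr>pf_ob = (\<lambda>i. full_subcategory C (S i)),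
      pf_ar = (\<lambda>i j _. fct_id (full_subcategory C (S i))),
      pf_cmp = (\<lambda>i j l _ _. \<lambda>X\<in>S i. Idn C X),
      pf_unit = (\<lambda>i. \<lambda>X\<in>S i. Idn C X)\<rparr>"

definition full_chain_inclusions ::
  "('o, 'm, 'k) kcat \<Rightarrow> ('i, unit) cat \<Rightarrow> ('i \<Rightarrow> 'o set) \<Rightarrow> ('i, unit, 'o, 'm, 'o, 'm) psnat" where
  "full_chain_inclusions C I S =
     mk_psnat I (\<lambda>i. fct_id (full_subcategory C (S i))) (\<lambda>i j _. \<lambda>X\<in>S i. Idn C X)"

lemma full_subcategory_simps [simp]:
  "Obj (full_subcategory C S) = S"
  "Hom (full_subcategory C S) = Hom C"
  "Cmp (full_subcategory C S) = Cmp C"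
  "Idn (full_subcategory C S) = Idn C"
  by (simp_all add: full_subcategory_def)

lemma hmod_full_subcategory [simp]: "hmod (full_subcategory C S) = hmod C"
  by (simp add: full_subcategory_def)

lemma full_chain_simps [simp]:
  "pf_ob (full_chain C S) i = full_subcategory C (S i)"
  "pf_ar (full_chain C S) i j f = fct_id (full_subcategory C (S i))"
  "pf_cmp (full_chain C S) i j l g f = (\<lambda>X\<in>S i. Idn C X)"
  "pf_unit (full_chain C S) i = (\<lambda>X\<in>S i. Idn C X)"
  by (simp_all add: full_chain_def)

lemma preorder_cat_simps [simp]:
  "Obj (preorder_cat A r) = A"
  "f \<in> Hom (preorder_cat A r) i j \<longleftrightarrow> (i, j) \<in> r"
  "Cmp (preorder_cat A r) i j l g f = ()"
  "Idn (preorder_cat A r) i = ()"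
  by (simp_all add: preorder_cat_def)

lemma fct_id_simps:
  "a \<in> Obj C \<Longrightarrow> fob (fct_id C) a = a"
  "\<lbrakk>a \<in> Obj C; b \<in> Obj C; f \<in> Hom C a b\<rbrakk> \<Longrightarrow> far (fct_id C) a b f = f"
  by (simp_all add: fct_id_def mk_fct_simps)

lemma fct_comp_simps:
  "a \<in> Obj C \<Longrightarrow> fob (fct_comp C G F) a = fob G (fob F a)"
  "\<lbrakk>a \<in> Obj C; b \<in> Obj C; f \<in> Hom C a b\<rbrakk>
    \<Longrightarrow> far (fct_comp C G F) a b f = far G (fob F a) (fob F b) (far F a b f)"
  by (simp_all add: fct_comp_def mk_fct_simps)

lemma mk_psnat_simps:
  "i \<in> Obj I \<Longrightarrow> pn_ob (mk_psnat I so sc) i = so i"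
  "\<lbrakk>i \<in> Obj I; j \<in> Obj I; f \<in> Hom I i j\<rbrakk> \<Longrightarrow> pn_cell (mk_psnat I so sc) i j f = sc i j f"
  by (simp_all add: mk_psnat_def arrows_def)

lemma mk_psnat_eqI:
  assumes "\<And>i. i \<in> Obj I \<Longrightarrow> so i = so' i"
    and "\<And>i j f. \<lbrakk>i \<in> Obj I; j \<in> Obj I; f \<in> Hom I i j\<rbrakk> \<Longrightarrow> sc i j f = sc' i j f"
  shows "mk_psnat I so sc = mk_psnat I so' sc'"
  using assms by (auto simp: mk_psnat_def arrows_def restrict_def fun_eq_iff)

lemma klinear_category_full_subcategory:
  assumes "klinear_category k C" "S \<subseteq> Obj C"
  shows "klinear_category k (full_subcategory C S)"
proof -
  interpret C: klinear_category k C by fact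
  note * = assms(2)[THEN subsetD]
  show ?thesis
    by (intro klinear_category.intro category.intro klinear_category_axioms.intro)
      (simp_all add: * C.Idn_closed C.Cmp_closed C.Cmp_Idn_right C.Cmp_Idn_left C.Cmp_assoc C.hmod_module
        C.hmod_carrier C.Cmp_linear_left C.Cmp_linear_right)
qed

lemma (in klinear_category) klinear_functor_inclusion:
  assumes "S \<subseteq> T" "S \<subseteq> Obj C"
  shows "klinear_functor k (full_subcategory C S) (full_subcategory C T) (fct_id (full_subcategory C S))"
proof -
  let ?C = "full_subcategory C S"
  interpret S: klinear_category k ?C
    using klinear_category_full_subcategory[OF klinear_category_axioms assms(2)] .
  have "is_functor ?C (full_subcategory C T) (fct_id ?C)"
    unfolding fct_id_def by (rule is_functor_mk_fct[OF S.category_axioms]) (use assms(1) in auto)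
  moreover have "linear_map k (hmod C a b) (hmod C (fob (fct_id ?C) a) (fob (fct_id ?C) b)) (far (fct_id ?C) a b)"
    if "a \<in> S" "b \<in> S" for a b
  proof -
    have c: "carrier (hmod C a b) = Hom C a b" using that assms(2) hmod_carrier by blast
    interpret M: module k "hmod C a b" using that assms(2) hmod_module by blast
    show ?thesis using that c M.M.a_closed M.smult_closed by (auto simp: linear_map_def fct_id_simps)
  qed
  ultimately show ?thesis by (simp add: klinear_functor_def)
qed

lemma full_subcategory_Obj: "full_subcategory C (Obj C) = C"
  by (simp add: full_subcategory_def)

text \<open>\<open>ex_least\<close> expresses two things at once: the stages cover \<open>C\<close>,
  and each object has a least stage. The latter is the form in which the well-ordering of the
  cardinals is used.\<close>

locale covering_chain = C: klinear_category k C
  for k :: "('k, 'r) ring_scheme" and C :: "('o, 'm, 'k) kcat" +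
  fixes A :: "'i set" and r :: "'i rel" and S :: "'i \<Rightarrow> 'o set"
  assumes A_nonempty: "A \<noteq> {}"
    and r_refl: "i \<in> A \<Longrightarrow> (i, i) \<in> r"
    and r_trans: "\<lbrakk>(i, j) \<in> r; (j, l) \<in> r\<rbrakk> \<Longrightarrow> (i, l) \<in> r"
    and r_total: "\<lbrakk>i \<in> A; j \<in> A\<rbrakk> \<Longrightarrow> (i, j) \<in> r \<or> (j, i) \<in> r"
    and S_subset: "i \<in> A \<Longrightarrow> S i \<subseteq> Obj C"
    and S_mono: "\<lbrakk>i \<in> A; j \<in> A; (i, j) \<in> r\<rbrakk> \<Longrightarrow> S i \<subseteq> S j"
    and ex_least: "X \<in> Obj C \<Longrightarrow> \<exists>i\<in>A. X \<in> S i \<and> (\<forall>j\<in>A. X \<in> S j \<longrightarrow> (i, j) \<in> r)"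
begin

abbreviation I :: "('i, unit) cat" where "I \<equiv> preorder_cat A r"
abbreviation P :: "('i, unit, 'o, 'm, 'k) psfct" where "P \<equiv> full_chain C S"

lemma S_Obj: "i \<in> A \<Longrightarrow> X \<in> S i \<Longrightarrow> X \<in> Obj C"
  using S_subset by blast

lemma S_le: "\<lbrakk>i \<in> A; j \<in> A; (i, j) \<in> r; X \<in> S i\<rbrakk> \<Longrightarrow> X \<in> S j"
  using S_mono by blast

sublocale I: category I
  by unfold_locales (auto intro: r_refl r_trans)

lemma finite_upper_bound:
  assumes "finite B" "B \<subseteq> A"
  shows "\<exists>m\<in>A. \<forall>b\<in>B. (b, m) \<in> r"
  using assms
proof (induction B)
  case empty
  then show ?case using A_nonempty by blast
next
  case (insert b B)
  then obtain m where m: "m \<in> A" "\<forall>b\<in>B. (b, m) \<in> r" by blast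
  have "b \<in> A" using insert.prems by blast
  from r_total[OF this m(1)] show ?case
    using m \<open>b \<in> A\<close> r_refl r_trans by (metis insert_iff)
qed

text \<open>A finite diagram involves finitely many indices, which have an upper bound by totality;
  in a preorder every upper bound is a cocone.\<close>

lemma is_filtered_chain: "is_filtered natLeq I"
  unfolding is_filtered_def
proof (intro allI impI)
  fix K :: "(nat, nat) cat" and D
  assume K: "category K \<and> |arrows K| <o natLeq \<and> is_functor K I D"
  then have "|Obj K| <o natLeq" using category.small_Obj by blast
  then have "finite (fob D ` Obj K)" using finite_iff_ordLess_natLeq by blast
  moreover have "fob D ` Obj K \<subseteq> A" using K is_functorD(1)[of K I D] by auto
  ultimately obtain m where "m \<in> A" "\<forall>b\<in>fob D ` Obj K. (b, m) \<in> r"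
    using finite_upper_bound by blast
  then have "is_cocone K I D m (\<lambda>_. ())" by (simp add: is_cocone_def)
  then show "\<exists>L l. is_cocone K I D L l" by blast
qed

lemma klinear_category_stage: "i \<in> A \<Longrightarrow> klinear_category k (full_subcategory C (S i))"
  using klinear_category_full_subcategory C.klinear_category_axioms S_subset by blast

lemma is_iso_Idn: "X \<in> Obj C \<Longrightarrow> is_iso C X X (Idn C X)"
  unfolding is_iso_def using C.Idn_closed C.Cmp_Idn_left by blast

lemma is_iso_full_subcategory: "is_iso (full_subcategory C T) a b f \<longleftrightarrow> is_iso C a b f"
  by (simp add: is_iso_def)

text \<open>Covers all compositors and unitors of the chain: on \<open>S i\<close> every functor
  involved acts as the identity.\<close>

lemma is_nat_iso_inclusion:
  assumes "i \<in> A" "\<And>X. X \<in> S i \<Longrightarrow> fob F X = X" "\<And>X. X \<in> S i \<Longrightarrow> fob G X = X"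
    and "\<And>X Y f. \<lbrakk>X \<in> S i; Y \<in> S i; f \<in> Hom C X Y\<rbrakk> \<Longrightarrow> far F X Y f = f"
    and "\<And>X Y f. \<lbrakk>X \<in> S i; Y \<in> S i; f \<in> Hom C X Y\<rbrakk> \<Longrightarrow> far G X Y f = f"
  shows "is_nat_iso (full_subcategory C (S i)) (full_subcategory C T) F G (\<lambda>X\<in>S i. Idn C X)"
  using assms S_Obj[OF assms(1)] C.Idn_closed is_iso_Idn C.Cmp_Idn_left C.Cmp_Idn_right
  by (simp add: is_nat_iso_def is_nat_trans_def is_iso_full_subcategory)

lemma klinear_pseudofunctor_chain: "klinear_pseudofunctor k I P"
proof (intro klinear_pseudofunctor.intro klinear_pseudofunctor_axioms.intro I.category_axioms)
  fix i j l :: 'i and f g :: unit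
  assume "i \<in> Obj I" then have i: "i \<in> A" by simp
  show "klinear_category k (pf_ob P i)" using klinear_category_stage i by simp
  show "is_nat_iso (pf_ob P i) (pf_ob P i) (fct_id (pf_ob P i)) (pf_ar P i i (Idn I i)) (pf_unit P i)"
    using is_nat_iso_inclusion[OF i] i by (simp add: fct_id_simps)
  assume "j \<in> Obj I" and "f \<in> Hom I i j" then have j: "j \<in> A" "(i, j) \<in> r" by simp_all
  show "klinear_functor k (pf_ob P i) (pf_ob P j) (pf_ar P i j f)"
    using C.klinear_functor_inclusion[OF S_mono[OF i j] S_subset[OF i]] by simp
  assume "l \<in> Obj I" and "g \<in> Hom I j l" then have l: "l \<in> A" "(j, l) \<in> r" by simp_all
  show "is_nat_iso (pf_ob P i) (pf_ob P l) (fct_comp (pf_ob P i) (pf_ar P j l g) (pf_ar P i j f))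
            (pf_ar P i l (Cmp I i j l g f)) (pf_cmp P i j l g f)"
    using is_nat_iso_inclusion[OF i] S_le[OF i j] by (simp add: fct_id_simps fct_comp_simps)
next
  fix i j f x y x'
  assume h: "i \<in> Obj I" "j \<in> Obj I" "f \<in> Hom I i j" "x \<in> Obj (pf_ob P i)" "y = fob (pf_ar P i j f) x"
  then have x: "x \<in> Obj C" "x \<in> S i" "x \<in> S j" "y = x" using S_Obj[of i] S_le[of i j] by (auto simp: fct_id_simps)
  show "Cmp (pf_ob P j) y (fob (pf_ar P j j (Idn I j)) y) y (pf_cmp P i j j (Idn I j) f x) (pf_unit P j y) =
      Idn (pf_ob P j) y"
    using x C.Idn_closed C.Cmp_Idn_left by (simp add: fct_id_simps)
  assume "x' = fob (pf_ar P i i (Idn I i)) x"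
  then have "x' = x" using x by (simp add: fct_id_simps)
  then show "Cmp (pf_ob P j) y (fob (pf_ar P i j f) x') y (pf_cmp P i i j f (Idn I i) x)
      (far (pf_ar P i j f) x x' (pf_unit P i x)) = Idn (pf_ob P j) y"
    using x C.Idn_closed C.Cmp_Idn_left by (simp add: fct_id_simps)
next
  fix i j l m f g h x gf hg hgf y z w
  assume a: "i \<in> Obj I" "j \<in> Obj I" "l \<in> Obj I" "m \<in> Obj I" "f \<in> Hom I i j" "g \<in> Hom I j l" "h \<in> Hom I l m"
    "x \<in> Obj (pf_ob P i)" "y = fob (pf_ar P i j f) x" "z = fob (pf_ar P j l g) y" "w = fob (pf_ar P l m h) z"
  then have x: "x \<in> Obj C" "x \<in> S i" "x \<in> S j" "x \<in> S l" using S_Obj[of i] S_le[of i j] S_le[of j l] by auto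
  then have "y = x" "z = x" "w = x" using a by (simp_all add: fct_id_simps)
  then show "Cmp (pf_ob P m) w (fob (pf_ar P l m h) (fob (pf_ar P i l gf) x)) (fob (pf_ar P i m hgf) x)
        (pf_cmp P i l m h gf x) (far (pf_ar P l m h) z (fob (pf_ar P i l gf) x) (pf_cmp P i j l g f x)) =
      Cmp (pf_ob P m) w (fob (pf_ar P j m hg) y) (fob (pf_ar P i m hgf) x)
        (pf_cmp P i j m hg f x) (pf_cmp P j l m h g y)"
    using x C.Idn_closed by (simp add: fct_id_simps)
qed

end

locale chain_test = covering_chain k C A r S + D: klinear_category k D
  for k :: "('k, 'r) ring_scheme" and C :: "('o, 'm, 'k) kcat"
    and A :: "'i set" and r :: "'i rel" and S :: "'i \<Rightarrow> 'o set"
    and D :: "('p, 'n, 'k) kcat"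
begin

section \<open>Pseudonatural transformations out of a chain, in components\<close>

abbreviation "stage i \<equiv> full_subcategory C (S i)"
abbreviation "ob s i X \<equiv> fob (pn_ob s i) X"
abbreviation "ar s i X Y f \<equiv> far (pn_ob s i) X Y f"
abbreviation "ce s i j X \<equiv> pn_cell s i j () X"
abbreviation "psnat \<equiv> is_psnat k I P D"

lemma psnat_klinear: "psnat s \<Longrightarrow> i \<in> A \<Longrightarrow> klinear_functor k (stage i) D (pn_ob s i)"
  by (simp add: is_psnat_def)

lemma psnat_functor: "psnat s \<Longrightarrow> i \<in> A \<Longrightarrow> is_functor (stage i) D (pn_ob s i)"
  using psnat_klinear by (auto simp: klinear_functor_def)

lemma ob_closed: "psnat s \<Longrightarrow> i \<in> A \<Longrightarrow> X \<in> S i \<Longrightarrow> ob s i X \<in> Obj D"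
  using is_functorD(1)[OF psnat_functor] by simp

lemma ar_closed:
  "\<lbrakk>psnat s; i \<in> A; X \<in> S i; Y \<in> S i; f \<in> Hom C X Y\<rbrakk> \<Longrightarrow> ar s i X Y f \<in> Hom D (ob s i X) (ob s i Y)"
  using is_functorD(2)[OF psnat_functor] by simp

lemma psnat_nat_iso:
  assumes "psnat s" "i \<in> A" "j \<in> A" "(i, j) \<in> r"
  shows "is_nat_iso (stage i) D (pn_ob s i) (fct_comp (stage i) (pn_ob s j) (fct_id (stage i))) (pn_cell s i j ())"
proof -
  have "\<forall>f\<in>Hom I i j. is_nat_iso (pf_ob P i) D (pn_ob s i) (fct_comp (pf_ob P i) (pn_ob s j) (pf_ar P i j f))
      (pn_cell s i j f)"
    using assms unfolding is_psnat_def by simp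
  then show ?thesis using assms(4) by simp
qed

lemma ce_iso:
  assumes "psnat s" "i \<in> A" "j \<in> A" "(i, j) \<in> r" "X \<in> S i"
  shows "is_iso D (ob s i X) (ob s j X) (ce s i j X)"
  using psnat_nat_iso[OF assms(1-4)] assms(5) by (simp add: is_nat_iso_def fct_comp_simps fct_id_simps)

lemma ce_closed:
  assumes "psnat s" "i \<in> A" "j \<in> A" "(i, j) \<in> r" "X \<in> S i"
  shows "ce s i j X \<in> Hom D (ob s i X) (ob s j X)"
  using ce_iso[OF assms] by (simp add: is_iso_def)

lemma ce_square:
  assumes "psnat s" "i \<in> A" "j \<in> A" "(i, j) \<in> r" "X \<in> S i" "Y \<in> S i" "f \<in> Hom C X Y"
  shows "square D (ob s i X) (ob s i Y) (ob s j X) (ob s j Y)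
    (ar s i X Y f) (ce s i j X) (ce s i j Y) (ar s j X Y f)"
  using psnat_nat_iso[OF assms(1-4)] assms ar_closed ce_closed S_le[OF assms(2-4)]
  by (simp add: square_def is_nat_iso_def is_nat_trans_def fct_comp_simps fct_id_simps)

lemma ar_Idn: "\<lbrakk>psnat s; i \<in> A; X \<in> S i\<rbrakk> \<Longrightarrow> ar s i X X (Idn C X) = Idn D (ob s i X)"
  using is_functorD(3)[OF psnat_functor] by simp

lemma ar_Cmp:
  "\<lbrakk>psnat s; i \<in> A; X \<in> S i; Y \<in> S i; Z \<in> S i; f \<in> Hom C X Y; g \<in> Hom C Y Z\<rbrakk>
    \<Longrightarrow> ar s i X Z (Cmp C X Y Z g f) = Cmp D (ob s i X) (ob s i Y) (ob s i Z) (ar s i Y Z g) (ar s i X Y f)"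
  using is_functorD(4)[OF psnat_functor] by simp

lemma ce_Idn:
  assumes "psnat s" "i \<in> A" "X \<in> S i"
  shows "ce s i i X = Idn D (ob s i X)"
proof -
  have "\<forall>i\<in>A. \<forall>x\<in>S i. ce s i i x = ar s i x (fob (fct_id (stage i)) x) ((\<lambda>X\<in>S i. Idn C X) x)"
    using assms(1) unfolding is_psnat_def by simp
  then show ?thesis using assms ar_Idn by (simp add: fct_id_simps)
qed

text \<open>The compositor of the chain is an identity, which \<open>pn_ob s l\<close> preserves, so
  the coherence law reduces to composition of cells.\<close>

lemma ce_Cmp:
  assumes "psnat s" "i \<in> A" "j \<in> A" "l \<in> A" "(i, j) \<in> r" "(j, l) \<in> r" "X \<in> S i"
  shows "ce s i l X = Cmp D (ob s i X) (ob s j X) (ob s l X) (ce s j l X) (ce s i j X)"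
proof -
  have *: "\<forall>i\<in>A. \<forall>j\<in>A. \<forall>l\<in>A. \<forall>f\<in>Hom I i j. \<forall>g\<in>Hom I j l. \<forall>x\<in>S i.
        let gf = Cmp I i j l g f;
            y = fob (pf_ar P i j f) x; z = fob (pf_ar P j l g) y; z' = fob (pf_ar P i l gf) x;
            a = fob (pn_ob s i) x; b = fob (pn_ob s j) y; c = fob (pn_ob s l) z; d = fob (pn_ob s l) z'
        in pn_cell s i l gf x =
             Cmp D a c d (far (pn_ob s l) z z' (pf_cmp P i j l g f x))
               (Cmp D a b c (pn_cell s j l g y) (pn_cell s i j f x))"
    using assms(1) unfolding is_psnat_def by simp
  have X: "X \<in> S j" "X \<in> S l" using S_le assms by blast+
  have "() \<in> Hom I i j" "() \<in> Hom I j l" using assms by simp_all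
  note *[rule_format, OF assms(2-4) this assms(7)]
  moreover have "Cmp D (ob s i X) (ob s j X) (ob s l X) (ce s j l X) (ce s i j X) \<in> Hom D (ob s i X) (ob s l X)"
    by (rule D.Cmp_closed) (use assms X ob_closed ce_closed in blast)+
  ultimately show ?thesis
    using X assms ob_closed D.Cmp_Idn_left by (simp add: Let_def fct_id_simps ar_Idn)
qed

text \<open>The conditions of \<open>is_psnat\<close> without the identity compositors and unitors,
  which preservation of identities puts back.\<close>

lemma psnatI:
  assumes "mk_psnat I (pn_ob s) (pn_cell s) = s"
    and kl: "\<And>i. i \<in> A \<Longrightarrow> klinear_functor k (stage i) D (pn_ob s i)"
    and ext: "\<And>i j. \<lbrakk>i \<in> A; j \<in> A; (i, j) \<in> r\<rbrakk> \<Longrightarrow> pn_cell s i j () \<in> extensional (S i)"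
    and iso: "\<And>i j X. \<lbrakk>i \<in> A; j \<in> A; (i, j) \<in> r; X \<in> S i\<rbrakk> \<Longrightarrow> is_iso D (ob s i X) (ob s j X) (ce s i j X)"
    and sq: "\<And>i j X Y f. \<lbrakk>i \<in> A; j \<in> A; (i, j) \<in> r; X \<in> S i; Y \<in> S i; f \<in> Hom C X Y\<rbrakk> \<Longrightarrow>
      square D (ob s i X) (ob s i Y) (ob s j X) (ob s j Y) (ar s i X Y f) (ce s i j X) (ce s i j Y) (ar s j X Y f)"
    and comp: "\<And>i j l X. \<lbrakk>i \<in> A; j \<in> A; l \<in> A; (i, j) \<in> r; (j, l) \<in> r; X \<in> S i\<rbrakk> \<Longrightarrow>
      ce s i l X = Cmp D (ob s i X) (ob s j X) (ob s l X) (ce s j l X) (ce s i j X)"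
    and idn: "\<And>i X. \<lbrakk>i \<in> A; X \<in> S i\<rbrakk> \<Longrightarrow> ce s i i X = Idn D (ob s i X)"
  shows "psnat s"
proof -
  have ob: "ob s i X \<in> Obj D" if "i \<in> A" "X \<in> S i" for i X
    using is_functorD(1)[of "stage i" D "pn_ob s i" X] kl that by (simp add: klinear_functor_def)
  have ar_Idn: "ar s i X X (Idn C X) = Idn D (ob s i X)" if "i \<in> A" "X \<in> S i" for i X
    using is_functorD(3)[of "stage i" D "pn_ob s i" X] kl that by (simp add: klinear_functor_def)
  have ce: "ce s i j X \<in> Hom D (ob s i X) (ob s j X)" if "i \<in> A" "j \<in> A" "(i, j) \<in> r" "X \<in> S i" for i j X
    using iso[OF that] by (simp add: is_iso_def)
  show ?thesis
    unfolding is_psnat_def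
  proof (intro conjI ballI)
    show "s = mk_psnat I (pn_ob s) (pn_cell s)" by (simp only: assms(1))
    fix i assume "i \<in> Obj I" then have i: "i \<in> A" by simp
    show "klinear_functor k (pf_ob P i) D (pn_ob s i)" using kl i by simp
    {
      fix x assume "x \<in> Obj (pf_ob P i)"
      then show "pn_cell s i i (Idn I i) x =
          far (pn_ob s i) x (fob (pf_ar P i i (Idn I i)) x) (pf_unit P i x)"
        using idn i ar_Idn by (simp add: fct_id_simps)
    }
    fix j f assume "j \<in> Obj I" "f \<in> Hom I i j" then have j: "j \<in> A" "(i, j) \<in> r" by simp_all
    show "is_nat_iso (pf_ob P i) D (pn_ob s i) (fct_comp (pf_ob P i) (pn_ob s j) (pf_ar P i j f)) (pn_cell s i j f)"
      using ext[OF i j] iso[OF i j] ce[OF i j] sq[OF i j] S_le[OF i j]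
      by (simp add: is_nat_iso_def is_nat_trans_def square_def fct_comp_simps fct_id_simps)
    fix l g x assume "l \<in> Obj I" "g \<in> Hom I j l" "x \<in> Obj (pf_ob P i)"
    then have l: "l \<in> A" "(j, l) \<in> r" and x: "x \<in> S i" "x \<in> S j" "x \<in> S l"
      using S_le[OF i j] S_le[OF j(1)] by auto
    have "Cmp D (ob s i x) (ob s j x) (ob s l x) (ce s j l x) (ce s i j x) \<in> Hom D (ob s i x) (ob s l x)"
      using D.Cmp_closed ob ce i j l x by blast
    then have "ce s i l x = Cmp D (ob s i x) (ob s l x) (ob s l x) (Idn D (ob s l x))
        (Cmp D (ob s i x) (ob s j x) (ob s l x) (ce s j l x) (ce s i j x))"
      using comp[OF i j(1) l(1) j(2) l(2) x(1)] D.Cmp_Idn_left ob i l x by simp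
    then show "let gf = Cmp I i j l g f;
            y = fob (pf_ar P i j f) x; z = fob (pf_ar P j l g) y; z' = fob (pf_ar P i l gf) x;
            a = fob (pn_ob s i) x; b = fob (pn_ob s j) y; c = fob (pn_ob s l) z; d = fob (pn_ob s l) z'
        in pn_cell s i l gf x =
             Cmp D a c d (far (pn_ob s l) z z' (pf_cmp P i j l g f x))
               (Cmp D a b c (pn_cell s j l g y) (pn_cell s i j f x))"
      using x ar_Idn l by (simp add: Let_def fct_id_simps)
  qed
qed

text \<open>Naturality and compatibility with the cells both take the form of squares, so that
  modifications too can be handled by pasting.\<close>

lemma is_modification_iff:
  assumes "psnat s" "psnat t"
  shows "is_modification I P D s t \<mu> \<longleftrightarrow>
    \<mu> \<in> extensional A \<and> (\<forall>i\<in>A. \<mu> i \<in> extensional (S i)) \<and>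
    (\<forall>i\<in>A. \<forall>X\<in>S i. \<mu> i X \<in> Hom D (ob s i X) (ob t i X)) \<and>
    (\<forall>i\<in>A. \<forall>X\<in>S i. \<forall>Y\<in>S i. \<forall>f\<in>Hom C X Y.
      square D (ob s i X) (ob s i Y) (ob t i X) (ob t i Y) (ar s i X Y f) (\<mu> i X) (\<mu> i Y) (ar t i X Y f)) \<and>
    (\<forall>i\<in>A. \<forall>j\<in>A. (i, j) \<in> r \<longrightarrow> (\<forall>X\<in>S i.
      square D (ob s i X) (ob s j X) (ob t i X) (ob t j X) (ce s i j X) (\<mu> i X) (\<mu> j X) (ce t i j X)))"
proof -
  have 1: "is_nat_trans (pf_ob P i) D (pn_ob s i) (pn_ob t i) (\<mu> i) \<longleftrightarrow> \<mu> i \<in> extensional (S i) \<and>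
      (\<forall>X\<in>S i. \<mu> i X \<in> Hom D (ob s i X) (ob t i X)) \<and>
      (\<forall>X\<in>S i. \<forall>Y\<in>S i. \<forall>f\<in>Hom C X Y.
        square D (ob s i X) (ob s i Y) (ob t i X) (ob t i Y) (ar s i X Y f) (\<mu> i X) (\<mu> i Y) (ar t i X Y f))"
    if "i \<in> A" for i
    using is_nat_trans_iff_square[OF psnat_functor[OF assms(1) that] psnat_functor[OF assms(2) that]] by simp
  have 2: "(let y = fob (pf_ar P i j f) X
        in Cmp D (fob (pn_ob s i) X) (fob (pn_ob t i) X) (fob (pn_ob t j) y)
             (pn_cell t i j f X) (\<mu> i X) =
           Cmp D (fob (pn_ob s i) X) (fob (pn_ob s j) y) (fob (pn_ob t j) y)
             (\<mu> j y) (pn_cell s i j f X)) \<longleftrightarrow>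
      square D (ob s i X) (ob s j X) (ob t i X) (ob t j X) (ce s i j X) (\<mu> i X) (\<mu> j X) (ce t i j X)"
    if "i \<in> A" "j \<in> A" "(i, j) \<in> r" "X \<in> S i"
      and "\<forall>i\<in>A. \<forall>X\<in>S i. \<mu> i X \<in> Hom D (ob s i X) (ob t i X)" for i j X and f :: unit
    using that ce_closed[OF assms(1)] ce_closed[OF assms(2)] S_le[of i j X]
    by (auto simp: Let_def square_def fct_id_simps)
  have 3: "(\<forall>f\<in>Hom I i j. Q f) \<longleftrightarrow> ((i, j) \<in> r \<longrightarrow> Q ())" for i j and Q :: "unit \<Rightarrow> bool"
    by (simp add: Ball_def)
  show ?thesis
    unfolding is_modification_def
    using 1 2 by (simp add: 3 cong: conj_cong) blast
qed

lemma modificationD: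
  assumes "is_modification I P D s t \<mu>" "psnat s" "psnat t"
  shows "\<lbrakk>i \<in> A; X \<in> S i\<rbrakk> \<Longrightarrow> \<mu> i X \<in> Hom D (ob s i X) (ob t i X)"
    and "\<lbrakk>i \<in> A; X \<in> S i; Y \<in> S i; f \<in> Hom C X Y\<rbrakk> \<Longrightarrow>
      square D (ob s i X) (ob s i Y) (ob t i X) (ob t i Y) (ar s i X Y f) (\<mu> i X) (\<mu> i Y) (ar t i X Y f)"
    and "\<lbrakk>i \<in> A; j \<in> A; (i, j) \<in> r; X \<in> S i\<rbrakk> \<Longrightarrow>
      square D (ob s i X) (ob s j X) (ob t i X) (ob t j X) (ce s i j X) (\<mu> i X) (\<mu> j X) (ce t i j X)"
  using assms(1) unfolding is_modification_iff[OF assms(2,3)] by blast+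

lemma Psnat_simps:
  "Obj (Psnat k I P D) = {s. psnat s}"
  "Hom (Psnat k I P D) s t = {\<mu>. is_modification I P D s t \<mu>}"
  "Cmp (Psnat k I P D) s t u \<nu> \<mu> =
     (\<lambda>i\<in>A. \<lambda>X\<in>S i. Cmp D (ob s i X) (ob t i X) (ob u i X) (\<nu> i X) (\<mu> i X))"
  "Idn (Psnat k I P D) s = (\<lambda>i\<in>A. \<lambda>X\<in>S i. Idn D (ob s i X))"
  by (simp_all add: Psnat_def cong: restrict_cong)

text \<open>By \<open>square_inverse\<close> the inverses of the components again satisfy both kinds
  of squares.\<close>

lemma is_iso_Psnat:
  assumes \<mu>: "is_modification I P D s t \<mu>" and st: "psnat s" "psnat t"
    and iso: "\<And>i X. \<lbrakk>i \<in> A; X \<in> S i\<rbrakk> \<Longrightarrow> is_iso D (ob s i X) (ob t i X) (\<mu> i X)"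
  shows "is_iso (Psnat k I P D) s t \<mu>"
proof -
  have "\<forall>i X. \<exists>g. i \<in> A \<and> X \<in> S i \<longrightarrow> g \<in> Hom D (ob t i X) (ob s i X) \<and>
      Cmp D (ob s i X) (ob t i X) (ob s i X) g (\<mu> i X) = Idn D (ob s i X) \<and>
      Cmp D (ob t i X) (ob s i X) (ob t i X) (\<mu> i X) g = Idn D (ob t i X)"
    using iso unfolding is_iso_def by blast
  then obtain \<nu> where \<nu>: "\<And>i X. \<lbrakk>i \<in> A; X \<in> S i\<rbrakk> \<Longrightarrow> \<nu> i X \<in> Hom D (ob t i X) (ob s i X)"
    "\<And>i X. \<lbrakk>i \<in> A; X \<in> S i\<rbrakk> \<Longrightarrow> Cmp D (ob s i X) (ob t i X) (ob s i X) (\<nu> i X) (\<mu> i X) = Idn D (ob s i X)"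
    "\<And>i X. \<lbrakk>i \<in> A; X \<in> S i\<rbrakk> \<Longrightarrow> Cmp D (ob t i X) (ob s i X) (ob t i X) (\<mu> i X) (\<nu> i X) = Idn D (ob t i X)"
    by metis
  let ?\<nu> = "\<lambda>i\<in>A. \<lambda>X\<in>S i. \<nu> i X"
  have "is_modification I P D t s ?\<nu>"
    unfolding is_modification_iff[OF st(2,1)]
  proof (intro conjI ballI impI)
    fix i X assume i: "i \<in> A" "X \<in> S i"
    show "?\<nu> i X \<in> Hom D (ob t i X) (ob s i X)" using i \<nu>(1) by simp
    {
      fix Y f assume Y: "Y \<in> S i" "f \<in> Hom C X Y"
      have "square D (ob t i X) (ob t i Y) (ob s i X) (ob s i Y) (ar t i X Y f) (\<nu> i X) (\<nu> i Y) (ar s i X Y f)"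
        by (rule D.square_inverse[OF _ _ _ _ modificationD(2)[OF \<mu> st i Y] \<nu>(1)[OF i] \<nu>(3)[OF i]
              \<nu>(1)[OF i(1) Y(1)] \<nu>(2)[OF i(1) Y(1)]])
          (simp_all add: ob_closed st i Y)
      then show "square D (ob t i X) (ob t i Y) (ob s i X) (ob s i Y) (ar t i X Y f) (?\<nu> i X) (?\<nu> i Y) (ar s i X Y f)"
        using i Y by simp
    }
    fix j assume j: "j \<in> A" "(i, j) \<in> r"
    have X: "X \<in> S j" by (rule S_le[OF i(1) j i(2)])
    have "square D (ob t i X) (ob t j X) (ob s i X) (ob s j X) (ce t i j X) (\<nu> i X) (\<nu> j X) (ce s i j X)"
      by (rule D.square_inverse[OF _ _ _ _ modificationD(3)[OF \<mu> st i(1) j i(2)] \<nu>(1)[OF i] \<nu>(3)[OF i]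
            \<nu>(1)[OF j(1) X] \<nu>(2)[OF j(1) X]])
        (simp_all add: ob_closed st i j X)
    then show "square D (ob t i X) (ob t j X) (ob s i X) (ob s j X) (ce t i j X) (?\<nu> i X) (?\<nu> j X) (ce s i j X)"
      using i j X by simp
  qed simp_all
  then show ?thesis
    unfolding is_iso_def Psnat_simps using \<mu> \<nu>(2,3)
    by (intro conjI bexI[of _ ?\<nu>]) (simp_all cong: restrict_cong)
qed

section \<open>Gluing a pseudonatural transformation to a functor on the whole category\<close>

definition rank :: "'o \<Rightarrow> 'i" where
  "rank X = (SOME i. i \<in> A \<and> X \<in> S i \<and> (\<forall>j\<in>A. X \<in> S j \<longrightarrow> (i, j) \<in> r))"

text \<open>\<open>r\<close> is only a preorder, so \<open>ex_least\<close> need not determine the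
  least stage uniquely; \<open>rank\<close> is one choice of it.\<close>

lemma rank:
  assumes "X \<in> Obj C"
  shows "rank X \<in> A" "X \<in> S (rank X)" "\<And>j. j \<in> A \<Longrightarrow> X \<in> S j \<Longrightarrow> (rank X, j) \<in> r"
proof -
  have "\<exists>i. i \<in> A \<and> X \<in> S i \<and> (\<forall>j\<in>A. X \<in> S j \<longrightarrow> (i, j) \<in> r)" using ex_least[OF assms] by blast
  from someI_ex[OF this] show "rank X \<in> A" "X \<in> S (rank X)" "\<And>j. j \<in> A \<Longrightarrow> X \<in> S j \<Longrightarrow> (rank X, j) \<in> r"
    unfolding rank_def by blast+
qed

text \<open>Room for three objects is what the composite of two arrows requires.\<close>

lemma common_rank:
  assumes "X \<in> Obj C" "Y \<in> Obj C" "Z \<in> Obj C"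
  obtains m where "m \<in> A" "X \<in> S m" "Y \<in> S m" "Z \<in> S m"
proof -
  obtain m where m: "m \<in> A" "\<forall>i\<in>{rank X, rank Y, rank Z}. (i, m) \<in> r"
    using finite_upper_bound[of "{rank X, rank Y, rank Z}"] assms rank(1) by auto
  have "W \<in> S m" if "W \<in> Obj C" "(rank W, m) \<in> r" for W
    by (rule S_le[OF rank(1)[OF that(1)] m(1) that(2) rank(2)[OF that(1)]])
  then show thesis using that[OF m(1)] m(2) assms by simp
qed

lemma rank_ce_closed: "\<lbrakk>psnat s; m \<in> A; X \<in> S m\<rbrakk> \<Longrightarrow> ce s (rank X) m X \<in> Hom D (ob s (rank X) X) (ob s m X)"
  using ce_closed rank S_Obj by blast

lemma rank_ce_iso: "\<lbrakk>psnat s; m \<in> A; X \<in> S m\<rbrakk> \<Longrightarrow> is_iso D (ob s (rank X) X) (ob s m X) (ce s (rank X) m X)"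
  using ce_iso rank S_Obj by blast

lemma rank_ob_closed: "\<lbrakk>psnat s; X \<in> Obj C\<rbrakk> \<Longrightarrow> ob s (rank X) X \<in> Obj D"
  using ob_closed rank by blast

text \<open>The arrow \<open>g\<close> is s(m)(f) carried back along the cells to the least stages
  of \<open>X\<close> and \<open>Y\<close>.\<close>

definition glue_square where
  "glue_square s X Y g m f \<longleftrightarrow>
    square D (ob s (rank X) X) (ob s (rank Y) Y) (ob s m X) (ob s m Y)
      g (ce s (rank X) m X) (ce s (rank Y) m Y) (ar s m X Y f)"

text \<open>Asking for all common stages at once keeps the value free of a chosen stage. Existence
  is \<open>glue_ar_square\<close>; by \<open>glue_square_unique\<close> a single stage determines
  the value, and \<open>glue_ar_eqI\<close> computes it there.\<close>

definition glue_ar where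
  "glue_ar s X Y f = (SOME g. \<forall>m\<in>A. X \<in> S m \<longrightarrow> Y \<in> S m \<longrightarrow> glue_square s X Y g m f)"

lemma glue_square_unique:
  assumes "psnat s" "m \<in> A" "X \<in> S m" "Y \<in> S m"
    and "glue_square s X Y g m f" "glue_square s X Y g' m f"
  shows "g = g'"
  by (rule D.square_unique[OF rank_ob_closed rank_ob_closed ob_closed rank_ce_iso])
    (use assms S_Obj in \<open>auto simp: glue_square_def\<close>)

text \<open>Paste below it the naturality square of the cell from \<open>m\<close> to
  \<open>n\<close>; the vertical composites are again cells by \<open>ce_Cmp\<close>.\<close>

lemma glue_square_le:
  assumes s: "psnat s" and m: "m \<in> A" "X \<in> S m" "Y \<in> S m" and g: "glue_square s X Y g m f"
    and n: "n \<in> A" "(m, n) \<in> r" and f: "f \<in> Hom C X Y"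
  shows "glue_square s X Y g n f"
proof -
  have XY: "X \<in> Obj C" "Y \<in> Obj C" "X \<in> S n" "Y \<in> S n" using S_Obj S_le m n by blast+
  have "square D (ob s (rank X) X) (ob s (rank Y) Y) (ob s n X) (ob s n Y) g
    (Cmp D (ob s (rank X) X) (ob s m X) (ob s n X) (ce s m n X) (ce s (rank X) m X))
    (Cmp D (ob s (rank Y) Y) (ob s m Y) (ob s n Y) (ce s m n Y) (ce s (rank Y) m Y)) (ar s n X Y f)"
    by (rule D.square_vcomp[OF _ _ _ _ _ _ g[unfolded glue_square_def] ce_square[OF s m(1) n m(2,3) f]])
      (simp_all add: ob_closed rank_ob_closed s m n XY)
  then show ?thesis
    unfolding glue_square_def
    using ce_Cmp[OF s rank(1)[OF XY(1)] m(1) n(1) rank(3)[OF XY(1) m(1,2)] n(2) rank(2)[OF XY(1)]]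
      ce_Cmp[OF s rank(1)[OF XY(2)] m(1) n(1) rank(3)[OF XY(2) m(1,3)] n(2) rank(2)[OF XY(2)]] by simp
qed

text \<open>By totality the later of the two least stages is the least common stage of
  \<open>X\<close> and \<open>Y\<close>. A square is filled there and carried to all other common
  stages by \<open>glue_square_le\<close>.\<close>

lemma glue_ar_square:
  assumes s: "psnat s" and f: "f \<in> Hom C X Y" and n: "n \<in> A" "X \<in> S n" "Y \<in> S n"
  shows "glue_square s X Y (glue_ar s X Y f) n f"
proof -
  have XY: "X \<in> Obj C" "Y \<in> Obj C" using S_Obj n by blast+
  have "\<exists>m\<in>A. X \<in> S m \<and> Y \<in> S m \<and> (\<forall>n\<in>A. X \<in> S n \<longrightarrow> Y \<in> S n \<longrightarrow> (m, n) \<in> r)"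
    using r_total[OF rank(1)[OF XY(1)] rank(1)[OF XY(2)]]
  proof
    assume "(rank X, rank Y) \<in> r"
    then have "X \<in> S (rank Y)" by (rule S_le[OF rank(1)[OF XY(1)] rank(1)[OF XY(2)] _ rank(2)[OF XY(1)]])
    then show ?thesis using rank[OF XY(2)] by blast
  next
    assume "(rank Y, rank X) \<in> r"
    then have "Y \<in> S (rank X)" by (rule S_le[OF rank(1)[OF XY(2)] rank(1)[OF XY(1)] _ rank(2)[OF XY(2)]])
    then show ?thesis using rank[OF XY(1)] by blast
  qed
  then obtain m where m: "m \<in> A" "X \<in> S m" "Y \<in> S m"
    "\<And>n. \<lbrakk>n \<in> A; X \<in> S n; Y \<in> S n\<rbrakk> \<Longrightarrow> (m, n) \<in> r"
    by blast
  obtain g where g: "glue_square s X Y g m f"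
    using D.square_fill[OF rank_ob_closed[OF s XY(1)] rank_ob_closed[OF s XY(2)] ob_closed[OF s m(1,2)]
        ob_closed[OF s m(1,3)] rank_ce_iso[OF s m(1,3)] rank_ce_closed[OF s m(1,2)] ar_closed[OF s m(1-3) f]]
    unfolding glue_square_def by blast
  have "\<forall>n\<in>A. X \<in> S n \<longrightarrow> Y \<in> S n \<longrightarrow> glue_square s X Y g n f"
    by (intro ballI impI) (rule glue_square_le[OF s m(1-3) g _ m(4) f])
  then have "\<forall>n\<in>A. X \<in> S n \<longrightarrow> Y \<in> S n \<longrightarrow> glue_square s X Y (glue_ar s X Y f) n f"
    unfolding glue_ar_def by (rule someI)
  then show ?thesis using n by blast
qed

lemma glue_ar_eqI:
  assumes "psnat s" "f \<in> Hom C X Y" "m \<in> A" "X \<in> S m" "Y \<in> S m" "glue_square s X Y g m f"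
  shows "glue_ar s X Y f = g"
  using glue_square_unique[OF assms(1,3-5) glue_ar_square[OF assms(1-5)] assms(6)] .

lemma glue_ar_closed:
  assumes "psnat s" "X \<in> Obj C" "Y \<in> Obj C" "f \<in> Hom C X Y"
  shows "glue_ar s X Y f \<in> Hom D (ob s (rank X) X) (ob s (rank Y) Y)"
proof -
  obtain m where "m \<in> A" "X \<in> S m" "Y \<in> S m" by (rule common_rank[OF assms(2,3,3)])
  from glue_ar_square[OF assms(1,4) this] show ?thesis by (simp add: glue_square_def square_def)
qed

definition glue where
  "glue s = mk_fct C (\<lambda>X. ob s (rank X) X) (glue_ar s)"

lemma glue_simps:
  "X \<in> Obj C \<Longrightarrow> fob (glue s) X = ob s (rank X) X"
  "\<lbrakk>X \<in> Obj C; Y \<in> Obj C; f \<in> Hom C X Y\<rbrakk> \<Longrightarrow> far (glue s) X Y f = glue_ar s X Y f"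
  by (simp_all add: glue_def mk_fct_simps)

text \<open>For a composite, the squares of both arrows are pasted at a stage common to the three
  objects; for an identity, the least stage of the object itself is used.\<close>

lemma is_functor_glue:
  assumes s: "psnat s"
  shows "is_functor C D (glue s)"
  unfolding glue_def
proof (rule is_functor_mk_fct[OF C.category_axioms])
  fix X assume X: "X \<in> Obj C"
  show "ob s (rank X) X \<in> Obj D" by (rule rank_ob_closed[OF s X])
  note o = rank_ob_closed[OF s X]
  have "glue_square s X X (Idn D (ob s (rank X) X)) (rank X) (Idn C X)"
    unfolding glue_square_def
    using D.square_Idn[OF o o D.Idn_closed[OF o]]
      ce_Idn[OF s rank(1,2)[OF X]] ar_Idn[OF s rank(1,2)[OF X]] by simp
  then show "glue_ar s X X (Idn C X) = Idn D (ob s (rank X) X)"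
    using glue_ar_eqI[OF s C.Idn_closed[OF X] rank(1,2,2)[OF X]] by blast
  fix Y f assume Y: "Y \<in> Obj C" and f: "f \<in> Hom C X Y"
  show "glue_ar s X Y f \<in> Hom D (ob s (rank X) X) (ob s (rank Y) Y)"
    by (rule glue_ar_closed[OF s X Y f])
  fix Z g assume Z: "Z \<in> Obj C" and g: "g \<in> Hom C Y Z"
  obtain m where m: "m \<in> A" "X \<in> S m" "Y \<in> S m" "Z \<in> S m" by (rule common_rank[OF X Y Z])
  have "glue_square s X Z (Cmp D (ob s (rank X) X) (ob s (rank Y) Y) (ob s (rank Z) Z) (glue_ar s Y Z g) (glue_ar s X Y f))
      m (Cmp C X Y Z g f)"
    unfolding glue_square_def ar_Cmp[OF s m f g]
    by (rule D.square_hcomp[OF _ _ _ _ _ _ glue_ar_square[OF s f m(1-3), unfolded glue_square_def]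
          glue_ar_square[OF s g m(1,3,4), unfolded glue_square_def]])
      (simp_all add: ob_closed rank_ob_closed s m X Y Z)
  then show "glue_ar s X Z (Cmp C X Y Z g f) =
      Cmp D (ob s (rank X) X) (ob s (rank Y) Y) (ob s (rank Z) Z) (glue_ar s Y Z g) (glue_ar s X Y f)"
    using glue_ar_eqI[OF s C.Cmp_closed[OF X Y Z f g] m(1,2,4)] by blast
qed

text \<open>At a common stage \<open>m\<close> the glued arrow is determined by an equation between
  its composite with the cell at \<open>Y\<close> and the composite of s(m)(f) with the cell at
  \<open>X\<close>. Both sides are linear, so sums and multiples of solutions are the solutions for
  sums and multiples.\<close>

lemma klinear_functor_glue:
  assumes s: "psnat s"
  shows "klinear_functor k C D (glue s)"
  unfolding klinear_functor_def
proof (intro conjI ballI is_functor_glue s)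
  fix X Y assume XY: "X \<in> Obj C" "Y \<in> Obj C"
  obtain m where m: "m \<in> A" "X \<in> S m" "Y \<in> S m" by (rule common_rank[OF XY(1,2,2)])
  let ?X = "ob s (rank X) X" and ?Y = "ob s (rank Y) Y" and ?X' = "ob s m X" and ?Y' = "ob s m Y"
  have ob: "?X \<in> Obj D" "?Y \<in> Obj D" "?X' \<in> Obj D" "?Y' \<in> Obj D"
    using ob_closed rank_ob_closed s m XY by simp_all
  interpret M: module k "hmod C X Y" by (rule C.hmod_module[OF XY])
  interpret N: module k "hmod D ?X ?Y" by (rule D.hmod_module[OF ob(1,2)])
  have cM: "carrier (hmod C X Y) = Hom C X Y" by (rule C.hmod_carrier[OF XY])
  have cN: "carrier (hmod D ?X ?Y) = Hom D ?X ?Y" by (rule D.hmod_carrier[OF ob(1,2)])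
  have cX: "ce s (rank X) m X \<in> Hom D ?X ?X'" and cY: "ce s (rank Y) m Y \<in> Hom D ?Y ?Y'"
    using rank_ce_closed s m by blast+
  have ar: "linear_map k (hmod C X Y) (hmod D ?X' ?Y') (far (pn_ob s m) X Y)"
    using psnat_klinear[OF s m(1)] m(2,3) by (simp add: klinear_functor_def)
  have pre: "linear_map k (hmod D ?X' ?Y') (hmod D ?X ?Y') (\<lambda>g. Cmp D ?X ?X' ?Y' g (ce s (rank X) m X))"
    by (rule D.Cmp_linear_left[OF ob(1,3,4) cX])
  have post: "linear_map k (hmod D ?X ?Y) (hmod D ?X ?Y') (Cmp D ?X ?Y ?Y' (ce s (rank Y) m Y))"
    by (rule D.Cmp_linear_right[OF ob(1,2,4) cY])
  have gl: "Cmp D ?X ?Y ?Y' (ce s (rank Y) m Y) (glue_ar s X Y f) = Cmp D ?X ?X' ?Y' (ar s m X Y f) (ce s (rank X) m X)"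
    and glc: "glue_ar s X Y f \<in> Hom D ?X ?Y" if "f \<in> Hom C X Y" for f
    using glue_ar_square[OF s that m] by (simp_all add: glue_square_def square_def)
  have arc: "ar s m X Y f \<in> carrier (hmod D ?X' ?Y')" if "f \<in> Hom C X Y" for f
    using linear_mapD(1)[OF ar] that cM by blast
  have eqI: "glue_ar s X Y f = g"
    if "f \<in> Hom C X Y" "g \<in> Hom D ?X ?Y"
      "Cmp D ?X ?Y ?Y' (ce s (rank Y) m Y) g = Cmp D ?X ?X' ?Y' (ar s m X Y f) (ce s (rank X) m X)" for f g
    by (rule glue_ar_eqI[OF s that(1) m])
      (use that cX cY ar_closed[OF s m] in \<open>simp add: glue_square_def square_def\<close>)
  have "linear_map k (hmod C X Y) (hmod D ?X ?Y) (glue_ar s X Y)"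
    unfolding linear_map_def
  proof (intro conjI ballI funcsetI)
    fix f assume f: "f \<in> carrier (hmod C X Y)"
    then show "glue_ar s X Y f \<in> carrier (hmod D ?X ?Y)" using glc cM cN by simp
    {
      fix g assume g: "g \<in> carrier (hmod C X Y)"
      show "glue_ar s X Y (f \<oplus>\<^bsub>hmod C X Y\<^esub> g) = glue_ar s X Y f \<oplus>\<^bsub>hmod D ?X ?Y\<^esub> glue_ar s X Y g"
      proof (rule eqI)
        show "f \<oplus>\<^bsub>hmod C X Y\<^esub> g \<in> Hom C X Y" using f g M.M.a_closed cM by blast
        show "glue_ar s X Y f \<oplus>\<^bsub>hmod D ?X ?Y\<^esub> glue_ar s X Y g \<in> Hom D ?X ?Y"
          using f g glc N.M.a_closed cM cN by simp
        show "Cmp D ?X ?Y ?Y' (ce s (rank Y) m Y) (glue_ar s X Y f \<oplus>\<^bsub>hmod D ?X ?Y\<^esub> glue_ar s X Y g) =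
            Cmp D ?X ?X' ?Y' (ar s m X Y (f \<oplus>\<^bsub>hmod C X Y\<^esub> g)) (ce s (rank X) m X)"
          using f g glc gl arc cM cN linear_mapD(2)[OF post] linear_mapD(2)[OF pre] linear_mapD(2)[OF ar] by simp
      qed
    }
    fix a assume a: "a \<in> carrier k"
    show "glue_ar s X Y (a \<odot>\<^bsub>hmod C X Y\<^esub> f) = a \<odot>\<^bsub>hmod D ?X ?Y\<^esub> glue_ar s X Y f"
    proof (rule eqI)
      show "a \<odot>\<^bsub>hmod C X Y\<^esub> f \<in> Hom C X Y" using a f M.smult_closed cM by blast
      show "a \<odot>\<^bsub>hmod D ?X ?Y\<^esub> glue_ar s X Y f \<in> Hom D ?X ?Y"
        using a f glc N.smult_closed cM cN by simp
      show "Cmp D ?X ?Y ?Y' (ce s (rank Y) m Y) (a \<odot>\<^bsub>hmod D ?X ?Y\<^esub> glue_ar s X Y f) =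
          Cmp D ?X ?X' ?Y' (ar s m X Y (a \<odot>\<^bsub>hmod C X Y\<^esub> f)) (ce s (rank X) m X)"
        using a f glc gl arc cM cN linear_mapD(3)[OF post] linear_mapD(3)[OF pre] linear_mapD(3)[OF ar] by simp
    qed
  qed
  moreover have "far (glue s) X Y f = glue_ar s X Y f" if "f \<in> carrier (hmod C X Y)" for f
    using that XY cM by (simp add: glue_simps)
  ultimately show "linear_map k (hmod C X Y) (hmod D (fob (glue s) X) (fob (glue s) Y)) (far (glue s) X Y)"
    using XY M.M.a_closed M.smult_closed by (auto simp: linear_map_def glue_simps(1))
qed

abbreviation "FC \<equiv> klinear_functor_cat k C D"
abbreviation "PS \<equiv> Psnat k I P D"

definition glue_nat where
  "glue_nat \<mu> = (\<lambda>X\<in>Obj C. \<mu> (rank X) X)"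

text \<open>At a common stage \<open>m\<close> the glued square of \<open>s\<close> is pasted with
  the naturality square of \<open>\<mu> m\<close>. Compatibility of \<mu> with the cells rewrites
  the vertical sides so that they end in the cells of \<open>t\<close>, and these cancel against the
  glued square of \<open>t\<close>.\<close>

lemma is_nat_trans_glue_nat:
  assumes s: "psnat s" and t: "psnat t" and \<mu>: "is_modification I P D s t \<mu>"
  shows "is_nat_trans C D (glue s) (glue t) (glue_nat \<mu>)"
  unfolding is_nat_trans_iff_square[OF is_functor_glue[OF s] is_functor_glue[OF t]]
proof (intro conjI ballI)
  show "glue_nat \<mu> \<in> extensional (Obj C)" by (simp add: glue_nat_def)
  have mod: "\<mu> (rank X) X \<in> Hom D (ob s (rank X) X) (ob t (rank X) X)" if "X \<in> Obj C" for X
    by (rule modificationD(1)[OF \<mu> s t rank(1,2)[OF that]])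
  fix X assume X: "X \<in> Obj C"
  show "glue_nat \<mu> X \<in> Hom D (fob (glue s) X) (fob (glue t) X)"
    using mod[OF X] X by (simp add: glue_nat_def glue_simps)
  fix Y f assume Y: "Y \<in> Obj C" and f: "f \<in> Hom C X Y"
  obtain m where m: "m \<in> A" "X \<in> S m" "Y \<in> S m" by (rule common_rank[OF X Y Y])
  have cell: "Cmp D (ob s (rank Z) Z) (ob s m Z) (ob t m Z) (\<mu> m Z) (ce s (rank Z) m Z) =
      Cmp D (ob s (rank Z) Z) (ob t (rank Z) Z) (ob t m Z) (ce t (rank Z) m Z) (\<mu> (rank Z) Z)"
    if "Z \<in> Obj C" "Z \<in> S m" for Z
    using modificationD(3)[OF \<mu> s t rank(1)[OF that(1)] m(1) rank(3)[OF that(1) m(1) that(2)] rank(2)[OF that(1)]]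
    by (simp add: square_def)
  have "square D (ob s (rank X) X) (ob s (rank Y) Y) (ob t m X) (ob t m Y) (glue_ar s X Y f)
      (Cmp D (ob s (rank X) X) (ob s m X) (ob t m X) (\<mu> m X) (ce s (rank X) m X))
      (Cmp D (ob s (rank Y) Y) (ob s m Y) (ob t m Y) (\<mu> m Y) (ce s (rank Y) m Y)) (ar t m X Y f)"
    by (rule D.square_vcomp[OF _ _ _ _ _ _ glue_ar_square[OF s f m, unfolded glue_square_def]
          modificationD(2)[OF \<mu> s t m f]])
      (simp_all add: rank_ob_closed ob_closed s t X Y m)
  then have "square D (ob s (rank X) X) (ob s (rank Y) Y) (ob t (rank X) X) (ob t (rank Y) Y)
      (glue_ar s X Y f) (\<mu> (rank X) X) (\<mu> (rank Y) Y) (glue_ar t X Y f)"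
    unfolding cell[OF X m(2)] cell[OF Y m(3)]
    by (rule D.square_cancel[rotated 6, OF _ glue_ar_square[OF t f m, unfolded glue_square_def]
          mod[OF X] mod[OF Y] rank_ce_iso[OF t m(1,3)]])
      (simp_all add: rank_ob_closed ob_closed s t X Y m)
  then show "square D (fob (glue s) X) (fob (glue s) Y) (fob (glue t) X) (fob (glue t) Y)
      (far (glue s) X Y f) (glue_nat \<mu> X) (glue_nat \<mu> Y) (far (glue t) X Y f)"
    using X Y f by (simp add: glue_nat_def glue_simps)
qed

section \<open>Restricting functors and natural transformations to the stages\<close>

definition restr where
  "restr H = mk_psnat I (\<lambda>i. fct_comp (stage i) H (fct_id (stage i))) (\<lambda>i j _. \<lambda>X\<in>S i. Idn D (fob H X))"

lemma restr_simps:
  "\<lbrakk>i \<in> A; X \<in> S i\<rbrakk> \<Longrightarrow> ob (restr H) i X = fob H X"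
  "\<lbrakk>i \<in> A; X \<in> S i; Y \<in> S i; f \<in> Hom C X Y\<rbrakk> \<Longrightarrow> ar (restr H) i X Y f = far H X Y f"
  "\<lbrakk>i \<in> A; j \<in> A; (i, j) \<in> r\<rbrakk> \<Longrightarrow> pn_cell (restr H) i j u = (\<lambda>X\<in>S i. Idn D (fob H X))"
  by (simp_all add: restr_def mk_psnat_simps fct_comp_simps fct_id_simps restrict_def)

lemma psnat_restr:
  assumes H: "klinear_functor k C D H"
  shows "psnat (restr H)"
proof (rule psnatI)
  have HF: "is_functor C D H" using H by (simp add: klinear_functor_def)
  note H' = is_functorD(1,2)[OF HF]
  show "mk_psnat I (pn_ob (restr H)) (pn_cell (restr H)) = restr H"
    unfolding restr_def by (rule mk_psnat_eqI) (simp_all add: mk_psnat_simps restrict_def)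
  fix i assume i: "i \<in> A"
  have "is_functor (stage i) D (fct_comp (stage i) H (fct_id (stage i)))"
  proof (rule is_functor_fct_comp[OF _ _ HF])
    show "category (stage i)" using klinear_category_stage[OF i] by (rule klinear_category.axioms)
    show "is_functor (stage i) C (fct_id (stage i))"
      using C.klinear_functor_inclusion[OF S_subset[OF i] S_subset[OF i]]
      unfolding full_subcategory_Obj klinear_functor_def by blast
  qed
  moreover have "linear_map k (hmod C X Y) (hmod D (ob (restr H) i X) (ob (restr H) i Y)) (far (pn_ob (restr H) i) X Y)"
    if XY: "X \<in> S i" "Y \<in> S i" for X Y
  proof -
    note XY' = S_Obj[OF i XY(1)] S_Obj[OF i XY(2)]
    interpret M: module k "hmod C X Y" by (rule C.hmod_module[OF XY'])
    have "linear_map k (hmod C X Y) (hmod D (fob H X) (fob H Y)) (far H X Y)"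
      using H XY' by (simp add: klinear_functor_def)
    moreover have "ar (restr H) i X Y f = far H X Y f" if "f \<in> carrier (hmod C X Y)" for f
      using restr_simps(2)[OF i XY] that C.hmod_carrier[OF XY'] by simp
    ultimately show ?thesis
      using M.M.a_closed M.smult_closed restr_simps(1)[OF i] XY by (auto simp: linear_map_def)
  qed
  moreover have "pn_ob (restr H) i = fct_comp (stage i) H (fct_id (stage i))"
    using i by (simp add: restr_def mk_psnat_simps)
  ultimately show "klinear_functor k (stage i) D (pn_ob (restr H) i)"
    by (simp add: klinear_functor_def)
  { fix X assume "X \<in> S i"
    then show "ce (restr H) i i X = Idn D (ob (restr H) i X)" using i r_refl by (simp add: restr_simps) }
  fix j assume j: "j \<in> A" "(i, j) \<in> r"
  show "pn_cell (restr H) i j () \<in> extensional (S i)" using i j by (simp add: restr_simps)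
  fix X assume X: "X \<in> S i"
  have XC: "X \<in> Obj C" "X \<in> S j" using S_Obj[OF i X] S_le[OF i j X] by blast+
  show "is_iso D (ob (restr H) i X) (ob (restr H) j X) (ce (restr H) i j X)"
    using i j X XC H'(1) D.Idn_closed D.Cmp_Idn_left by (auto simp: restr_simps is_iso_def)
  { fix l assume l: "l \<in> A" "(j, l) \<in> r"
    then have "X \<in> S l" "(i, l) \<in> r" using S_le[OF j(1) l XC(2)] r_trans j by blast+
    then show "ce (restr H) i l X = Cmp D (ob (restr H) i X) (ob (restr H) j X) (ob (restr H) l X)
        (ce (restr H) j l X) (ce (restr H) i j X)"
      using i j l X XC H'(1) D.Idn_closed D.Cmp_Idn_left by (simp add: restr_simps) }
  fix Y f assume Y: "Y \<in> S i" and f: "f \<in> Hom C X Y"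
  have YC: "Y \<in> Obj C" "Y \<in> S j" using S_Obj[OF i Y] S_le[OF i j Y] by blast+
  show "square D (ob (restr H) i X) (ob (restr H) i Y) (ob (restr H) j X) (ob (restr H) j Y)
      (ar (restr H) i X Y f) (ce (restr H) i j X) (ce (restr H) i j Y) (ar (restr H) j X Y f)"
    using D.square_Idn[OF H'(1)[OF XC(1)] H'(1)[OF YC(1)] H'(2)[OF XC(1) YC(1) f]] i j X Y f XC YC
    by (simp add: restr_simps)
qed

definition restr_nat where
  "restr_nat \<eta> = (\<lambda>i\<in>A. \<lambda>X\<in>S i. \<eta> X)"

lemma is_modification_restr_nat:
  assumes G: "klinear_functor k C D G" and H: "klinear_functor k C D H"
    and \<eta>: "is_nat_trans C D G H \<eta>"
  shows "is_modification I P D (restr G) (restr H) (restr_nat \<eta>)"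
proof -
  have F: "is_functor C D G" "is_functor C D H" using G H by (simp_all add: klinear_functor_def)
  have \<eta>c: "\<eta> X \<in> Hom D (fob G X) (fob H X)" if "X \<in> Obj C" for X
    using \<eta> that by (simp add: is_nat_trans_def)
  have \<eta>s: "square D (fob G X) (fob G Y) (fob H X) (fob H Y) (far G X Y f) (\<eta> X) (\<eta> Y) (far H X Y f)"
    if "X \<in> Obj C" "Y \<in> Obj C" "f \<in> Hom C X Y" for X Y f
    using \<eta> that unfolding is_nat_trans_iff_square[OF F] by blast
  show ?thesis
    unfolding is_modification_iff[OF psnat_restr[OF G] psnat_restr[OF H]]
  proof (intro conjI ballI impI)
    fix i X assume i: "i \<in> A" and X: "X \<in> S i"
    note XC = S_Obj[OF i X]
    show "restr_nat \<eta> i X \<in> Hom D (ob (restr G) i X) (ob (restr H) i X)"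
      using i X \<eta>c[OF XC] by (simp add: restr_nat_def restr_simps)
    { fix Y f assume Y: "Y \<in> S i" "f \<in> Hom C X Y"
      then show "square D (ob (restr G) i X) (ob (restr G) i Y) (ob (restr H) i X) (ob (restr H) i Y)
          (ar (restr G) i X Y f) (restr_nat \<eta> i X) (restr_nat \<eta> i Y) (ar (restr H) i X Y f)"
        using i X \<eta>s[OF XC S_Obj[OF i Y(1)] Y(2)] by (simp add: restr_nat_def restr_simps) }
    fix j assume j: "j \<in> A" "(i, j) \<in> r"
    show "square D (ob (restr G) i X) (ob (restr G) j X) (ob (restr H) i X) (ob (restr H) j X)
        (ce (restr G) i j X) (restr_nat \<eta> i X) (restr_nat \<eta> j X) (ce (restr H) i j X)"
      using i j X S_le[OF i j X]
        D.square_Idn[OF is_functorD(1)[OF F(1) XC] is_functorD(1)[OF F(2) XC] \<eta>c[OF XC], THEN square_transpose]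
      by (simp add: restr_nat_def restr_simps)
  qed (auto simp: restr_nat_def)
qed

abbreviation "R \<equiv> induced_functor k I P C (full_chain_inclusions C I S) D"

text \<open>The cells of the inclusions are identities and \<open>G\<close> preserves them, so
  composing with the inclusions is plain restriction to the stages.\<close>

lemma induced_functor_eq: "R = mk_fct FC restr (\<lambda>G H. restr_nat)"
  unfolding induced_functor_def
proof (rule mk_fct_eqI)
  have incl: "pn_ob (full_chain_inclusions C I S) i = fct_id (stage i)" if "i \<in> A" for i
    using that by (simp add: full_chain_inclusions_def mk_psnat_simps)
  {
    fix G assume "G \<in> Obj FC"
    then have "is_functor C D G" by (simp add: klinear_functor_cat_simps klinear_functor_def)
    note G = is_functorD(3)[OF this]
    show "mk_psnat I (\<lambda>i. fct_comp (pf_ob P i) G (pn_ob (full_chain_inclusions C I S) i))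
         (\<lambda>i j f. \<lambda>x\<in>Obj (pf_ob P i). far G (fob (pn_ob (full_chain_inclusions C I S) i) x)
           (fob (pn_ob (full_chain_inclusions C I S) j) (fob (pf_ar P i j f) x))
           (pn_cell (full_chain_inclusions C I S) i j f x)) = restr G"
      unfolding restr_def
    proof (rule mk_psnat_eqI)
      fix i j f assume "i \<in> Obj I" "j \<in> Obj I" "f \<in> Hom I i j"
      then have ij: "i \<in> A" "j \<in> A" "(i, j) \<in> r" by simp_all
      then have ce: "pn_cell (full_chain_inclusions C I S) i j () = (\<lambda>X\<in>S i. Idn C X)"
        by (simp add: full_chain_inclusions_def mk_psnat_simps restrict_def)
      show "(\<lambda>x\<in>Obj (pf_ob P i). far G (fob (pn_ob (full_chain_inclusions C I S) i) x)
           (fob (pn_ob (full_chain_inclusions C I S) j) (fob (pf_ar P i j f) x))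
           (pn_cell (full_chain_inclusions C I S) i j f x)) = (\<lambda>X\<in>S i. Idn D (fob G X))"
        using G ij S_Obj[OF ij(1)] S_le[OF ij] by (simp add: incl ce fct_id_simps cong: restrict_cong)
    qed (simp add: incl)
  }
  fix G H \<eta>
  show "(\<lambda>i\<in>Obj I. \<lambda>x\<in>Obj (pf_ob P i). \<eta> (fob (pn_ob (full_chain_inclusions C I S) i) x)) = restr_nat \<eta>"
    by (simp add: restr_nat_def incl fct_id_simps cong: restrict_cong)
qed

lemma R_simps:
  "klinear_functor k C D G \<Longrightarrow> fob R G = restr G"
  "\<lbrakk>klinear_functor k C D G; klinear_functor k C D H; is_nat_trans C D G H \<eta>\<rbrakk> \<Longrightarrow> far R G H \<eta> = restr_nat \<eta>"
  by (simp_all add: induced_functor_eq mk_fct_simps klinear_functor_cat_simps)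

lemma is_functor_R: "is_functor FC PS R"
  unfolding induced_functor_eq
proof (rule is_functor_mk_fct[OF category_klinear_functor_cat[OF D.category_axioms]];
    unfold klinear_functor_cat_simps Psnat_simps mem_Collect_eq)
  show "restr_nat (\<lambda>a\<in>Obj C. Idn D (fob F a)) = (\<lambda>i\<in>A. \<lambda>X\<in>S i. Idn D (ob (restr F) i X))" for F
    by (simp add: restr_nat_def restr_simps S_Obj cong: restrict_cong)
  show "restr_nat (\<lambda>a\<in>Obj C. Cmp D (fob F a) (fob G a) (fob H a) (\<theta> a) (\<eta> a)) =
      (\<lambda>i\<in>A. \<lambda>X\<in>S i. Cmp D (ob (restr F) i X) (ob (restr G) i X) (ob (restr H) i X) (restr_nat \<theta> i X) (restr_nat \<eta> i X))"
    for F G H \<eta> \<theta>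
    by (simp add: restr_nat_def restr_simps S_Obj cong: restrict_cong)
qed (use psnat_restr is_modification_restr_nat in blast)+

section \<open>Restriction and gluing as inverse equivalences\<close>

definition Glue where
  "Glue = mk_fct PS glue (\<lambda>s t. glue_nat)"

lemma Glue_simps:
  "psnat s \<Longrightarrow> fob Glue s = glue s"
  "\<lbrakk>psnat s; psnat t; is_modification I P D s t \<mu>\<rbrakk> \<Longrightarrow> far Glue s t \<mu> = glue_nat \<mu>"
  by (simp_all add: Glue_def mk_fct_simps Psnat_simps)

lemma category_Psnat: "category PS"
proof (rule category.intro; unfold Psnat_simps mem_Collect_eq)
  fix s assume s: "psnat s"
  show "is_modification I P D s s (\<lambda>i\<in>A. \<lambda>X\<in>S i. Idn D (ob s i X))"
    unfolding is_modification_iff[OF s s]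
    using D.Idn_closed D.square_Idn[THEN square_transpose] D.square_Idn ob_closed[OF s] ar_closed[OF s]
      ce_closed[OF s] S_le by (auto simp: restrict_def extensional_def)
next
  fix s t u \<mu> \<nu>
  assume st: "psnat s" "psnat t" "psnat u"
    and \<mu>: "is_modification I P D s t \<mu>" and \<nu>: "is_modification I P D t u \<nu>"
  show "is_modification I P D s u (\<lambda>i\<in>A. \<lambda>X\<in>S i. Cmp D (ob s i X) (ob t i X) (ob u i X) (\<nu> i X) (\<mu> i X))"
    (is "is_modification I P D s u ?\<kappa>")
    unfolding is_modification_iff[OF st(1,3)]
  proof (intro conjI ballI impI)
    fix i X assume i: "i \<in> A" and X: "X \<in> S i"
    show "?\<kappa> i X \<in> Hom D (ob s i X) (ob u i X)"
      using D.Cmp_closed modificationD(1)[OF \<mu> st(1,2)] modificationD(1)[OF \<nu> st(2,3)] ob_closed st i X by simp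
    { fix Y f assume Y: "Y \<in> S i" "f \<in> Hom C X Y"
      have "square D (ob s i X) (ob s i Y) (ob u i X) (ob u i Y) (ar s i X Y f)
          (Cmp D (ob s i X) (ob t i X) (ob u i X) (\<nu> i X) (\<mu> i X))
          (Cmp D (ob s i Y) (ob t i Y) (ob u i Y) (\<nu> i Y) (\<mu> i Y)) (ar u i X Y f)"
        by (rule D.square_vcomp[OF _ _ _ _ _ _ modificationD(2)[OF \<mu> st(1,2) i X Y]
              modificationD(2)[OF \<nu> st(2,3) i X Y]]) (simp_all add: ob_closed st i X Y)
      then show "square D (ob s i X) (ob s i Y) (ob u i X) (ob u i Y) (ar s i X Y f) (?\<kappa> i X) (?\<kappa> i Y) (ar u i X Y f)"
        using i X Y by simp }
    fix j assume j: "j \<in> A" "(i, j) \<in> r"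
    have Xj: "X \<in> S j" by (rule S_le[OF i j X])
    have "square D (ob s i X) (ob s j X) (ob u i X) (ob u j X) (ce s i j X)
        (Cmp D (ob s i X) (ob t i X) (ob u i X) (\<nu> i X) (\<mu> i X))
        (Cmp D (ob s j X) (ob t j X) (ob u j X) (\<nu> j X) (\<mu> j X)) (ce u i j X)"
      by (rule D.square_vcomp[OF _ _ _ _ _ _ modificationD(3)[OF \<mu> st(1,2) i j X]
            modificationD(3)[OF \<nu> st(2,3) i j X]]) (simp_all add: ob_closed st i j X Xj)
    then show "square D (ob s i X) (ob s j X) (ob u i X) (ob u j X) (ce s i j X) (?\<kappa> i X) (?\<kappa> j X) (ce u i j X)"
      using i j X Xj by simp
  qed simp_all
next
  fix s t \<mu> assume st: "psnat s" "psnat t" and \<mu>: "is_modification I P D s t \<mu>"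
  have ext: "\<mu> = (\<lambda>i\<in>A. \<lambda>X\<in>S i. \<mu> i X)"
    using \<mu> unfolding is_modification_iff[OF st] by (simp add: extensional_restrict cong: restrict_cong)
  note \<mu>c = modificationD(1)[OF \<mu> st]
  show "(\<lambda>i\<in>A. \<lambda>X\<in>S i. Cmp D (ob s i X) (ob s i X) (ob t i X) (\<mu> i X) ((\<lambda>i\<in>A. \<lambda>X\<in>S i. Idn D (ob s i X)) i X)) = \<mu>"
    by (subst (2) ext, intro restrict_ext) (use \<mu>c ob_closed st D.Cmp_Idn_right in simp)
  show "(\<lambda>i\<in>A. \<lambda>X\<in>S i. Cmp D (ob s i X) (ob t i X) (ob t i X) ((\<lambda>i\<in>A. \<lambda>X\<in>S i. Idn D (ob t i X)) i X) (\<mu> i X)) = \<mu>"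
    by (subst (2) ext, intro restrict_ext) (use \<mu>c ob_closed st D.Cmp_Idn_left in simp)
next
  fix s t u v \<mu> \<nu> \<kappa>
  assume st: "psnat s" "psnat t" "psnat u" "psnat v" and \<mu>: "is_modification I P D s t \<mu>"
    and \<nu>: "is_modification I P D t u \<nu>" and \<kappa>: "is_modification I P D u v \<kappa>"
  show "(\<lambda>i\<in>A. \<lambda>X\<in>S i. Cmp D (ob s i X) (ob u i X) (ob v i X) (\<kappa> i X)
          ((\<lambda>i\<in>A. \<lambda>X\<in>S i. Cmp D (ob s i X) (ob t i X) (ob u i X) (\<nu> i X) (\<mu> i X)) i X)) =
      (\<lambda>i\<in>A. \<lambda>X\<in>S i. Cmp D (ob s i X) (ob t i X) (ob v i X)
          ((\<lambda>i\<in>A. \<lambda>X\<in>S i. Cmp D (ob t i X) (ob u i X) (ob v i X) (\<kappa> i X) (\<nu> i X)) i X) (\<mu> i X))"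
    by (intro restrict_ext) (use D.Cmp_assoc ob_closed st modificationD(1)[OF \<mu> st(1,2)]
        modificationD(1)[OF \<nu> st(2,3)] modificationD(1)[OF \<kappa> st(3,4)] in simp)
qed

lemma is_functor_Glue: "is_functor PS FC Glue"
  unfolding Glue_def
proof (rule is_functor_mk_fct[OF category_Psnat]; unfold klinear_functor_cat_simps Psnat_simps mem_Collect_eq)
  show "glue_nat (\<lambda>i\<in>A. \<lambda>X\<in>S i. Idn D (ob s i X)) = (\<lambda>X\<in>Obj C. Idn D (fob (glue s) X))" for s
    unfolding glue_nat_def by (rule restrict_ext) (use rank in \<open>simp add: glue_simps\<close>)
  show "glue_nat (\<lambda>i\<in>A. \<lambda>X\<in>S i. Cmp D (ob s i X) (ob t i X) (ob u i X) (\<nu> i X) (\<mu> i X)) =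
      (\<lambda>X\<in>Obj C. Cmp D (fob (glue s) X) (fob (glue t) X) (fob (glue u) X) (glue_nat \<nu> X) (glue_nat \<mu> X))"
    for s t u \<mu> \<nu>
    unfolding glue_nat_def by (rule restrict_ext) (use rank in \<open>simp add: glue_simps\<close>)
qed (use klinear_functor_glue is_nat_trans_glue_nat in blast)+

text \<open>The cells of \<open>restr H\<close> are identities, so carrying the value of an arrow
  back along them does not change it.\<close>

lemma glue_restr:
  assumes "klinear_functor k C D H"
  shows "glue (restr H) = H"
proof -
  have HF: "is_functor C D H" using assms by (simp add: klinear_functor_def)
  note H = is_functorD(1,2)[OF HF] and p = psnat_restr[OF assms]
  have "mk_fct C (\<lambda>X. ob (restr H) (rank X) X) (glue_ar (restr H)) = mk_fct C (fob H) (far H)"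
  proof (rule mk_fct_eqI)
    show "ob (restr H) (rank X) X = fob H X" if "X \<in> Obj C" for X
      using rank[OF that] by (simp add: restr_simps)
    fix X Y f assume XY: "X \<in> Obj C" "Y \<in> Obj C" "f \<in> Hom C X Y"
    obtain m where m: "m \<in> A" "X \<in> S m" "Y \<in> S m" by (rule common_rank[OF XY(1,2,2)])
    have "glue_square (restr H) X Y (far H X Y f) m f"
      unfolding glue_square_def
      using D.square_Idn[OF H(1)[OF XY(1)] H(1)[OF XY(2)] H(2)[OF XY]] m XY rank[OF XY(1)] rank[OF XY(2)]
      by (simp add: restr_simps)
    then show "glue_ar (restr H) X Y f = far H X Y f" by (rule glue_ar_eqI[OF p XY(3) m])
  qed
  then show ?thesis unfolding glue_def is_functor_eq[OF HF] .
qed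

text \<open>An equality of functors rather than an isomorphism, so the unit of the equivalence is an
  identity transformation.\<close>

lemma Glue_R: "fct_comp FC Glue R = fct_id FC"
  unfolding fct_comp_def fct_id_def
proof (rule mk_fct_eqI; unfold klinear_functor_cat_simps mem_Collect_eq)
  show "fob Glue (fob R H) = H" if "klinear_functor k C D H" for H
    using that by (simp add: R_simps Glue_simps psnat_restr glue_restr)
  fix G H \<eta> assume a: "klinear_functor k C D G" "klinear_functor k C D H" "is_nat_trans C D G H \<eta>"
  have "glue_nat (restr_nat \<eta>) = (\<lambda>X\<in>Obj C. \<eta> X)"
    unfolding glue_nat_def restr_nat_def by (rule restrict_ext) (use rank in simp)
  also have "\<dots> = \<eta>" using a(3) by (simp add: is_nat_trans_def extensional_restrict)
  finally show "far Glue (fob R G) (fob R H) (far R G H \<eta>) = \<eta>"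
    using a by (simp add: R_simps Glue_simps psnat_restr is_modification_restr_nat)
qed

definition counit where
  "counit s = (\<lambda>i\<in>A. \<lambda>X\<in>S i. ce s (rank X) i X)"

text \<open>The glued functor takes its values at the least stages, and the cells carry them to
  stage \<open>i\<close>. Naturality is the defining square of \<open>glue_ar\<close>, and
  compatibility with the cells is \<open>ce_Cmp\<close>.\<close>

lemma is_modification_counit:
  assumes s: "psnat s"
  shows "is_modification I P D (restr (glue s)) s (counit s)"
  unfolding is_modification_iff[OF psnat_restr[OF klinear_functor_glue[OF s]] s]
proof (intro conjI ballI impI)
  fix i X assume i: "i \<in> A" and X: "X \<in> S i"
  note XC = S_Obj[OF i X]
  show "counit s i X \<in> Hom D (ob (restr (glue s)) i X) (ob s i X)"
    using i X XC rank_ce_closed[OF s i X] by (simp add: counit_def restr_simps glue_simps)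
  { fix Y f assume Y: "Y \<in> S i" "f \<in> Hom C X Y"
    then show "square D (ob (restr (glue s)) i X) (ob (restr (glue s)) i Y) (ob s i X) (ob s i Y)
        (ar (restr (glue s)) i X Y f) (counit s i X) (counit s i Y) (ar s i X Y f)"
      using i X XC S_Obj[OF i Y(1)] glue_ar_square[OF s Y(2) i X Y(1)]
      by (simp add: counit_def restr_simps glue_simps glue_square_def) }
  fix j assume j: "j \<in> A" "(i, j) \<in> r"
  have Xj: "X \<in> S j" by (rule S_le[OF i j X])
  have "Cmp D (ob s (rank X) X) (ob s i X) (ob s j X) (ce s i j X) (ce s (rank X) i X) = ce s (rank X) j X"
    by (rule ce_Cmp[OF s rank(1)[OF XC] i j(1) rank(3)[OF XC i X] j(2) rank(2)[OF XC], symmetric])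
  then have "square D (ob s (rank X) X) (ob s (rank X) X) (ob s i X) (ob s j X)
      (Idn D (ob s (rank X) X)) (ce s (rank X) i X) (ce s (rank X) j X) (ce s i j X)"
    using rank_ce_closed[OF s i X] rank_ce_closed[OF s j(1) Xj] ce_closed[OF s i j X] rank_ob_closed[OF s XC]
      ob_closed[OF s j(1) Xj] D.Idn_closed D.Cmp_Idn_right by (simp add: square_def)
  then show "square D (ob (restr (glue s)) i X) (ob (restr (glue s)) j X) (ob s i X) (ob s j X)
      (ce (restr (glue s)) i j X) (counit s i X) (counit s j X) (ce s i j X)"
    using i j X Xj XC by (simp add: counit_def restr_simps glue_simps)
qed (auto simp: counit_def)

text \<open>Naturality in \<open>s\<close> is the compatibility of a modification with the cell from
  the least stage of \<open>X\<close> to \<open>i\<close>; invertibility is that of the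
  cells.\<close>

lemma is_nat_iso_counit:
  "is_nat_iso PS PS (fct_comp PS R Glue) (fct_id PS) (\<lambda>s\<in>Obj PS. counit s)"
  unfolding is_nat_iso_def is_nat_trans_def
proof (intro conjI ballI)
  have RG: "fob (fct_comp PS R Glue) s = restr (glue s)" if "psnat s" for s
    using that by (simp add: fct_comp_simps Psnat_simps Glue_simps R_simps klinear_functor_glue)
  fix s assume "s \<in> Obj PS"
  then have s: "psnat s" by (simp add: Psnat_simps)
  show "(\<lambda>s\<in>Obj PS. counit s) s \<in> Hom PS (fob (fct_comp PS R Glue) s) (fob (fct_id PS) s)"
    using s is_modification_counit[OF s] by (simp add: RG fct_id_simps Psnat_simps)
  have "is_iso PS (restr (glue s)) s (counit s)"
  proof (rule is_iso_Psnat[OF is_modification_counit[OF s] psnat_restr[OF klinear_functor_glue[OF s]] s])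
    fix i X assume i: "i \<in> A" "X \<in> S i"
    then show "is_iso D (ob (restr (glue s)) i X) (ob s i X) (counit s i X)"
      using rank_ce_iso[OF s i] S_Obj[OF i] by (simp add: counit_def restr_simps glue_simps)
  qed
  then show "is_iso PS (fob (fct_comp PS R Glue) s) (fob (fct_id PS) s) ((\<lambda>s\<in>Obj PS. counit s) s)"
    using s by (simp add: RG fct_id_simps Psnat_simps)
  fix t \<mu> assume "t \<in> Obj PS" and "\<mu> \<in> Hom PS s t"
  then have t: "psnat t" and \<mu>: "is_modification I P D s t \<mu>" by (simp_all add: Psnat_simps)
  have RGa: "far (fct_comp PS R Glue) s t \<mu> = restr_nat (glue_nat \<mu>)"
    using s t \<mu> by (simp add: fct_comp_simps Psnat_simps Glue_simps R_simps klinear_functor_glue is_nat_trans_glue_nat)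
  have "Cmp D (ob (restr (glue s)) i X) (ob (restr (glue t)) i X) (ob t i X) (counit t i X) (restr_nat (glue_nat \<mu>) i X) =
      Cmp D (ob (restr (glue s)) i X) (ob s i X) (ob t i X) (\<mu> i X) (counit s i X)"
    if i: "i \<in> A" "X \<in> S i" for i X
    using modificationD(3)[OF \<mu> s t rank(1) i(1) rank(3) rank(2), of X] i S_Obj[OF i]
    by (simp add: square_def counit_def restr_nat_def glue_nat_def restr_simps glue_simps)
  then show "Cmp PS (fob (fct_comp PS R Glue) s) (fob (fct_comp PS R Glue) t) (fob (fct_id PS) t)
        ((\<lambda>s\<in>Obj PS. counit s) t) (far (fct_comp PS R Glue) s t \<mu>) =
      Cmp PS (fob (fct_comp PS R Glue) s) (fob (fct_id PS) s) (fob (fct_id PS) t)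
        (far (fct_id PS) s t \<mu>) ((\<lambda>s\<in>Obj PS. counit s) s)"
    using s t \<mu> unfolding RGa by (simp add: RG fct_id_simps Psnat_simps cong: restrict_cong)
qed simp

lemma is_equivalence_R: "is_equivalence FC PS R"
  unfolding is_equivalence_def
  \<comment> \<open>\<open>Glue_R\<close> identifies the composite with \<open>fct_id FC\<close>, so
    the identity transformation serves as the unit.\<close>
  using is_functor_R is_functor_Glue is_nat_iso_counit
    category.is_nat_iso_Idn[OF category_klinear_functor_cat[OF D.category_axioms], of k C]
  unfolding Glue_R[symmetric] by (metis Glue_R)

end

section \<open>The bicolimit of a covering chain\<close>

context covering_chain
begin

text \<open>With \<open>C\<close> itself as test category, the inclusions are the restriction of the
  identity functor.\<close>

lemma is_psnat_inclusions: "is_psnat k I P C (full_chain_inclusions C I S)"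
proof -
  interpret T: chain_test k C A r S C by unfold_locales
  have "klinear_functor k C C (fct_id C)"
    using C.klinear_functor_inclusion[of "Obj C" "Obj C"] by (simp add: full_subcategory_Obj)
  then have "is_psnat k I P C (T.restr (fct_id C))" by (rule T.psnat_restr)
  moreover have "T.restr (fct_id C) = full_chain_inclusions C I S"
    unfolding T.restr_def full_chain_inclusions_def
  proof (rule mk_psnat_eqI)
    fix i assume "i \<in> Obj I" then have i: "i \<in> A" by simp
    show "fct_comp (full_subcategory C (S i)) (fct_id C) (fct_id (full_subcategory C (S i))) = fct_id (full_subcategory C (S i))"
      unfolding fct_comp_def fct_id_def[of "full_subcategory C (S i)"]
      by (rule mk_fct_eqI) (simp_all add: mk_fct_simps fct_id_simps S_Obj[OF i])
    show "(\<lambda>X\<in>S i. Idn C (fob (fct_id C) X)) = (\<lambda>X\<in>S i. Idn C X)"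
      by (rule restrict_ext) (simp add: fct_id_simps S_Obj[OF i])
  qed
  ultimately show ?thesis by simp
qed

theorem is_klinear_filtered_bicolimit_chain:
  "is_klinear_filtered_bicolimit TYPE('p) TYPE('n) k I P C (full_chain_inclusions C I S)"
  unfolding is_klinear_filtered_bicolimit_def
proof (intro conjI allI impI is_filtered_chain klinear_pseudofunctor_chain C.klinear_category_axioms
    is_psnat_inclusions)
  fix D :: "('p, 'n, 'k) kcat"
  assume "klinear_category k D"
  then interpret T: chain_test k C A r S D
    by (intro chain_test.intro covering_chain_axioms)
  show "is_equivalence (klinear_functor_cat k C D) (Psnat k I P D)
      (induced_functor k I P C (full_chain_inclusions C I S) D)"
    by (rule T.is_equivalence_R)
qed

end

section \<open>Specialization to the chain of presentable objects\<close>

theorem proposition1p2: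
  fixes k :: "('k, 'r) ring_scheme" and C :: "('o, 'u, 'k) kcat"
  assumes "inaccessible (univ_card :: 'u rel)"
    and "cring k" and "small TYPE('u) (carrier k)"
    and "klinear_category k C"
    and "locally_presentable k C"
  shows "is_klinear_filtered_bicolimit TYPE('p) TYPE('n) k Reg
           (presentables_diagram k C) C (presentables_inclusions k C)"
proof -
  interpret universe_klinear_category "TYPE('u)" k C
    by (intro universe_klinear_category.intro universe.intro assms(1,4))
  define S where "S \<alpha> = {X. presentable k C \<alpha> X}" for \<alpha>
  interpret covering_chain k C small_regular_cardinals univ_card S
  proof (intro covering_chain.intro covering_chain_axioms.intro assms(4))
    show "small_regular_cardinals \<noteq> ({} :: 'u set)"
      using assms(5) by (auto simp: locally_presentable_def)
    show "(\<alpha>, \<alpha>) \<in> univ_card" for \<alpha> :: 'u by (rule univ_card_refl)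
    show "(\<alpha>, \<beta>) \<in> univ_card \<Longrightarrow> (\<beta>, \<gamma>) \<in> univ_card \<Longrightarrow> (\<alpha>, \<gamma>) \<in> univ_card" for \<alpha> \<beta> \<gamma> :: 'u
      by (rule univ_card_trans)
    show "(\<alpha>, \<beta>) \<in> univ_card \<or> (\<beta>, \<alpha>) \<in> univ_card" for \<alpha> \<beta> :: 'u by (rule univ_card_total)
    show "S \<alpha> \<subseteq> Obj C" for \<alpha> by (auto simp: S_def presentable_def)
    show "S \<alpha> \<subseteq> S \<beta>" if "(\<alpha>, \<beta>) \<in> univ_card" for \<alpha> \<beta>
      using presentable_mono[OF that] by (auto simp: S_def)
    fix X assume X: "X \<in> Obj C"
    \<comment> \<open>\<open>univ_card\<close> well-orders \<open>'u\<close>, so the nonempty set of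
      regular cardinals for which \<open>X\<close> is presentable has a least element.\<close>
    let ?B = "{\<alpha> \<in> small_regular_cardinals. X \<in> S \<alpha>}"
    have "?B \<noteq> {}" using locally_presentable_ex_presentable[OF assms(5) X] by (auto simp: S_def)
    then have "wo_rel.minim univ_card ?B \<in> ?B" "\<forall>\<beta>\<in>?B. (wo_rel.minim univ_card ?B, \<beta>) \<in> univ_card"
      using wo_rel.minim_in[OF wo_rel_univ_card, of ?B] wo_rel.minim_least[OF wo_rel_univ_card, of ?B]
      by (simp_all add: Field_univ_card)
    then show "\<exists>\<alpha>\<in>small_regular_cardinals. X \<in> S \<alpha> \<and> (\<forall>\<beta>\<in>small_regular_cardinals. X \<in> S \<beta> \<longrightarrow> (\<alpha>, \<beta>) \<in> univ_card)"
      by blast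
  qed
  have "presentables k C = (\<lambda>\<alpha>. full_subcategory C (S \<alpha>))"
    by (simp add: presentables_def S_def fun_eq_iff)
  then have "presentables_diagram k C = full_chain C S"
    "presentables_inclusions k C = full_chain_inclusions C (preorder_cat small_regular_cardinals univ_card) S"
    by (simp_all add: presentables_diagram_def full_chain_def presentables_inclusions_def
        full_chain_inclusions_def Reg_def)
  then show ?thesis
    unfolding Reg_def by (simp only: is_klinear_filtered_bicolimit_chain)
qed

end
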